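(* Let $n\geq 2$ and $k\in(-\infty,0]$. For every $R>0$ there exists $\epsilon>0$ such that for all metrics $g\in\mathcal{M}^\star_k(B^n)$ with $|f_{\overline g}-R|_{\mathcal{C}^1(S^{n-1})}\leq\epsilon$, $$\mathrm{I}(\Omega_{\overline g})\geq \mathrm{I}(\Omega_{\delta^k}),$$ where $\Omega\subset\mathbf{R}^n$, $\overline g$ and $f_{\overline g}$ are the domain, metric and radial function associated to $g$ by normal coordinates. Furthermore, for such $g$, $\mathrm{I}(\Omega_{\overline g})=\mathrm{I}(\Omega_{\delta^k})$ only if $\overline g=\delta^k$ on $\Omega$.
   Context: $B^n\subset\mathbf{R}^n$ is the closed unit ball with center $o$ (the origin). $\mathcal{M}_k(B^n)$ is the set of $\mathcal{C}^\infty$ Riemannian metrics on $B^n$ (smooth up to the boundary) with sectional curvature bounded above by $k$; $B^n_g:=(B^n,g)$. Star-shaped metrics: $\mathcal{M}^\star_k(B^n)\subset\mathcal{M}_k(B^n)$ consists of those $g$ for which $B^n_g$ is star-shaped with respect to its center $o$, i.e. there exists a domain $\overline{B^n_g}\subset T_oB^n_g\simeq\mathbf{R}^n$ such that the exponential map $\exp_o\colon\overline{B^n_g}\to B^n_g$ is a diffeomorphism, and the radial geodesics of $B^n_g$ (those emanating from $o$) meet $\partial B^n_g$ transversely. Normal coordinates: for $g\in\mathcal{M}^\star_k(B^n)$ let $g_o$ also denote the matrix $(g_{ij}(o))$ in the standard basis $e_i$ of $\mathbf{R}^n$, let $h=\sqrt{g_o}$ be its positive definite symmetric square root, and let $\overline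 e_i:=h^{-1}e_i$, which is a $g$-orthonormal basis of $T_oB^n_g$. Define $\phi\colon\mathbf{R}^n\to T_oB^n_g$ by $\phi(x)=\sum_i x_i\overline e_i$, and set $\Omega:=\phi^{-1}(\overline{B^n_g})$, $\widetilde{\exp}_o:=\exp_o\circ\phi|_\Omega\colon\Omega\to B^n$ (a diffeomorphism), $\overline g:=\widetilde{\exp}_o^{\,*}(g)$. Then $\Omega_{\overline g}:=(\Omega,\overline g)$ is isometric to $B^n_g$, and the standard coordinates of $\mathbf{R}^n$ are normal coordinates centered at $o$ on $\Omega_{\overline g}$. Radial function: for $\theta\in S^{n-1}$ (the Euclidean unit sphere), $f_{\overline g}(\theta)$ is the length of the radial geodesic of $\Omega_{\overline g}$ from $o$ to $\partial\Omega$ with initial direction $\theta$; this geodesic is $t\mapsto t\theta$, $0\leq t\leq f_{\overline g}(\theta)$, so $\Omega=\{t\theta:\theta\in S^{n-1},\,0\leq t\leq f_{\overline g}(\theta)\}$, and $f_{\overline g}$ is $\mathcal{C}^\infty$. $|\cdot|_{\mathcal{C}^1(S^{n-1})}$ is the usual $\mathcal{C}^1$-norm on functions on $S^{n-1}$, and $R$ is regarded as a constant function. $\delta^k$ is the metric of constant curvature $k$ on $\mathbf{R}^n$ in normal coordinates centered at $o$, i.e. in polar coordinates $\delta^k=dr^2+s_k(r)^2d\theta^2$ where $d\theta^2$ is the standard metric of $S^{n-1}$, $s_0(r)=r$, and $s_k(r)=\sinh(\sqrt{-k}\,r)/\sqrt{-k}$ for $k<0$; $\delta^0$ is the Euclidean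 metric. $\Omega_{\delta^k}:=(\Omega,\delta^k)$ with the same $\Omega$. The isoperimetric ratio of a compact Riemannian $n$-manifold $X$ with boundary is $\mathrm{I}(X):=|\partial X|^n/|X|^{n-1}$, where $|X|$ is the Riemannian volume and $|\partial X|$ the $(n-1)$-dimensional Riemannian volume of the boundary. *)

theory Defs
  imports "HOL-Analysis.Analysis"
begin

text \<open>Riemannian metrics on (subsets of) \<open>real ^ 'n\<close> are given by their matrices
  \<open>x \<mapsto> (g\<^sub>i\<^sub>j(x))\<close> in the standard basis. On a closed region \<open>S\<close>, all derivatives are taken
  within \<open>S\<close>, so that they also make sense (as one-sided derivatives) at boundary points.\<close>

type_synonym 'n metric = "real ^ 'n \<Rightarrow> real ^ 'n ^ 'n"

section \<open>Smoothness\<close>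

fun Ck_open :: "nat \<Rightarrow> 'a::euclidean_space set \<Rightarrow> ('a \<Rightarrow> 'b::real_normed_vector) \<Rightarrow> bool" where
  "Ck_open 0 U f \<longleftrightarrow> continuous_on U f"
| "Ck_open (Suc m) U f \<longleftrightarrow>
     (\<forall>x\<in>U. f differentiable (at x)) \<and> (\<forall>v. Ck_open m U (\<lambda>x. frechet_derivative f (at x) v))"

text \<open>On an arbitrary set, smooth means extendable to a smooth function on an open
  neighbourhood (``smooth up to the boundary'').\<close>

definition smooth_on :: "'a::euclidean_space set \<Rightarrow> ('a \<Rightarrow> 'b::real_normed_vector) \<Rightarrow> bool" where
  "smooth_on S f \<longleftrightarrow>
     (\<exists>U F. open U \<and> S \<subseteq> U \<and> (\<forall>m. Ck_open m U F) \<and> (\<forall>x\<in>S. F x = f x))"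

definition diffeo_between ::
  "('a::euclidean_space \<Rightarrow> 'b::euclidean_space) \<Rightarrow> 'a set \<Rightarrow> 'b set \<Rightarrow> bool" where
  "diffeo_between f V W \<longleftrightarrow>
     bij_betw f V W \<and> smooth_on V f \<and> smooth_on W (the_inv_into V f)"

section \<open>Metrics and curvature\<close>

definition pos_def_sym :: "real ^ 'n ^ 'n \<Rightarrow> bool" where
  "pos_def_sym A \<longleftrightarrow> transpose A = A \<and> (\<forall>v. v \<noteq> 0 \<longrightarrow> 0 < v \<bullet> (A *v v))"

definition riem_inner :: "real ^ 'n ^ 'n \<Rightarrow> real ^ 'n \<Rightarrow> real ^ 'n \<Rightarrow> real" where
  "riem_inner A u v = u \<bullet> (A *v v)"

definition partial_within ::
  "(real ^ 'n) set \<Rightarrow> (real ^ 'n \<Rightarrow> real) \<Rightarrow> 'n \<Rightarrow> real ^ 'n \<Rightarrow> real" where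
  "partial_within S f i x = frechet_derivative f (at x within S) (axis i 1)"

text \<open>\<open>christoffel S g l i j\<close> is \<open>\<Gamma>\<^sup>l\<^sub>i\<^sub>j\<close>, i.e. the covariant derivative of \<open>\<partial>\<^sub>j\<close> along \<open>\<partial>\<^sub>i\<close>
  is \<open>\<Sum>\<^sub>l \<Gamma>\<^sup>l\<^sub>i\<^sub>j \<partial>\<^sub>l\<close>.\<close>

definition christoffel ::
  "(real ^ 'n) set \<Rightarrow> ('n::finite) metric \<Rightarrow> 'n \<Rightarrow> 'n \<Rightarrow> 'n \<Rightarrow> real ^ 'n \<Rightarrow> real" where
  "christoffel S g l i j x =
     (1/2) * (\<Sum>m\<in>UNIV. matrix_inv (g x) $ l $ m *
        (partial_within S (\<lambda>y. g y $ j $ m) i x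
         + partial_within S (\<lambda>y. g y $ i $ m) j x
         - partial_within S (\<lambda>y. g y $ i $ j) m x))"

text \<open>\<open>riem_coeff S g l i j k\<close> is the \<open>\<partial>\<^sub>l\<close>-component of \<open>R(\<partial>\<^sub>i,\<partial>\<^sub>j)\<partial>\<^sub>k\<close>, where
  \<open>R(X,Y) = \<nabla>\<^sub>X\<nabla>\<^sub>Y - \<nabla>\<^sub>Y\<nabla>\<^sub>X - \<nabla>\<^sub>[\<^sub>X\<^sub>,\<^sub>Y\<^sub>]\<close>; with this sign \<open>\<langle>R(u,v)v,u\<rangle>\<close> is positive on round spheres.\<close>

definition riem_coeff ::
  "(real ^ 'n) set \<Rightarrow> ('n::finite) metric \<Rightarrow> 'n \<Rightarrow> 'n \<Rightarrow> 'n \<Rightarrow> 'n \<Rightarrow> real ^ 'n \<Rightarrow> real" where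
  "riem_coeff S g l i j k x =
     partial_within S (christoffel S g l j k) i x - partial_within S (christoffel S g l i k) j x
     + (\<Sum>m\<in>UNIV. christoffel S g l i m x * christoffel S g m j k x
                 - christoffel S g l j m x * christoffel S g m i k x)"

definition riem_curv ::
  "(real ^ 'n) set \<Rightarrow> ('n::finite) metric \<Rightarrow> real ^ 'n \<Rightarrow> real ^ 'n \<Rightarrow> real ^ 'n \<Rightarrow> real ^ 'n \<Rightarrow> real ^ 'n" where
  "riem_curv S g x u v w =
     (\<chi> l. \<Sum>i\<in>UNIV. \<Sum>j\<in>UNIV. \<Sum>k\<in>UNIV. riem_coeff S g l i j k x * u $ i * v $ j * w $ k)"

definition sectional_curvature ::
  "(real ^ 'n) set \<Rightarrow> ('n::finite) metric \<Rightarrow> real ^ 'n \<Rightarrow> real ^ 'n \<Rightarrow> real ^ 'n \<Rightarrow> real" where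
  "sectional_curvature S g x u v =
     riem_inner (g x) (riem_curv S g x u v v) u /
     (riem_inner (g x) u u * riem_inner (g x) v v - (riem_inner (g x) u v)\<^sup>2)"

definition riem_metric_on :: "(real ^ 'n) set \<Rightarrow> ('n::finite) metric \<Rightarrow> bool" where
  "riem_metric_on S g \<longleftrightarrow> smooth_on S g \<and> (\<forall>x\<in>S. pos_def_sym (g x))"

definition metrics_ball :: "real \<Rightarrow> ('n::finite) metric set" where
  "metrics_ball k =
     {g. riem_metric_on (cball 0 1) g \<and>
         (\<forall>x\<in>cball 0 1. \<forall>u v. u \<noteq> v \<and> independent {u, v}
            \<longrightarrow> sectional_curvature (cball 0 1) g x u v \<le> k)}"

section \<open>Geodesics, exponential map, star-shaped metrics\<close>

definition geodesic_on ::
  "(real ^ 'n) set \<Rightarrow> ('n::finite) metric \<Rightarrow> real \<Rightarrow> (real \<Rightarrow> real ^ 'n) \<Rightarrow> (real \<Rightarrow> real ^ 'n) \<Rightarrow> bool" where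
  "geodesic_on S g T c c' \<longleftrightarrow>
     0 < T \<and>
     (\<forall>t\<in>{0..T}. c t \<in> S \<and>
        (c has_vector_derivative c' t) (at t within {0..T}) \<and>
        (c' has_vector_derivative
           - (\<chi> l. \<Sum>i\<in>UNIV. \<Sum>j\<in>UNIV. christoffel S g l i j (c t) * c' t $ i * c' t $ j))
          (at t within {0..T}))"

definition curve_length ::
  "('n::finite) metric \<Rightarrow> real \<Rightarrow> (real \<Rightarrow> real ^ 'n) \<Rightarrow> (real \<Rightarrow> real ^ 'n) \<Rightarrow> real" where
  "curve_length g T c c' = integral {0..T} (\<lambda>t. sqrt (riem_inner (g (c t)) (c' t) (c' t)))"

text \<open>Because the ball has a boundary, the exponential map at the center is only partially defined:
  \<open>exp_rel g v y\<close> says that \<open>exp\<^sub>o(v)\<close> exists and equals \<open>y\<close>.\<close>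

definition exp_rel :: "('n::finite) metric \<Rightarrow> real ^ 'n \<Rightarrow> real ^ 'n \<Rightarrow> bool" where
  "exp_rel g v y \<longleftrightarrow>
     (\<exists>c c'. geodesic_on (cball 0 1) g 1 c c' \<and> c 0 = 0 \<and> c' 0 = v \<and> c 1 = y)"

definition exp_o :: "('n::finite) metric \<Rightarrow> real ^ 'n \<Rightarrow> real ^ 'n" where
  "exp_o g v = (THE y. exp_rel g v y)"

definition closed_domain :: "'a::topological_space set \<Rightarrow> bool" where
  "closed_domain V \<longleftrightarrow> (\<exists>W. open W \<and> connected W \<and> W \<noteq> {} \<and> V = closure W)"

definition is_exp_domain :: "('n::finite) metric \<Rightarrow> (real ^ 'n) set \<Rightarrow> bool" where
  "is_exp_domain g V \<longleftrightarrow>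
     closed_domain V \<and> (\<forall>v\<in>V. \<exists>y. exp_rel g v y) \<and> diffeo_between (exp_o g) V (cball 0 1)"

text \<open>The tangent space of the unit sphere at \<open>p\<close> is the Euclidean orthogonal complement of \<open>p\<close>.\<close>

definition radial_transverse :: "('n::finite) metric \<Rightarrow> bool" where
  "radial_transverse g \<longleftrightarrow>
     (\<forall>T c c'. geodesic_on (cball 0 1) g T c c' \<and> c 0 = 0 \<and> c T \<in> sphere 0 1
        \<longrightarrow> c' T \<bullet> c T \<noteq> 0)"

definition star_metrics_ball :: "real \<Rightarrow> ('n::finite) metric set" where
  "star_metrics_ball k = {g \<in> metrics_ball k. (\<exists>V. is_exp_domain g V) \<and> radial_transverse g}"

text \<open>For a star-shaped metric the domain is unique: by transversality it is the set of all \<open>v\<close>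
  for which \<open>exp\<^sub>o(v)\<close> is defined. Hence the choice below is immaterial.\<close>

definition exp_domain :: "('n::finite) metric \<Rightarrow> (real ^ 'n) set" where
  "exp_domain g = (SOME V. is_exp_domain g V)"

section \<open>Normal coordinates\<close>

definition matrix_sqrt :: "real ^ 'n ^ 'n \<Rightarrow> real ^ 'n ^ 'n" where
  "matrix_sqrt A = (THE h. pos_def_sym h \<and> h ** h = A)"

definition normal_frame :: "('n::finite) metric \<Rightarrow> 'n \<Rightarrow> real ^ 'n" where
  "normal_frame g i = matrix_inv (matrix_sqrt (g 0)) *v axis i 1"

definition normal_phi :: "('n::finite) metric \<Rightarrow> real ^ 'n \<Rightarrow> real ^ 'n" where
  "normal_phi g x = (\<Sum>i\<in>UNIV. (x $ i) *\<^sub>R normal_frame g i)"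

definition Omega :: "('n::finite) metric \<Rightarrow> (real ^ 'n) set" where
  "Omega g = normal_phi g -` exp_domain g"

definition exp_tilde :: "('n::finite) metric \<Rightarrow> real ^ 'n \<Rightarrow> real ^ 'n" where
  "exp_tilde g = exp_o g \<circ> normal_phi g"

definition pullback_metric ::
  "(real ^ 'n) set \<Rightarrow> (real ^ 'n \<Rightarrow> real ^ 'n) \<Rightarrow> ('n::finite) metric \<Rightarrow> ('n::finite) metric" where
  "pullback_metric S F g x =
     (let J = jacobian F (at x within S) in transpose J ** g (F x) ** J)"

definition gbar :: "('n::finite) metric \<Rightarrow> ('n::finite) metric" where
  "gbar g = pullback_metric (Omega g) (exp_tilde g) g"

text \<open>Length of the \<open>g\<close>-geodesic of \<open>S\<close> from the origin to the boundary of \<open>S\<close> with initial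
  velocity \<open>\<theta>\<close>.\<close>

definition radial_length :: "(real ^ 'n) set \<Rightarrow> ('n::finite) metric \<Rightarrow> real ^ 'n \<Rightarrow> real" where
  "radial_length S g \<theta> =
     (THE L. \<exists>T c c'. geodesic_on S g T c c' \<and> c 0 = 0 \<and> c' 0 = \<theta> \<and>
        c ` {0..<T} \<subseteq> interior S \<and> c T \<in> frontier S \<and> L = curve_length g T c c')"

definition radial_fun :: "('n::finite) metric \<Rightarrow> real ^ 'n \<Rightarrow> real" where
  "radial_fun g = radial_length (Omega g) (gbar g)"

text \<open>The derivative of \<open>u\<close> along the sphere at \<open>\<theta>\<close> is read off from the extension of \<open>u\<close> that is
  constant on rays (\<open>sgn x = x / |x|\<close>), whose differential at \<open>\<theta>\<close> vanishes on \<open>\<theta>\<close> and equals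
  \<open>du\<close> on tangent vectors.\<close>

definition C1_norm_sphere :: "(real ^ 'n \<Rightarrow> real) \<Rightarrow> real" where
  "C1_norm_sphere u =
     (SUP \<theta>\<in>sphere 0 1. \<bar>u \<theta>\<bar>) +
     (SUP \<theta>\<in>sphere 0 1. onorm (frechet_derivative (\<lambda>x. u (sgn x)) (at \<theta>)))"

section \<open>Model metrics\<close>

definition s_model :: "real \<Rightarrow> real \<Rightarrow> real" where
  "s_model k r = (if k = 0 then r else sinh (sqrt (- k) * r) / sqrt (- k))"

text \<open>In Cartesian coordinates, with \<open>e = x / r\<close> and \<open>r = |x|\<close>, one has \<open>dr\<^sup>2 = e e\<^sup>T\<close> and
  \<open>d\<theta>\<^sup>2 = (I - e e\<^sup>T) / r\<^sup>2\<close>.\<close>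

definition delta_metric :: "real \<Rightarrow> ('n::finite) metric" where
  "delta_metric k x =
     (if x = 0 then mat 1
      else let e = sgn x; P = (\<chi> i j. e $ i * e $ j)
           in P + (s_model k (norm x) / norm x)\<^sup>2 *\<^sub>R (mat 1 - P))"

section \<open>Volumes and the isoperimetric ratio\<close>

definition riem_volume :: "(real ^ 'n) set \<Rightarrow> ('n::finite) metric \<Rightarrow> real" where
  "riem_volume S g = integral S (\<lambda>x. sqrt (det (g x)))"

text \<open>Integration over the Euclidean unit sphere with respect to its surface measure, which assigns
  to \<open>A\<close> the number \<open>n\<close> times the volume of the cone \<open>{t \<theta> | \<theta> \<in> A, 0 < t < 1}\<close>.\<close>

definition sphere_integral :: "(real ^ 'n \<Rightarrow> real) \<Rightarrow> real" where
  "sphere_integral u = real CARD('n) * integral (ball 0 1) (\<lambda>x. u (sgn x))"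

text \<open>Volume of the hypersurface parametrized by \<open>\<Phi>\<close> on the unit sphere, i.e. the integral of the
  volume density of the pulled back metric \<open>\<Phi>\<^sup>*g\<close>. The matrix \<open>J\<close> represents \<open>d\<Phi>\<close> on the tangent
  space of the sphere at \<open>\<theta>\<close> and annihilates \<open>\<theta>\<close>; adding \<open>\<theta> \<theta>\<^sup>T\<close> makes the determinant equal to
  the Gram determinant of \<open>\<Phi>\<^sup>*g\<close> with respect to a Euclidean orthonormal basis of the tangent space.\<close>

definition hypersurface_volume :: "(real ^ 'n \<Rightarrow> real ^ 'n) \<Rightarrow> ('n::finite) metric \<Rightarrow> real" where
  "hypersurface_volume \<Phi> g =
     sphere_integral (\<lambda>\<theta>. let J = jacobian (\<lambda>x. \<Phi> (sgn x)) (at \<theta>)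
        in sqrt (det (transpose J ** g (\<Phi> \<theta>) ** J + (\<chi> i j. \<theta> $ i * \<theta> $ j))))"

text \<open>The boundary of a domain that is star-shaped about the origin is parametrized by the unit
  sphere through radial projection (its volume does not depend on the parametrization).\<close>

definition boundary_point :: "(real ^ 'n) set \<Rightarrow> real ^ 'n \<Rightarrow> real ^ 'n" where
  "boundary_point S \<theta> = (THE p. p \<in> frontier S \<and> (\<exists>t>0. p = t *\<^sub>R \<theta>))"

definition riem_boundary_volume :: "(real ^ 'n) set \<Rightarrow> ('n::finite) metric \<Rightarrow> real" where
  "riem_boundary_volume S g = hypersurface_volume (boundary_point S) g"

definition isoperimetric_ratio :: "(real ^ 'n) set \<Rightarrow> ('n::finite) metric \<Rightarrow> real" where
  "isoperimetric_ratio S g =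
     riem_boundary_volume S g ^ CARD('n) / riem_volume S g ^ (CARD('n) - 1)"

end

theory Submission
  imports Defs
begin

text \<open>In polar normal coordinates \<open>gbar g = dr\<^sup>2 + g\<^sub>r\<close> (Gauss lemma), and the Sturm comparison
  for the length of a Jacobi field \<open>J\<close> normal to a ray gives that \<open>|J|\<^sup>2 / s\<^sub>k\<^sup>2\<close> is nondecreasing along
  the ray. So \<open>g\<^sub>r / s\<^sub>k(r)\<^sup>2\<close> is nondecreasing as a family of quadratic forms and starts at \<open>d\<theta>\<^sup>2\<close>;
  in particular the ratio \<open>\<lambda> \<ge> 1\<close> of the volume densities is nondecreasing along rays. With \<open>\<mu> = \<lambda> - 1\<close>
  evaluated on the boundary, the volume exceeds that of the model by at most the integral of \<open>\<mu>\<close>,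
  while the boundary area exceeds it by at least almost as much in proportion when \<open>f\<close> is \<open>C\<^sup>1\<close>-close to a constant:
  if the volume ratio is at most \<open>1 + z\<close>, the area ratio is at least \<open>1 + c z\<close> with \<open>c > (n - 1) / n\<close>,
  and \<open>(1 + c z)\<^sup>n > (1 + z)\<^bsup>n-1\<^esup>\<close> for \<open>z > 0\<close>. Equality forces \<open>\<mu> = 0\<close>, and then the
  monotone forms \<open>g\<^sub>r / s\<^sub>k(r)\<^sup>2\<close> are constant.\<close>

section \<open>Symmetric matrices\<close>

text \<open>Jacobi fields are read off from the derivatives of the map \<open>ex\<close> onto the
  ball: for fixed w, the field t \<open>D1 w (t x)\<close> along the ray of x arises by varying x,
  and the geodesic equation of all rays is one differential equation for \<open>ex\<close>. These
  derivatives live on the interior of \<open>Omega g\<close>; the results reach the boundary, where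
  area is measured, by continuity along rays. Transversality serves twice: a geodesic from the
  center can meet the sphere only at its endpoint, and the radial function is differentiable by an
  implicit function argument. Volume and area gains are compared through one number I, the integral
  over all directions of the boundary value of \<mu>. Monotonicity replaces \<mu> inside the domain
  by this boundary value, so the integrand splits into an angular and a radial factor; enclosing the
  domain between the balls of radii R - \<epsilon> and R + 2 \<epsilon> makes the radial range
  independent of the direction. The constant c collects the losses of these estimates. It depends on
  n, k, R and \<epsilon> only and tends to 1 with \<epsilon> tending to 0, so \<epsilon> is fixed
  before the metric; the gap between 1 and (n - 1) / n pays for the losses.\<close>

lemma symmetric_dot_swap:
  fixes A :: "real^'n^'n"
  assumes "transpose A = A"
  shows "(A *v x) \<bullet> y = x \<bullet> (A *v y)"
  by (metis assms dot_lmul_matrix transpose_matrix_vector)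

text \<open>Maximize x . A x over the unit vectors of \<open>S\<close>. With maximum
  \<open>m\<close>, the form m |x|^2 - x . A x is nonnegative on \<open>S\<close> and zero at the
  maximizer \<open>v\<close>, so the residual m v - A v, which lies in \<open>S\<close> by
  invariance, has to vanish. The invariant subspace is what lets
  \<open>symmetric_matrix_eigenbasis\<close> iterate.\<close>

lemma symmetric_matrix_eigenvector:
  fixes A :: "real^'n^'n"
  assumes sym: "transpose A = A" and S: "subspace S" and ne: "S \<noteq> {0}"
    and inv: "\<And>x. x \<in> S \<Longrightarrow> A *v x \<in> S"
  obtains v d where "v \<in> S" "norm v = 1" "A *v v = d *\<^sub>R v"
proof -
  let ?K = "S \<inter> sphere 0 1"
  have "compact ?K"
    using closed_subspace[OF S] by (simp add: closed_Int_compact)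
  obtain x0 where x0: "x0 \<in> S" "x0 \<noteq> 0" using ne S subspace_0 by blast
  then have "(1 / norm x0) *\<^sub>R x0 \<in> ?K"
    using subspace_scale[OF S] by simp
  then have "?K \<noteq> {}" by blast
  moreover have "continuous_on ?K (\<lambda>x. x \<bullet> (A *v x))"
    by (rule continuous_on_inner[OF continuous_on_id matrix_vector_mult_linear_continuous_on])
  ultimately obtain v where v: "v \<in> ?K" and vmax: "\<And>x. x \<in> ?K \<Longrightarrow> x \<bullet> (A *v x) \<le> v \<bullet> (A *v v)"
    using continuous_attains_sup[OF \<open>compact ?K\<close>, of "\<lambda>x. x \<bullet> (A *v x)"] by blast
  define m where "m = v \<bullet> (A *v v)"
  have nonneg: "0 \<le> m * (x \<bullet> x) - x \<bullet> (A *v x)" if "x \<in> S" for x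
  proof (cases "x = 0")
    case False
    then have "(1 / norm x) *\<^sub>R x \<in> ?K" using that subspace_scale[OF S] by simp
    from vmax[OF this] have "(1 / norm x)\<^sup>2 * (x \<bullet> (A *v x)) \<le> m"
      by (simp add: matrix_vector_mult_scaleR m_def power2_eq_square)
    then show ?thesis using False
      by (simp add: field_simps power2_norm_eq_inner[symmetric])
  qed simp
  have vv: "v \<in> S" "v \<bullet> v = 1" using v by (auto simp: norm_eq_1)
  define r where "r = m *\<^sub>R v - A *v v"
  have rS: "r \<in> S" unfolding r_def using vv inv S by (simp add: subspace_diff subspace_scale)
  have "r \<bullet> r = 0"
  proof (rule ccontr)
    assume neq: "r \<bullet> r \<noteq> 0"
    define b where "b = r \<bullet> r"
    define c where "c = m * b - r \<bullet> (A *v r)"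
    have b: "b > 0" using neq by (simp add: b_def)
    have quad: "0 \<le> 2 * t * b + t\<^sup>2 * c" for t :: real
    proof -
      have "v + t *\<^sub>R r \<in> S" using vv rS S by (simp add: subspace_add subspace_scale)
      from nonneg[OF this]
      have "0 \<le> m * (1 + 2 * t * (v \<bullet> r) + t\<^sup>2 * b) - (m + 2 * t * (r \<bullet> (A *v v)) + t\<^sup>2 * (r \<bullet> (A *v r)))"
        using vv symmetric_dot_swap[OF sym, of v r]
        by (simp add: matrix_vector_right_distrib matrix_vector_mult_scaleR inner_simps algebra_simps
            power2_eq_square inner_commute m_def b_def)
      moreover have "r \<bullet> (A *v v) = m * (v \<bullet> r) - b"
        unfolding b_def by (simp add: r_def inner_simps inner_commute algebra_simps)
      ultimately show ?thesis by (simp add: c_def algebra_simps)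
    qed
    have c0: "c \<ge> 0" using nonneg[OF rS] by (simp add: c_def b_def)
    \<comment> \<open>The variation v + t r has the first order term 2 t b; this negative value of t
      makes it beat the quadratic term, and the 1 in the denominator covers c = 0.\<close>
    have "0 \<le> 2 * (- b / (c + 1)) * b + (- b / (c + 1))\<^sup>2 * c" by (rule quad)
    also have "\<dots> = b\<^sup>2 / (c+1)\<^sup>2 * (c - 2 * (c + 1))"
      using c0 by (simp add: divide_simps power2_eq_square) (simp add: algebra_simps)
    also have "\<dots> < 0" using b c0 by (intro mult_pos_neg) auto
    finally show False by simp
  qed
  then have "A *v v = m *\<^sub>R v" by (simp add: r_def)
  with that vv show ?thesis by (metis norm_eq_1)
qed

text \<open>Induction on the dimension: an eigenvector splits off, and the symmetry of
  \<open>A\<close> keeps its orthogonal complement in \<open>S\<close> invariant.\<close>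

lemma symmetric_matrix_eigenbasis:
  fixes A :: "real^'n^'n"
  assumes sym: "transpose A = A" and S: "subspace S" and inv: "\<And>x. x \<in> S \<Longrightarrow> A *v x \<in> S"
  shows "\<exists>B. finite B \<and> B \<subseteq> S \<and> pairwise orthogonal B \<and> card B = dim S \<and>
      (\<forall>b\<in>B. norm b = 1 \<and> (\<exists>d. A *v b = d *\<^sub>R b))"
  using S inv
proof (induction "dim S" arbitrary: S)
  case 0
  then have "S \<subseteq> {0}" by (simp add: dim_eq_0)
  then show ?case using 0 by (intro exI[of _ "{}"]) auto
next
  case (Suc m)
  have "S \<noteq> {0}" using Suc.hyps(2) by auto
  then obtain v d where v: "v \<in> S" "norm v = 1" "A *v v = d *\<^sub>R v"
    using symmetric_matrix_eigenvector[OF sym Suc.prems(1)] Suc.prems(2) by metis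
  define S' where "S' = {y \<in> S. \<forall>x\<in>span {v}. orthogonal x y}"
  have S'eq: "S' = {y \<in> S. v \<bullet> y = 0}"
    unfolding S'_def orthogonal_def by (auto simp: span_singleton)
  have sub: "subspace S'"
    using Suc.prems(1) unfolding S'eq subspace_def by (auto simp: inner_simps)
  have "dim S' + dim (span {v}) = dim S"
    unfolding S'_def using Suc.prems(1) v(1) 
    by (intro dim_subspace_orthogonal_to_vectors) (auto simp: span_minimal)
  moreover have "dim (span {v}) = 1" using v(2) by (auto simp: dim_insert)
  ultimately have dimS': "m = dim S'" using Suc.hyps(2) by simp
  have inv': "A *v x \<in> S'" if "x \<in> S'" for x
    using that Suc.prems(2) v(3) symmetric_dot_swap[OF sym, of v x] unfolding S'eq by auto
  obtain B where B: "finite B" "B \<subseteq> S'" "pairwise orthogonal B" "card B = dim S'"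
      "\<forall>b\<in>B. norm b = 1 \<and> (\<exists>d. A *v b = d *\<^sub>R b)"
    using Suc.hyps(1)[OF dimS' sub inv'] by auto
  have "v \<notin> B" using B(2) v(2) unfolding S'eq by (auto simp: norm_eq_1)
  moreover have "pairwise orthogonal (insert v B)"
    using B(2,3) unfolding S'eq by (auto simp: pairwise_insert orthogonal_def inner_commute)
  moreover have "insert v B \<subseteq> S" using B(2) v(1) unfolding S'eq by auto
  moreover have "card (insert v B) = dim S" using B(1,4) \<open>v \<notin> B\<close> dimS' Suc.hyps(2) by simp
  moreover have "\<forall>b\<in>insert v B. norm b = 1 \<and> (\<exists>d. A *v b = d *\<^sub>R b)" using B(5) v by auto
  ultimately show ?case using B(1) by blast
qed

section \<open>Diagonalization, square roots and comparison of determinants\<close>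

definition diag_matrix :: "('n \<Rightarrow> real) \<Rightarrow> real^'n^'n" where
  "diag_matrix d = (\<chi> i j. if i = j then d i else 0)"

lemma diag_matrix_mult: "diag_matrix a ** diag_matrix b = diag_matrix (\<lambda>i. a i * b i)"
proof -
  have "(\<Sum>k\<in>UNIV. (if i = k then a i else 0) * (if k = j then b k else 0)) = (if i = j then a i * b i else 0)" for i j
  proof -
    have "(\<Sum>k\<in>UNIV. (if i = k then a i else 0) * (if k = j then b k else 0)) =
        (\<Sum>k\<in>UNIV. if k = i then (if i = j then a i * b i else 0) else 0)"
      by (rule sum.cong) auto
    then show ?thesis by simp
  qed
  then show ?thesis by (simp add: diag_matrix_def matrix_matrix_mult_def vec_eq_iff)
qed

lemma diag_matrix_vec: "diag_matrix d *v x = (\<chi> i. d i * x $ i)"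
  by (simp add: diag_matrix_def matrix_vector_mult_def vec_eq_iff sum.delta if_distrib[where f="\<lambda>c. c * _"] cong: if_cong)

lemma transpose_diag_matrix [simp]: "transpose (diag_matrix d) = diag_matrix d"
  by (auto simp: diag_matrix_def transpose_def vec_eq_iff)

lemma det_diag_matrix: "det (diag_matrix d) = (\<Prod>i\<in>UNIV. d i)"
  by (subst det_diagonal) (auto simp: diag_matrix_def)

lemma symmetric_matrix_diagonalization:
  fixes A :: "real^'n^'n"
  assumes sym: "transpose A = A"
  obtains Q d where "orthogonal_matrix Q" "A = Q ** diag_matrix d ** transpose Q"
proof -
  obtain B where B: "finite B" "pairwise orthogonal B" "card B = CARD('n)"
      "\<forall>b\<in>B. norm b = 1 \<and> (\<exists>d. A *v b = d *\<^sub>R b)"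
    using symmetric_matrix_eigenbasis[OF sym subspace_UNIV] by (auto simp: )
  obtain h where h: "bij_betw h (UNIV::'n set) B"
    using B by (metis finite finite_same_card_bij)
  have hB: "h i \<in> B" for i using h by (auto simp: bij_betw_def)
  have "\<forall>i. \<exists>d. A *v h i = d *\<^sub>R h i" using B hB by auto
  then obtain d where d: "\<And>i. A *v h i = d i *\<^sub>R h i" by metis
  define Q where "Q = (\<chi> i j. h j $ i)"
  have col: "column i Q = h i" for i by (simp add: Q_def column_def vec_eq_iff)
  have Q: "orthogonal_matrix Q"
    unfolding orthogonal_matrix_orthonormal_columns col
    using B hB h by (metis bij_betw_imp_inj_on injD pairwise_def)
  have "(A ** Q) $ i $ j = (Q ** diag_matrix d) $ i $ j" for i j
  proof -
    have "(A ** Q) $ i $ j = (A *v h j) $ i"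
      by (simp add: matrix_matrix_mult_def matrix_vector_mult_def Q_def)
    also have "\<dots> = d j * h j $ i" by (simp add: d)
    also have "\<dots> = (Q ** diag_matrix d) $ i $ j"
      by (simp add: matrix_matrix_mult_def diag_matrix_def Q_def if_distrib if_distribR cong: if_cong)
    finally show ?thesis .
  qed
  then have "A ** Q = Q ** diag_matrix d" by (simp add: vec_eq_iff)
  moreover have QQ: "Q ** transpose Q = mat 1" using Q by (simp add: orthogonal_matrix_def)
  ultimately have "A = Q ** diag_matrix d ** transpose Q"
    by (metis matrix_mul_assoc matrix_mul_rid)
  with Q that show ?thesis by blast
qed

lemma matrix_inv_mult:
  fixes A :: "real^'n^'n"
  assumes "invertible A"
  shows "A ** matrix_inv A = mat 1" "matrix_inv A ** A = mat 1"
  using assms someI_ex[of "\<lambda>A'. A ** A' = mat 1 \<and> A' ** A = mat 1"]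
  unfolding invertible_def matrix_inv_def by auto

lemma transpose_matrix_inv:
  fixes A :: "real^'n^'n"
  assumes "transpose A = A" "invertible A"
  shows "transpose (matrix_inv A) = matrix_inv A"
proof -
  have "transpose (matrix_inv A) ** A = mat 1"
    by (metis assms matrix_inv_mult(1) matrix_transpose_mul transpose_mat)
  then show ?thesis
    by (metis assms(2) matrix_inv_mult(1) matrix_mul_assoc matrix_mul_lid matrix_mul_rid)
qed

lemma bilinear_form_congruence:
  fixes A J :: "real^'n^'n"
  shows "x \<bullet> ((transpose J ** A ** J) *v y) = (J *v x) \<bullet> (A *v (J *v y))"
  by (metis dot_lmul_matrix inner_commute matrix_vector_mul_assoc transpose_matrix_vector)

lemma quadratic_form_congruence:
  fixes A P :: "real^'n^'n"
  shows "x \<bullet> ((transpose P ** A ** P) *v x) = (P *v x) \<bullet> (A *v (P *v x))"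
  by (rule bilinear_form_congruence)

lemma pos_def_sym_invertible:
  assumes "pos_def_sym A" shows "invertible A"
proof -
  have "A *v x = 0 \<Longrightarrow> x = 0" for x
    using assms unfolding pos_def_sym_def by fastforce
  then have "inj ((*v) A)"
    by (simp add: linear_injective_0)
  then show ?thesis
    by (simp add: matrix_left_invertible_injective invertible_left_inverse)
qed

lemma pos_def_sym_diag:
  fixes Q :: "real^'n^'n"
  assumes Q: "orthogonal_matrix Q"
  shows "pos_def_sym (Q ** diag_matrix d ** transpose Q) \<longleftrightarrow> (\<forall>i. 0 < d i)"
proof
  have QQ: "transpose Q ** Q = mat 1" "Q ** transpose Q = mat 1"
    using Q by (auto simp: orthogonal_matrix_def)
  have form: "x \<bullet> ((Q ** diag_matrix d ** transpose Q) *v x) = (\<Sum>i\<in>UNIV. d i * ((transpose Q *v x) $ i)\<^sup>2)" for x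
    using quadratic_form_congruence[of x "transpose Q" "diag_matrix d"]
    by (simp add: diag_matrix_vec inner_vec_def power2_eq_square mult.assoc mult.commute mult.left_commute)
  {
    assume pd: "pos_def_sym (Q ** diag_matrix d ** transpose Q)"
    show "\<forall>i. 0 < d i"
    proof
      fix i
      have e: "transpose Q *v (Q *v axis i 1) = axis i 1"
        by (simp add: matrix_vector_mul_assoc QQ)
      have "Q *v axis i 1 \<noteq> 0"
        by (metis e axis_eq_0_iff matrix_vector_mult_0_right zero_neq_one)
      then have "0 < (\<Sum>j\<in>UNIV. d j * ((axis i 1 :: real^'n) $ j)\<^sup>2)"
        using pd form[of "Q *v axis i 1"] unfolding pos_def_sym_def e by metis
      also have "\<dots> = d i"
        by (simp add: axis_def if_distrib if_distribR cong: if_cong)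
      finally show "0 < d i" .
    qed
  }
  assume d: "\<forall>i. 0 < d i"
  have "0 < x \<bullet> ((Q ** diag_matrix d ** transpose Q) *v x)" if "x \<noteq> 0" for x
  proof -
    have "transpose Q *v x \<noteq> 0"
      using that QQ by (metis matrix_vector_mul_assoc matrix_vector_mul_lid matrix_vector_mult_0_right)
    then obtain i where "(transpose Q *v x) $ i \<noteq> 0" by (auto simp: vec_eq_iff)
    then have "0 < d i * ((transpose Q *v x) $ i)\<^sup>2" using d by simp
    then show ?thesis unfolding form using d
      by (intro sum_pos2[of _ i]) (auto simp: less_imp_le)
  qed
  then show "pos_def_sym (Q ** diag_matrix d ** transpose Q)"
    by (simp add: pos_def_sym_def matrix_transpose_mul matrix_mul_assoc)
qed

lemma pos_def_sym_sqrt_ex: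
  assumes "pos_def_sym A"
  shows "\<exists>h. pos_def_sym h \<and> h ** h = A"
proof -
  obtain Q d where Q: "orthogonal_matrix Q" and A: "A = Q ** diag_matrix d ** transpose Q"
    using assms symmetric_matrix_diagonalization unfolding pos_def_sym_def by metis
  have d: "\<forall>i. 0 < d i" using assms A pos_def_sym_diag[OF Q] by simp
  let ?h = "Q ** diag_matrix (\<lambda>i. sqrt (d i)) ** transpose Q"
  have "?h ** ?h = Q ** diag_matrix (\<lambda>i. sqrt (d i)) ** (transpose Q ** Q) ** diag_matrix (\<lambda>i. sqrt (d i)) ** transpose Q"
    by (simp add: matrix_mul_assoc)
  also have "\<dots> = Q ** (diag_matrix (\<lambda>i. sqrt (d i)) ** diag_matrix (\<lambda>i. sqrt (d i))) ** transpose Q"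
    using Q by (simp add: orthogonal_matrix_def matrix_mul_assoc)
  also have "\<dots> = A" unfolding A diag_matrix_mult using d by (simp add: less_imp_le)
  finally show ?thesis using d pos_def_sym_diag[OF Q, of "\<lambda>i. sqrt (d i)"] by (intro exI[of _ ?h]) auto
qed

text \<open>With X = h - h', equality of the squares reads h X + X h' = 0. Tested on an eigenvector
  v of X with eigenvalue d, this gives d (v . h v + v . h' v) = 0, and the bracket is
  positive.\<close>

lemma pos_def_sym_sqrt_unique:
  assumes "pos_def_sym h" "pos_def_sym h'" "h ** h = h' ** h'"
  shows "h = h'"
proof -
  let ?X = "h - h'"
  have symX: "transpose ?X = ?X"
    using assms by (auto simp: pos_def_sym_def transpose_def vec_eq_iff)
  obtain Q d where Q: "orthogonal_matrix Q" and X: "?X = Q ** diag_matrix d ** transpose Q"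
    using symmetric_matrix_diagonalization[OF symX] by metis
  have QQ: "transpose Q ** Q = mat 1" using Q by (auto simp: orthogonal_matrix_def)
  have "d i = 0" for i
  proof -
    define v where "v = Q *v axis i 1"
    have "transpose Q *v v = axis i 1"
      by (simp add: v_def matrix_vector_mul_assoc QQ)
    moreover from this have "v \<noteq> 0"
      by (metis axis_eq_0_iff matrix_vector_mult_0_right zero_neq_one)
    moreover have "diag_matrix d *v axis i 1 = d i *\<^sub>R axis i 1"
      by (auto simp: diag_matrix_vec vec_eq_iff axis_def)
    ultimately have Xv: "?X *v v = d i *\<^sub>R v"
      unfolding X by (simp add: matrix_vector_mul_assoc[symmetric] matrix_vector_mult_scaleR v_def)
    have "h *v (?X *v v) + ?X *v (h' *v v) = (h ** h) *v v - (h' ** h') *v v"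
      by (simp add: matrix_vector_mult_diff_rdistrib matrix_vector_mult_diff_distrib
          flip: matrix_vector_mul_assoc)
    then have "v \<bullet> (h *v (?X *v v)) + v \<bullet> (?X *v (h' *v v)) = 0"
      by (metis assms(3) diff_self inner_add_right inner_zero_right)
    moreover have "v \<bullet> (?X *v (h' *v v)) = d i * (v \<bullet> (h' *v v))"
      using symmetric_dot_swap[OF symX, of v "h' *v v"] unfolding Xv by simp
    moreover have "v \<bullet> (h *v (?X *v v)) = d i * (v \<bullet> (h *v v))"
      unfolding Xv by (simp add: matrix_vector_mult_scaleR)
    ultimately have "d i * (v \<bullet> (h *v v) + v \<bullet> (h' *v v)) = 0"
      by (simp add: algebra_simps)
    moreover have "v \<bullet> (h *v v) + v \<bullet> (h' *v v) > 0"
      using assms \<open>v \<noteq> 0\<close> by (simp add: pos_def_sym_def add_pos_pos)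
    ultimately show ?thesis by simp
  qed
  then have "diag_matrix d = 0" by (simp add: diag_matrix_def vec_eq_iff)
  then have "?X = 0" unfolding X
    by (simp add: matrix_matrix_mult_def vec_eq_iff)
  then show ?thesis by simp
qed

lemma matrix_sqrt:
  assumes "pos_def_sym A"
  shows "pos_def_sym (matrix_sqrt A)" "matrix_sqrt A ** matrix_sqrt A = A"
proof -
  have "\<exists>!h. pos_def_sym h \<and> h ** h = A"
    using pos_def_sym_sqrt_ex[OF assms] pos_def_sym_sqrt_unique by metis
  from theI'[OF this] show "pos_def_sym (matrix_sqrt A)" "matrix_sqrt A ** matrix_sqrt A = A"
    by (auto simp: matrix_sqrt_def)
qed

text \<open>The diagonalization is handed out together with the determinant because single
  eigenvalues matter later: \<open>det_mono\<close> concludes that each of them is 1, and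
  \<open>det_plus_outer_ge\<close> forms products of all but one.\<close>

lemma det_ge_1:
  fixes M :: "real^'n^'n"
  assumes sym: "transpose M = M" and ge: "\<And>x. x \<bullet> x \<le> x \<bullet> (M *v x)"
  obtains Q d where "orthogonal_matrix Q" "M = Q ** diag_matrix d ** transpose Q" "\<And>i. 1 \<le> d i"
    "det M = (\<Prod>i\<in>UNIV. d i)"
proof -
  obtain Q d where Q: "orthogonal_matrix Q" and M: "M = Q ** diag_matrix d ** transpose Q"
    using symmetric_matrix_diagonalization[OF sym] by metis
  have QQ: "transpose Q ** Q = mat 1" "Q ** transpose Q = mat 1" using Q by (auto simp: orthogonal_matrix_def)
  have "1 \<le> d i" for i
  proof -
    define v where "v = Q *v axis i 1"
    have e: "transpose Q *v v = axis i 1"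
      by (simp add: v_def matrix_vector_mul_assoc QQ)
    have "v \<bullet> v = (transpose Q *v v) \<bullet> (transpose Q *v v)"
      using quadratic_form_congruence[of v "transpose Q" "mat 1"] by (simp add: QQ)
    then have "v \<bullet> v = 1" unfolding e by (simp add: inner_axis_axis)
    moreover have "v \<bullet> (M *v v) = axis i 1 \<bullet> (diag_matrix d *v axis i 1)"
      using quadratic_form_congruence[of v "transpose Q" "diag_matrix d"] unfolding M e by simp
    moreover have "axis i 1 \<bullet> (diag_matrix d *v axis i 1) = d i"
      by (simp add: diag_matrix_vec inner_axis_axis inner_commute[of "axis i 1"] inner_axis)
    ultimately show ?thesis using ge[of v] by simp
  qed
  moreover have "det M = (\<Prod>i\<in>UNIV. d i)"
  proof -
    have "det Q * det (transpose Q) = 1" by (metis QQ(2) det_I det_mul)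
    then show ?thesis by (simp add: M det_mul det_diag_matrix mult.commute mult.left_commute)
  qed
  ultimately show ?thesis using that Q M by blast
qed

text \<open>Conjugation with the inverse square root \<open>p\<close> of \<open>A\<close> turns
  \<open>A\<close> into the identity and \<open>B\<close> into \<open>C\<close>, whose eigenvalues
  are at least 1; if their product is 1, then \<open>C\<close> is the identity. The equality case is
  the pointwise rigidity behind \<open>lam_eq_1\<close>.\<close>

lemma det_mono:
  fixes A B :: "real^'n^'n"
  assumes A: "pos_def_sym A" and B: "transpose B = B" and le: "\<And>x. x \<bullet> (A *v x) \<le> x \<bullet> (B *v x)"
  shows "0 < det A" "det A \<le> det B" "det A = det B \<Longrightarrow> A = B"
proof -
  define h where "h = matrix_sqrt A"
  have h: "pos_def_sym h" "h ** h = A" using matrix_sqrt[OF A] by (auto simp: h_def)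
  have symh: "transpose h = h" using h by (simp add: pos_def_sym_def)
  have inv: "invertible h" using h pos_def_sym_invertible by blast
  define p where "p = matrix_inv h"
  have p: "h ** p = mat 1" "p ** h = mat 1" "transpose p = p"
    using matrix_inv_mult[OF inv] transpose_matrix_inv[OF symh inv] by (auto simp: p_def)
  define C where "C = transpose p ** B ** p"
  have symC: "transpose C = C" by (simp add: C_def matrix_transpose_mul B matrix_mul_assoc)
  have ge: "x \<bullet> x \<le> x \<bullet> (C *v x)" for x
  proof -
    have "x \<bullet> x = (h *v (p *v x)) \<bullet> (h *v (p *v x))" by (simp add: matrix_vector_mul_assoc p)
    also have "\<dots> = (p *v x) \<bullet> (A *v (p *v x))"
      by (metis h(2) matrix_vector_mul_assoc symh symmetric_dot_swap)
    also have "\<dots> \<le> (p *v x) \<bullet> (B *v (p *v x))" by (rule le)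
    also have "\<dots> = x \<bullet> (C *v x)" by (simp add: C_def quadratic_form_congruence)
    finally show ?thesis .
  qed
  have dp: "det p * det p * det A = 1"
    using p(1) h(2) by (metis det_I det_mul mult.assoc mult.commute mult.right_neutral)
  have detC: "det C * det A = det B"
    using dp by (simp add: C_def det_mul p(3) mult.commute mult.left_commute)
  show dA: "0 < det A"
    using dp by (metis mult_nonneg_nonpos not_less not_one_le_zero zero_le_square)
  obtain Q d where Q: "orthogonal_matrix Q" and CQ: "C = Q ** diag_matrix d ** transpose Q"
    and d: "\<And>i. 1 \<le> d i" and dC: "det C = (\<Prod>i\<in>UNIV. d i)"
    using det_ge_1[OF symC ge] by metis
  have "1 \<le> det C" unfolding dC using d by (simp add: prod_ge_1)
  then show "det A \<le> det B" using detC dA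
    by (metis less_imp_le mult_right_mono mult_1)
  assume "det A = det B"
  then have "det C = 1" using detC dA by simp
  have "d i = 1" for i
  proof (rule ccontr)
    assume "d i \<noteq> 1"
    then have "1 < d i * (\<Prod>j\<in>UNIV - {i}. d j)"
      using d[of i] d by (intro less_1_mult') (auto simp: prod_ge_1 less_le)
    then show False using \<open>det C = 1\<close> dC by (simp add: prod.remove[of UNIV i])
  qed
  then have "diag_matrix d = mat 1" by (simp add: diag_matrix_def mat_def cong: if_cong)
  then have "C = mat 1" using CQ Q by (simp add: orthogonal_matrix_def)
  then have "h ** C ** h = A" by (simp add: h)
  moreover have "h ** C ** h = (h ** p) ** B ** (p ** h)"
    by (simp add: C_def p(3) matrix_mul_assoc)
  ultimately show "A = B" by (simp add: p)
qed

section \<open>Determinants of rank-one perturbations\<close>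

definition outer :: "real^'n \<Rightarrow> real^'n^'n" where
  "outer e = (\<chi> i j. e $ i * e $ j)"

lemma outer_vec: "outer e *v x = (e \<bullet> x) *\<^sub>R e"
  by (simp add: outer_def matrix_vector_mult_def inner_vec_def vec_eq_iff sum_distrib_left mult_ac)

lemma transpose_outer [simp]: "transpose (outer e) = outer e"
  by (simp add: outer_def transpose_def vec_eq_iff mult.commute)

lemma outer_scaleR: "outer (c *\<^sub>R e) = c\<^sup>2 *\<^sub>R outer e"
  by (simp add: outer_def vec_eq_iff power2_eq_square)

lemma outer_congruence: "A ** outer e ** transpose A = outer (A *v e)"
proof -
  have "(A ** outer e ** transpose A) *v x = outer (A *v e) *v x" for x
    by (simp add: matrix_vector_mul_assoc[symmetric] outer_vec matrix_vector_mult_scaleR)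
       (metis dot_lmul_matrix inner_commute vector_transpose_matrix)
  then show ?thesis by (simp add: matrix_eq)
qed

lemma matrix_add_distrib_right:
  fixes A B :: "real^'m^'n"
  shows "(A + B) ** C = A ** C + B ** C"
  by (simp add: matrix_matrix_mult_def vec_eq_iff distrib_right sum.distrib)

text \<open>A rotation takes a multiple of a coordinate vector to \<open>z\<close>; for that
  multiple the matrix is diagonal.\<close>

lemma det_mat_1_plus_outer:
  fixes z :: "real^'n"
  shows "det (mat 1 + outer z) = 1 + z \<bullet> z"
proof -
  obtain k :: 'n where True by simp
  let ?e = "norm z *\<^sub>R axis k (1::real)"
  obtain f where f: "orthogonal_transformation f" "f ?e = z"
    using orthogonal_transformation_exists[of ?e z] by auto
  define Q where "Q = matrix f"
  have Q: "orthogonal_matrix Q" "Q *v ?e = z"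
    using f by (auto simp: Q_def orthogonal_transformation_matrix)
  have QQ: "Q ** transpose Q = mat 1" using Q by (auto simp: orthogonal_matrix_def)
  then have dQ: "det Q * det (transpose Q) = 1" by (metis det_I det_mul)
  have "mat 1 + outer z = Q ** (mat 1 + outer ?e) ** transpose Q"
    by (simp add: matrix_add_ldistrib matrix_add_distrib_right outer_congruence Q QQ)
  then have "det (mat 1 + outer z) = det (mat 1 + outer ?e)"
    using dQ by (simp add: det_mul mult.commute mult.left_commute)
  also have "mat 1 + outer ?e = diag_matrix (\<lambda>i. if i = k then 1 + z \<bullet> z else 1)"
    by (auto simp: mat_def outer_def diag_matrix_def vec_eq_iff axis_def power2_norm_eq_inner[symmetric] power2_eq_square)
  also have "det \<dots> = 1 + z \<bullet> z" by (simp add: det_diag_matrix)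
  finally show ?thesis .
qed

text \<open>By \<open>det_mat_1_plus_outer\<close>, det (M + e e^T) = det M (1 + e . M^(-1) e), and
  the eigenvalues of det M times M^(-1) are products of all but one eigenvalue of \<open>M\<close>,
  hence at least 1. The bound separates volume density and slope in the boundary area
  density.\<close>

lemma det_plus_outer_ge:
  fixes M :: "real^'n^'n"
  assumes sym: "transpose M = M" and ge: "\<And>x. x \<bullet> x \<le> x \<bullet> (M *v x)"
  shows "det M + e \<bullet> e \<le> det (M + outer e)"
proof -
  obtain Q d where Q: "orthogonal_matrix Q" and M: "M = Q ** diag_matrix d ** transpose Q"
    and d: "\<And>i. 1 \<le> d i" and dM: "det M = (\<Prod>i\<in>UNIV. d i)"
    using det_ge_1[OF sym ge] by metis
  have QQ: "transpose Q ** Q = mat 1" "Q ** transpose Q = mat 1" using Q by (auto simp: orthogonal_matrix_def)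
  then have dQ: "det Q * det (transpose Q) = 1" by (metis det_I det_mul)
  have d0: "d i > 0" for i using d[of i] by linarith
  define u where "u = transpose Q *v e"
  \<comment> \<open>With D = \<open>diag_matrix d\<close>, \<open>z\<close> is D^(-1/2) u, so that D
    + u u^T = D^(1/2) (1 + z z^T) D^(1/2).\<close>
  define z where "z = (\<chi> i. u $ i / sqrt (d i))"
  let ?r = "diag_matrix (\<lambda>i. sqrt (d i))"
  have "Q *v u = e" unfolding u_def matrix_vector_mul_assoc by (simp add: QQ)
  have uu: "u \<bullet> u = e \<bullet> e"
    using quadratic_form_congruence[of e "transpose Q" "mat 1"] by (simp add: QQ u_def)
  have "?r *v z = u" using d0 by (auto simp: diag_matrix_vec z_def vec_eq_iff less_imp_neq[THEN not_sym])
  then have "diag_matrix d + outer u = ?r ** (mat 1 + outer z) ** transpose ?r"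
    using d0 outer_congruence[of ?r z] by (simp add: matrix_add_ldistrib matrix_add_distrib_right
        diag_matrix_mult less_imp_le)
  then have "det (diag_matrix d + outer u) = (\<Prod>i\<in>UNIV. sqrt (d i))\<^sup>2 * (1 + z \<bullet> z)"
    by (simp add: det_mul det_diag_matrix det_mat_1_plus_outer power2_eq_square)
  also have "(\<Prod>i\<in>UNIV. sqrt (d i))\<^sup>2 = (\<Prod>i\<in>UNIV. d i)"
    using d0 by (simp add: prod_power_distrib less_imp_le)
  finally have 1: "det (diag_matrix d + outer u) = (\<Prod>i\<in>UNIV. d i) + (\<Prod>i\<in>UNIV. d i) * (z \<bullet> z)"
    by (simp add: algebra_simps)
  have "(u $ i)\<^sup>2 \<le> (\<Prod>i\<in>UNIV. d i) * (z $ i)\<^sup>2" for i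
  proof -
    have "(\<Prod>i\<in>UNIV. d i) * (z $ i)\<^sup>2 = d i * (\<Prod>i\<in>UNIV - {i}. d i) * ((u $ i)\<^sup>2 / d i)"
      using d0[of i] by (simp add: z_def power_divide prod.remove[of UNIV i])
    also have "\<dots> = (\<Prod>i\<in>UNIV - {i}. d i) * (u $ i)\<^sup>2" using d0[of i] by simp
    also have "\<dots> \<ge> 1 * (u $ i)\<^sup>2" by (intro mult_right_mono prod_ge_1) (auto simp: d)
    finally show ?thesis by simp
  qed
  then have "u \<bullet> u \<le> (\<Prod>i\<in>UNIV. d i) * (z \<bullet> z)"
    by (auto simp: inner_vec_def sum_distrib_left power2_eq_square intro!: sum_mono)
  moreover have "M + outer e = Q ** (diag_matrix d + outer u) ** transpose Q"
    using outer_congruence[of Q u] \<open>Q *v u = e\<close> by (simp add: M matrix_add_ldistrib matrix_add_distrib_right)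
  then have "det (M + outer e) = det (diag_matrix d + outer u)"
    using dQ by (simp add: det_mul mult.commute mult.left_commute)
  ultimately show ?thesis using 1 dM uu by simp
qed

section \<open>Functions of class \<open>C\<^sup>k\<close> and uniqueness for differential equations\<close>

lemma frechet_derivative_cong_open:
  assumes "open U" "x \<in> U" "\<And>y. y \<in> U \<Longrightarrow> f y = g y"
  shows "frechet_derivative f (at x) = frechet_derivative g (at x)"
proof -
  have "(f has_derivative D) (at x) \<longleftrightarrow> (g has_derivative D) (at x)" for D
    using assms by (metis has_derivative_transform_within_open)
  then show ?thesis by (simp add: frechet_derivative_def)
qed

lemma Ck_open_transform:
  assumes U: "open U" and "\<And>x. x \<in> U \<Longrightarrow> f x = g x" "Ck_open m U f"
  shows "Ck_open m U g"
  using assms(2,3)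
proof (induction m arbitrary: f g)
  case 0
  then show ?case by (auto cong: continuous_on_cong)
next
  case (Suc m)
  have eq: "frechet_derivative f (at x) = frechet_derivative g (at x)" if "x \<in> U" for x
    using frechet_derivative_cong_open[OF U that] Suc.prems(1) by metis
  have "(g has_derivative frechet_derivative f (at x)) (at x)" if "x \<in> U" for x
  proof (rule has_derivative_transform_within_open[OF _ U that])
    show "(f has_derivative frechet_derivative f (at x)) (at x)"
      using Suc.prems(2) that by (simp add: frechet_derivative_works[symmetric])
  qed (use Suc.prems(1) in auto)
  then have "\<forall>x\<in>U. g differentiable (at x)" unfolding differentiable_def by blast
  moreover have "Ck_open m U (\<lambda>x. frechet_derivative g (at x) v)" for v
    by (rule Suc.IH[of "\<lambda>x. frechet_derivative f (at x) v"]) (use eq Suc.prems(2) in auto)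
  ultimately show ?case by simp
qed

text \<open>\<open>Ck_open\<close> recurses through \<open>frechet_derivative\<close>; here any
  explicit formula for the derivative takes its place. The closure under sums, products,
  compositions and reciprocals rests on this rule.\<close>

lemma Ck_openI:
  assumes U: "open U" and d: "\<And>x. x \<in> U \<Longrightarrow> (f has_derivative f' x) (at x)"
    and C: "\<And>v. Ck_open m U (\<lambda>x. f' x v)"
  shows "Ck_open (Suc m) U f"
proof -
  have eq: "f' x = frechet_derivative f (at x)" if "x \<in> U" for x
    using d[OF that] by (metis frechet_derivative_at)
  have "Ck_open m U (\<lambda>x. frechet_derivative f (at x) v)" for v
    by (rule Ck_open_transform[OF U _ C[of v]]) (simp add: eq)
  moreover have "\<forall>x\<in>U. f differentiable (at x)" unfolding differentiable_def using d by blast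
  ultimately show ?thesis by simp
qed

lemma Ck_open_Suc_has_derivative:
  assumes "Ck_open (Suc m) U f" "x \<in> U"
  shows "(f has_derivative frechet_derivative f (at x)) (at x)"
  using assms by (auto simp: frechet_derivative_works)

lemma Ck_open_Suc_derivative:
  assumes "Ck_open (Suc m) U f" 
  shows "Ck_open m U (\<lambda>x. frechet_derivative f (at x) v)"
  using assms by auto

lemma Ck_open_continuous_on: "Ck_open m U f \<Longrightarrow> continuous_on U f"
  by (cases m) (auto intro!: continuous_at_imp_continuous_on differentiable_imp_continuous_within)

lemma Ck_open_Suc: "Ck_open (Suc m) U f \<Longrightarrow> Ck_open m U f"
proof (induction m arbitrary: f)
  case 0
  then show ?case using Ck_open_continuous_on[OF 0] by simp
next
  case (Suc m)
  show ?case
    unfolding Ck_open.simps(2)[of m]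
    using Suc.prems Suc.IH Ck_open_Suc_derivative[OF Suc.prems] by auto
qed

lemma Ck_open_subset: "Ck_open m U f \<Longrightarrow> V \<subseteq> U \<Longrightarrow> Ck_open m V f"
  by (induction m arbitrary: f) (auto intro: continuous_on_subset)

lemma Ck_open_const: "open U \<Longrightarrow> Ck_open m U (\<lambda>x. c)"
  by (induction m arbitrary: c) (auto intro: Ck_openI[where f'="\<lambda>_ _. 0"])

lemma Ck_open_bounded_linear:
  assumes "open U" "bounded_linear L" "Ck_open m U f"
  shows "Ck_open m U (\<lambda>x. L (f x))"
  using assms(3)
proof (induction m arbitrary: f)
  case 0
  then show ?case using assms(2) by (auto intro: bounded_linear.continuous_on)
next
  case (Suc m)
  show ?case
    by (rule Ck_openI[OF \<open>open U\<close> bounded_linear.has_derivative[OF assms(2) Ck_open_Suc_has_derivative[OF Suc.prems]]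
          Suc.IH[OF Ck_open_Suc_derivative[OF Suc.prems]]])
qed

lemma Ck_open_id: "open U \<Longrightarrow> Ck_open m U (\<lambda>x. x)"
  by (cases m) (auto intro: Ck_openI[where f'="\<lambda>_ v. v"] Ck_open_const)

lemma Ck_open_linear:
  fixes L :: "'a::euclidean_space \<Rightarrow> 'b::real_normed_vector"
  shows "open U \<Longrightarrow> linear L \<Longrightarrow> Ck_open m U L"
  using Ck_open_bounded_linear[OF _ _ Ck_open_id] linear_conv_bounded_linear by blast

lemma Ck_open_add:
  assumes "open U" "Ck_open m U f" "Ck_open m U g"
  shows "Ck_open m U (\<lambda>x. f x + g x)"
  using assms(2,3)
proof (induction m arbitrary: f g)
  case 0
  then show ?case by (auto intro: continuous_on_add)
next
  case (Suc m)
  then show ?case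
    by (intro Ck_openI[where f'="\<lambda>x v. frechet_derivative f (at x) v + frechet_derivative g (at x) v"] \<open>open U\<close>)
       (auto simp: frechet_derivative_works intro!: has_derivative_add)
qed

lemma Ck_open_bilinear:
  assumes U: "open U" and B: "bounded_bilinear B" and "Ck_open m U f" "Ck_open m U g"
  shows "Ck_open m U (\<lambda>x. B (f x) (g x))"
  using assms(3,4)
proof (induction m arbitrary: f g)
  case 0
  then show ?case using B by (auto intro: bounded_bilinear.continuous_on)
next
  case (Suc m)
  have "Ck_open m U f" "Ck_open m U g" using Suc.prems by (auto intro: Ck_open_Suc simp del: Ck_open.simps)
  then have "Ck_open m U (\<lambda>x. B (f x) (frechet_derivative g (at x) v) + B (frechet_derivative f (at x) v) (g x))" for v
    using Suc.prems by (intro Ck_open_add[OF U] Suc.IH) (auto intro: Ck_open_Suc_derivative simp del: Ck_open.simps)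
  then show ?case
    using Suc.prems
    by (intro Ck_openI[where f'="\<lambda>x v. B (f x) (frechet_derivative g (at x) v) + B (frechet_derivative f (at x) v) (g x)"] U
         bounded_bilinear.FDERIV[OF B] Ck_open_Suc_has_derivative)
       (auto simp del: Ck_open.simps)
qed

lemmas Ck_open_mult = Ck_open_bilinear[OF _ bounded_bilinear_mult]
lemmas Ck_open_scaleR = Ck_open_bilinear[OF _ bounded_bilinear_scaleR]
lemmas Ck_open_inner = Ck_open_bilinear[OF _ bounded_bilinear_inner]

lemma Ck_open_minus:
  assumes "open U" "Ck_open m U f" shows "Ck_open m U (\<lambda>x. - f x)"
  using Ck_open_bounded_linear[OF assms(1) bounded_linear_minus[OF bounded_linear_ident] assms(2)] by simp

lemma Ck_open_diff:
  assumes "open U" "Ck_open m U f" "Ck_open m U g" shows "Ck_open m U (\<lambda>x. f x - g x)"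
  using Ck_open_add[OF assms(1,2) Ck_open_minus[OF assms(1,3)]] by simp

lemma Ck_open_sum:
  assumes "open U" "\<And>i. i \<in> I \<Longrightarrow> Ck_open m U (f i)"
  shows "Ck_open m U (\<lambda>x. \<Sum>i\<in>I. f i x)"
  using assms(2) by (induction I rule: infinite_finite_induct) (auto intro!: Ck_open_const Ck_open_add assms(1))

lemma Ck_open_prod:
  fixes f :: "'i \<Rightarrow> 'a::euclidean_space \<Rightarrow> real"
  assumes "open U" "\<And>i. i \<in> I \<Longrightarrow> Ck_open m U (f i)"
  shows "Ck_open m U (\<lambda>x. \<Prod>i\<in>I. f i x)"
  using assms(2) by (induction I rule: infinite_finite_induct) (auto intro!: Ck_open_const Ck_open_mult assms(1))

lemma Ck_open_vec_nth: "open U \<Longrightarrow> Ck_open m U f \<Longrightarrow> Ck_open m U (\<lambda>x. f x $ i)"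
  by (rule Ck_open_bounded_linear[OF _ bounded_linear_vec_nth])

lemma Ck_open_vecI:
  fixes f :: "'a::euclidean_space \<Rightarrow> ('b::real_normed_vector)^'n"
  assumes "open U" "\<And>i. Ck_open m U (\<lambda>x. f x $ i)"
  shows "Ck_open m U f"
proof -
  have eq: "f x = (\<Sum>i\<in>UNIV. axis i (f x $ i))" for x
    by (simp add: vec_eq_iff axis_def if_distrib[where f="\<lambda>c. c $ _"] cong: if_cong)
  have "bounded_linear (axis i :: 'b \<Rightarrow> 'b^'n)" for i
  proof (rule bounded_linear_intro[where K=1])
    show "norm (axis i x :: 'b^'n) \<le> norm x * 1" for x
      by (simp add: norm_vec_def axis_def L2_set_def if_distrib[where f=norm] if_distrib[where f="\<lambda>c. c^2"] cong: if_cong)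
  qed (auto simp: axis_def vec_eq_iff)
  then have "Ck_open m U (\<lambda>x. \<Sum>i\<in>UNIV. axis i (f x $ i))"
    using assms by (intro Ck_open_sum assms(1) Ck_open_bounded_linear[of U "axis _"]) auto
  then show ?thesis using eq by simp
qed

text \<open>In the chain rule the direction fed to the derivative of \<open>f\<close> depends on the
  point, whereas \<open>Ck_open\<close> speaks of fixed directions. Expanding it in the basis, as in
  \<open>?D\<close>, leaves derivatives of \<open>f\<close> in basis directions, composed with
  \<open>g\<close>, to which the induction hypothesis applies.\<close>

lemma Ck_open_compose:
  fixes f :: "'b::euclidean_space \<Rightarrow> 'c::real_normed_vector" and g :: "'a::euclidean_space \<Rightarrow> 'b"
  assumes U: "open U" and "Ck_open m U g" and V: "open V" and "Ck_open m V f" and sub: "g ` U \<subseteq> V"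
  shows "Ck_open m U (\<lambda>x. f (g x))"
  using assms(2,4)
proof (induction m arbitrary: f)
  case 0
  then show ?case using sub by (auto intro: continuous_on_compose2)
next
  case (Suc m)
  let ?D = "\<lambda>x v. \<Sum>b\<in>Basis. (frechet_derivative g (at x) v \<bullet> b) *\<^sub>R frechet_derivative f (at (g x)) b"
  have "((\<lambda>x. f (g x)) has_derivative ?D x) (at x)" if x: "x \<in> U" for x
  proof -
    have f: "(f has_derivative frechet_derivative f (at (g x))) (at (g x))"
      using Ck_open_Suc_has_derivative[OF Suc.prems(2)] x sub by auto
    have g: "(g has_derivative frechet_derivative g (at x)) (at x)"
      using Ck_open_Suc_has_derivative[OF Suc.prems(1)] x by auto
    have "((\<lambda>x. f (g x)) has_derivative (\<lambda>v. frechet_derivative f (at (g x)) (frechet_derivative g (at x) v))) (at x)"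
      using diff_chain_at[OF g f] by (simp add: o_def)
    moreover have "frechet_derivative f (at (g x)) (frechet_derivative g (at x) v) = ?D x v" for v
    proof -
      have lin: "linear (frechet_derivative f (at (g x)))" using f has_derivative_linear by blast
      have "frechet_derivative f (at (g x)) (frechet_derivative g (at x) v)
        = frechet_derivative f (at (g x)) (\<Sum>b\<in>Basis. (frechet_derivative g (at x) v \<bullet> b) *\<^sub>R b)"
        by (simp add: euclidean_representation)
      also have "\<dots> = ?D x v" by (simp add: linear_sum[OF lin] linear_scale[OF lin])
      finally show ?thesis .
    qed
    ultimately show ?thesis by simp
  qed
  moreover have "Ck_open m U g" using Suc.prems(1) by (rule Ck_open_Suc)
  then have "Ck_open m U (\<lambda>x. ?D x v)" for v
    using Suc.prems
    by (intro Ck_open_sum Ck_open_scaleR Ck_open_inner U Ck_open_const Suc.IH Ck_open_Suc_derivative)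
       (auto simp del: Ck_open.simps)
  ultimately show ?case by (intro Ck_openI[where f'="?D"] U)
qed

lemma Ck_open_inverse:
  fixes f :: "'a::euclidean_space \<Rightarrow> real"
  assumes U: "open U" and "Ck_open m U f" and nz: "\<And>x. x \<in> U \<Longrightarrow> f x \<noteq> 0"
  shows "Ck_open m U (\<lambda>x. inverse (f x))"
  using assms(2)
proof (induction m)
  case 0
  then show ?case using nz by (auto intro: continuous_on_inverse)
next
  case (Suc m)
  have "Ck_open m U (\<lambda>x. inverse (f x))" using Suc.IH Suc.prems by (auto intro: Ck_open_Suc simp del: Ck_open.simps)
  then have "Ck_open m U (\<lambda>x. - (inverse (f x) * frechet_derivative f (at x) v * inverse (f x)))" for v
    using Suc.prems by (intro Ck_open_minus Ck_open_mult U) (auto intro: Ck_open_Suc_derivative simp del: Ck_open.simps)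
  then show ?case
    by (intro Ck_openI[OF U, where f'="\<lambda>x v. - (inverse (f x) * frechet_derivative f (at x) v * inverse (f x))"]
          Deriv.has_derivative_inverse nz Ck_open_Suc_has_derivative[OF Suc.prems])
qed

lemma Ck_open_det:
  fixes A :: "'a::euclidean_space \<Rightarrow> real^'n^'n"
  assumes "open U" "\<And>i j. Ck_open m U (\<lambda>x. A x $ i $ j)"
  shows "Ck_open m U (\<lambda>x. det (A x))"
  unfolding det_def by (intro Ck_open_sum Ck_open_mult Ck_open_prod Ck_open_const assms)

text \<open>Cramer's rule reduces smoothness of the inverse matrix, and with it of the Christoffel
  symbols, to determinants and one reciprocal.\<close>

lemma matrix_inv_cramer:
  fixes A :: "real^'n^'n"
  assumes "invertible A"
  shows "matrix_inv A $ l $ m = det (\<chi> i j. if j = l then axis m 1 $ i else A $ i $ j) * inverse (det A)"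
proof -
  have "det A \<noteq> 0" using assms invertible_det_nz by blast
  moreover have "A *v (matrix_inv A *v axis m 1) = axis m 1"
    by (simp add: matrix_vector_mul_assoc matrix_inv_mult[OF assms])
  ultimately have "matrix_inv A *v axis m 1 = (\<chi> k. det (\<chi> i j. if j = k then axis m 1 $ i else A $ i $ j) / det A)"
    using cramer[of A "matrix_inv A *v axis m 1" "axis m 1"] by simp
  moreover have "matrix_inv A $ l $ m = (matrix_inv A *v axis m 1) $ l"
    by (simp add: matrix_vector_mult_def axis_def if_distrib[where f="\<lambda>c. _ * c"] cong: if_cong)
  ultimately show ?thesis by (simp add: divide_inverse)
qed

lemma Ck_open_matrix_inv:
  fixes A :: "'a::euclidean_space \<Rightarrow> real^'n^'n"
  assumes U: "open U" and A: "Ck_open m U A" and inv: "\<And>x. x \<in> U \<Longrightarrow> invertible (A x)"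
  shows "Ck_open m U (\<lambda>x. matrix_inv (A x) $ l $ k)"
proof -
  have c: "Ck_open m U (\<lambda>x. A x $ i $ j)" for i j
    using A U by (intro Ck_open_vec_nth)
  have "Ck_open m U (\<lambda>x. det (\<chi> i j. if j = l then axis k 1 $ i else A x $ i $ j) * inverse (det (A x)))"
  proof (intro Ck_open_mult U Ck_open_inverse Ck_open_det c)
    show "Ck_open m U (\<lambda>x. (\<chi> i j. if j = l then axis k 1 $ i else A x $ i $ j) $ i $ j)" for i j
      using c U by (cases "j = l") (auto intro: Ck_open_const)
    show "det (A x) \<noteq> 0" if "x \<in> U" for x using inv[OF that] invertible_det_nz by blast
  qed
  then show ?thesis
    by (rule Ck_open_transform[OF U, rotated]) (simp add: matrix_inv_cramer[OF inv])
qed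

section \<open>The chain rule along curves and the symmetry of second derivatives\<close>

lemma has_vector_derivative_compose:
  assumes c: "(c has_vector_derivative c') (at t within S)" and F: "(F has_derivative F') (at (c t))"
  shows "((\<lambda>t. F (c t)) has_vector_derivative F' c') (at t within S)"
proof -
  have "linear F'" using F has_derivative_linear by blast
  then show ?thesis
    using has_derivative_compose[OF c[unfolded has_vector_derivative_def] F]
    by (simp add: has_vector_derivative_def linear_scale)
qed

text \<open>The mixed second difference is computed in two ways by applying the mean value theorem
  twice.\<close>

lemma mixed_difference_mvt:
  fixes f :: "'a::euclidean_space \<Rightarrow> real"
  assumes "Ck_open 2 U f" and h: "h > 0"
    and sub: "\<And>s t. s \<in> {0..h} \<Longrightarrow> t \<in> {0..h} \<Longrightarrow> x + s *\<^sub>R v + t *\<^sub>R w \<in> U"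
  obtains s t where "s \<in> {0..h}" "t \<in> {0..h}"
    "f (x + h *\<^sub>R v + h *\<^sub>R w) - f (x + h *\<^sub>R v) - f (x + h *\<^sub>R w) + f x =
      h * h * frechet_derivative (\<lambda>y. frechet_derivative f (at y) v) (at (x + s *\<^sub>R v + t *\<^sub>R w)) w"
proof -
  have C1: "Ck_open (Suc 0) U (\<lambda>y. frechet_derivative f (at y) v)"
    using assms(1) by (simp add: numeral_2_eq_2)
  have df: "(f has_derivative frechet_derivative f (at y)) (at y)" if "y \<in> U" for y
    using Ck_open_Suc_has_derivative[of "Suc 0" U f y] assms(1) that by (simp add: numeral_2_eq_2)
  have d2f: "((\<lambda>y. frechet_derivative f (at y) v) has_derivative frechet_derivative (\<lambda>y. frechet_derivative f (at y) v) (at y)) (at y)"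
    if "y \<in> U" for y
    using Ck_open_Suc_has_derivative[OF C1 that] .
  have 1: "((\<lambda>s. f (x + s *\<^sub>R v + t *\<^sub>R w)) has_real_derivative frechet_derivative f (at (x + s *\<^sub>R v + t *\<^sub>R w)) v) (at s)"
    if "s \<in> {0..h}" "t \<in> {0..h}" for s t
  proof -
    have "((\<lambda>s. x + s *\<^sub>R v + t *\<^sub>R w) has_vector_derivative v) (at s)"
      by (auto intro!: derivative_eq_intros simp: has_vector_derivative_def)
    from has_vector_derivative_compose[OF this df[OF sub[OF that]]] show ?thesis
      by (simp add: has_real_derivative_iff_has_vector_derivative)
  qed
  have 2: "((\<lambda>t. frechet_derivative f (at (x + s *\<^sub>R v + t *\<^sub>R w)) v) has_real_derivative
      frechet_derivative (\<lambda>y. frechet_derivative f (at y) v) (at (x + s *\<^sub>R v + t *\<^sub>R w)) w) (at t)"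
    if "s \<in> {0..h}" "t \<in> {0..h}" for s t
  proof -
    have "((\<lambda>t. x + s *\<^sub>R v + t *\<^sub>R w) has_vector_derivative w) (at t)"
      by (auto intro!: derivative_eq_intros simp: has_vector_derivative_def)
    from has_vector_derivative_compose[OF this d2f[OF sub[OF that]]] show ?thesis
      by (simp add: has_real_derivative_iff_has_vector_derivative)
  qed
  have "\<exists>s. 0 < s \<and> s < h \<and> (f (x + h *\<^sub>R v + h *\<^sub>R w) - f (x + h *\<^sub>R v + 0 *\<^sub>R w)) - (f (x + 0 *\<^sub>R v + h *\<^sub>R w) - f (x + 0 *\<^sub>R v + 0 *\<^sub>R w))
      = (h - 0) * (frechet_derivative f (at (x + s *\<^sub>R v + h *\<^sub>R w)) v - frechet_derivative f (at (x + s *\<^sub>R v + 0 *\<^sub>R w)) v)"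
    using h by (intro MVT2 DERIV_diff 1) auto
  then obtain s where s: "0 < s" "s < h" and e1: "(f (x + h *\<^sub>R v + h *\<^sub>R w) - f (x + h *\<^sub>R v)) - (f (x + h *\<^sub>R w) - f x)
      = h * (frechet_derivative f (at (x + s *\<^sub>R v + h *\<^sub>R w)) v - frechet_derivative f (at (x + s *\<^sub>R v + 0 *\<^sub>R w)) v)" by auto
  have "\<exists>t. 0 < t \<and> t < h \<and> frechet_derivative f (at (x + s *\<^sub>R v + h *\<^sub>R w)) v - frechet_derivative f (at (x + s *\<^sub>R v + 0 *\<^sub>R w)) v
      = (h - 0) * frechet_derivative (\<lambda>y. frechet_derivative f (at y) v) (at (x + s *\<^sub>R v + t *\<^sub>R w)) w"
    using h s by (intro MVT2 2) auto
  then obtain t where t: "0 < t" "t < h" and e2: "frechet_derivative f (at (x + s *\<^sub>R v + h *\<^sub>R w)) v - frechet_derivative f (at (x + s *\<^sub>R v + 0 *\<^sub>R w)) v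
      = h * frechet_derivative (\<lambda>y. frechet_derivative f (at y) v) (at (x + s *\<^sub>R v + t *\<^sub>R w)) w" by auto
  show ?thesis
    using that[of s t] s t e1 unfolding e2 by simp
qed

text \<open>The mixed difference is symmetric in \<open>v\<close> and \<open>w\<close>, so the two
  second derivatives take the same value at two possibly different points of a small parallelogram;
  continuity brings both points to \<open>x\<close>.\<close>

lemma second_derivative_symmetric_real:
  fixes f :: "'a::euclidean_space \<Rightarrow> real"
  assumes U: "open U" and C2: "Ck_open 2 U f" and x: "x \<in> U"
  shows "frechet_derivative (\<lambda>y. frechet_derivative f (at y) v) (at x) w =
         frechet_derivative (\<lambda>y. frechet_derivative f (at y) w) (at x) v"
proof (rule ccontr)
  let ?D = "\<lambda>v w y. frechet_derivative (\<lambda>y. frechet_derivative f (at y) v) (at y) w"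
  assume "?D v w x \<noteq> ?D w v x"
  define e where "e = \<bar>?D v w x - ?D w v x\<bar> / 2"
  have e: "e > 0" using \<open>?D v w x \<noteq> ?D w v x\<close> by (simp add: e_def)
  have cont: "continuous (at x) (?D a b)" for a b
  proof -
    have "continuous_on U (?D a b)" using C2 by (simp add: numeral_2_eq_2)
    then show ?thesis using U x by (simp add: continuous_on_eq_continuous_at)
  qed
  have near: "\<exists>d>0. \<forall>y. dist y x < d \<longrightarrow> dist (?D a b y) (?D a b x) < e" for a b
    using cont[of a b] e unfolding continuous_at by (auto simp: tendsto_iff eventually_at dist_commute) (metis dist_self e)
  obtain d1 where d1: "d1 > 0" "\<And>y. dist y x < d1 \<Longrightarrow> dist (?D v w y) (?D v w x) < e" using near by metis
  obtain d2 where d2: "d2 > 0" "\<And>y. dist y x < d2 \<Longrightarrow> dist (?D w v y) (?D w v x) < e" using near by metis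
  obtain d3 where d3: "d3 > 0" "ball x d3 \<subseteq> U" using U x open_contains_ball by blast
  define d where "d = min d1 (min d2 d3)"
  \<comment> \<open>With this \<open>h\<close> the whole parallelogram lies within d / 2 of
    \<open>x\<close>; the 1 keeps the denominator positive when \<open>v\<close> and
    \<open>w\<close> are zero.\<close>
  define h where "h = d / (2 * (norm v + norm w + 1))"
  have d: "d > 0" using d1 d2 d3 by (simp add: d_def)
  have h: "h > 0" using d by (simp add: h_def add_nonneg_pos)
  have small: "dist (x + s *\<^sub>R v + t *\<^sub>R w) x < d" if "s \<in> {0..h}" "t \<in> {0..h}" for s t
  proof -
    have "dist (x + s *\<^sub>R v + t *\<^sub>R w) x \<le> s * norm v + t * norm w"
      using that norm_triangle_ineq[of "s *\<^sub>R v" "t *\<^sub>R w"] by (simp add: dist_norm add.assoc)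
    also have "\<dots> \<le> h * norm v + h * norm w" using that by (intro add_mono mult_right_mono) auto
    also have "\<dots> \<le> h * (norm v + norm w + 1)" using h by (simp add: algebra_simps)
    also have "\<dots> = d / 2"
    proof -
      have "norm v + norm w + 1 \<noteq> 0" by (metis add_nonneg_pos add_nonneg_nonneg less_numeral_extra(1) norm_ge_zero order_less_irrefl)
      then have "h * (2 * (norm v + norm w + 1)) = d" unfolding h_def by simp
      then show ?thesis by (simp add: algebra_simps)
    qed
    finally show ?thesis using d by simp
  qed
  have sub1: "x + s *\<^sub>R v + t *\<^sub>R w \<in> U" if "s \<in> {0..h}" "t \<in> {0..h}" for s t
    using small[OF that] d3 by (auto simp: d_def dist_commute subset_iff)
  have sub2: "x + s *\<^sub>R w + t *\<^sub>R v \<in> U" if "s \<in> {0..h}" "t \<in> {0..h}" for s t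
    using sub1[OF that(2,1)] by (simp add: add.assoc add.commute add.left_commute)
  obtain s t where st: "s \<in> {0..h}" "t \<in> {0..h}"
    "f (x + h *\<^sub>R v + h *\<^sub>R w) - f (x + h *\<^sub>R v) - f (x + h *\<^sub>R w) + f x = h * h * ?D v w (x + s *\<^sub>R v + t *\<^sub>R w)"
    using mixed_difference_mvt[OF C2 h sub1] by metis
  obtain s' t' where st': "s' \<in> {0..h}" "t' \<in> {0..h}"
    "f (x + h *\<^sub>R w + h *\<^sub>R v) - f (x + h *\<^sub>R w) - f (x + h *\<^sub>R v) + f x = h * h * ?D w v (x + s' *\<^sub>R w + t' *\<^sub>R v)"
    using mixed_difference_mvt[OF C2 h sub2] by metis
  have sw: "x + h *\<^sub>R w + h *\<^sub>R v = x + h *\<^sub>R v + h *\<^sub>R w" "x + s' *\<^sub>R w + t' *\<^sub>R v = x + t' *\<^sub>R v + s' *\<^sub>R w"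
    by (simp_all add: add.assoc add.commute)
  have "h * h * ?D v w (x + s *\<^sub>R v + t *\<^sub>R w) = h * h * ?D w v (x + t' *\<^sub>R v + s' *\<^sub>R w)"
    using st(3) st'(3) unfolding sw by linarith
  then have eq: "?D v w (x + s *\<^sub>R v + t *\<^sub>R w) = ?D w v (x + t' *\<^sub>R v + s' *\<^sub>R w)" using h by simp
  have "dist (?D v w (x + s *\<^sub>R v + t *\<^sub>R w)) (?D v w x) < e"
    using d1(2) small[OF st(1,2)] by (simp add: d_def)
  moreover have "dist (?D w v (x + t' *\<^sub>R v + s' *\<^sub>R w)) (?D w v x) < e"
    using d2(2) small[OF st'(2,1)] by (simp add: d_def)
  ultimately show False unfolding eq e_def dist_real_def by (simp add: field_simps abs_if split: if_splits)
qed

lemma frechet_derivative_inner_right: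
  assumes "f differentiable (at x)"
  shows "frechet_derivative (\<lambda>y. f y \<bullet> b) (at x) v = frechet_derivative f (at x) v \<bullet> b"
proof -
  have "((\<lambda>y. f y \<bullet> b) has_derivative (\<lambda>v. frechet_derivative f (at x) v \<bullet> b)) (at x)"
    using assms by (intro has_derivative_inner_left) (simp add: frechet_derivative_works)
  then show ?thesis by (metis frechet_derivative_at)
qed

lemma second_derivative_symmetric:
  fixes f :: "'a::euclidean_space \<Rightarrow> 'b::euclidean_space"
  assumes U: "open U" and C2: "Ck_open 2 U f" and x: "x \<in> U"
  shows "frechet_derivative (\<lambda>y. frechet_derivative f (at y) v) (at x) w =
         frechet_derivative (\<lambda>y. frechet_derivative f (at y) w) (at x) v"
proof (rule euclidean_eqI)
  fix b :: 'b assume "b \<in> Basis"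
  have C: "Ck_open (Suc (Suc 0)) U f" using C2 by (simp add: numeral_2_eq_2)
  have 1: "frechet_derivative (\<lambda>y. frechet_derivative f (at y) v) (at x) w \<bullet> b
      = frechet_derivative (\<lambda>y. frechet_derivative (\<lambda>y. f y \<bullet> b) (at y) v) (at x) w" for v w
  proof -
    have "frechet_derivative (\<lambda>y. frechet_derivative (\<lambda>y. f y \<bullet> b) (at y) v) (at x)
        = frechet_derivative (\<lambda>y. frechet_derivative f (at y) v \<bullet> b) (at x)"
      using C by (intro frechet_derivative_cong_open[OF U x] frechet_derivative_inner_right) auto
    then show ?thesis using C x by (simp add: frechet_derivative_inner_right)
  qed
  have "Ck_open 2 U (\<lambda>y. f y \<bullet> b)" by (intro Ck_open_inner U C2 Ck_open_const)
  then show "frechet_derivative (\<lambda>y. frechet_derivative f (at y) v) (at x) w \<bullet> b =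
      frechet_derivative (\<lambda>y. frechet_derivative f (at y) w) (at x) v \<bullet> b"
    unfolding 1 by (rule second_derivative_symmetric_real[OF U _ x])
qed

section \<open>Uniqueness for ordinary differential equations\<close>

lemma Ck_open_local_lipschitz:
  fixes X :: "'a::euclidean_space \<Rightarrow> 'b::euclidean_space"
  assumes U: "open U" and C1: "Ck_open (Suc 0) U X"
  shows "local_lipschitz (UNIV::real set) U (\<lambda>t. X)"
proof (rule local_lipschitzI)
  fix t :: real and x assume x: "x \<in> U"
  obtain d where d: "d > 0" "cball x d \<subseteq> U" using U x open_contains_cball by blast
  have "continuous_on U (\<lambda>y. \<Sum>b\<in>Basis. norm (frechet_derivative X (at y) b))"
    using C1 by (intro continuous_intros) auto
  then have "continuous_on (cball x d) (\<lambda>y. \<Sum>b\<in>Basis. norm (frechet_derivative X (at y) b))"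
    using d continuous_on_subset by blast
  then have "bounded ((\<lambda>y. \<Sum>b\<in>Basis. norm (frechet_derivative X (at y) b)) ` cball x d)"
    by (intro compact_imp_bounded compact_continuous_image) auto
  then obtain B where B0: "B > 0"
    and "\<forall>z\<in>(\<lambda>y. \<Sum>b\<in>Basis. norm (frechet_derivative X (at y) b)) ` cball x d. norm z \<le> B"
    unfolding bounded_pos by blast
  then have B: "B > 0" "\<And>y. y \<in> cball x d \<Longrightarrow> (\<Sum>b\<in>Basis. norm (frechet_derivative X (at y) b)) \<le> B"
    by (auto intro: abs_le_D1)
  have "B-lipschitz_on (cball x d) X"
  proof (rule lipschitz_onI)
    fix y z assume yz: "y \<in> cball x d" "z \<in> cball x d"
    have "norm (X y - X z) \<le> B * norm (y - z)"
    proof (rule differentiable_bound[OF convex_cball])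
      fix u assume u: "u \<in> cball x d"
      have du: "(X has_derivative frechet_derivative X (at u)) (at u)"
        using Ck_open_Suc_has_derivative[OF C1] u d by auto
      then show "(X has_derivative frechet_derivative X (at u)) (at u within cball x d)"
        by (rule has_derivative_at_withinI)
      have lin: "linear (frechet_derivative X (at u))" using du has_derivative_linear by blast
      show "onorm (frechet_derivative X (at u)) \<le> B"
      proof (rule onorm_le)
        fix v
        have "frechet_derivative X (at u) v = (\<Sum>b\<in>Basis. (v \<bullet> b) *\<^sub>R frechet_derivative X (at u) b)"
        proof -
          have "frechet_derivative X (at u) v = frechet_derivative X (at u) (\<Sum>b\<in>Basis. (v \<bullet> b) *\<^sub>R b)"
            by (simp add: euclidean_representation)
          also have "\<dots> = (\<Sum>b\<in>Basis. (v \<bullet> b) *\<^sub>R frechet_derivative X (at u) b)"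
            by (simp add: linear_sum[OF lin] linear_scale[OF lin])
          finally show ?thesis .
        qed
        also have "norm \<dots> \<le> (\<Sum>b\<in>Basis. norm v * norm (frechet_derivative X (at u) b))"
          by (intro sum_norm_le) (simp add: Basis_le_norm mult_right_mono)
        also have "\<dots> \<le> norm v * B" using B(2)[OF u] by (simp add: sum_distrib_left[symmetric] mult_left_mono)
        finally show "norm (frechet_derivative X (at u) v) \<le> B * norm v" by (simp add: mult.commute)
      qed
    qed (use yz in auto)
    then show "dist (X y) (X z) \<le> B * dist y z" by (simp add: dist_norm)
  qed (use B in simp)
  then have "B-lipschitz_on (cball x d \<inter> U) X"
    by (rule lipschitz_on_subset) auto
  then have "\<exists>L. \<forall>t\<in>cball t d \<inter> UNIV. L-lipschitz_on (cball x d \<inter> U) X" by blast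
  then show "\<exists>u>0. \<exists>L. \<forall>t\<in>cball t u \<inter> UNIV. L-lipschitz_on (cball x u \<inter> U) X" using d(1) by blast
qed

text \<open>Gronwall's argument: on the compact union \<open>K\<close> of the two trajectories the
  field has a Lipschitz constant \<open>L\<close>, so exp (- 2 L t) |u - v|^2 does not increase from
  its initial value 0.\<close>

lemma ode_unique:
  fixes X :: "'a::euclidean_space \<Rightarrow> 'a"
  assumes U: "open U" and C1: "Ck_open (Suc 0) U X"
    and u: "\<And>t. t \<in> {0..T} \<Longrightarrow> (u has_vector_derivative X (u t)) (at t within {0..T})"
    and v: "\<And>t. t \<in> {0..T} \<Longrightarrow> (v has_vector_derivative X (v t)) (at t within {0..T})"
    and uU: "\<And>t. t \<in> {0..T} \<Longrightarrow> u t \<in> U" and vU: "\<And>t. t \<in> {0..T} \<Longrightarrow> v t \<in> U"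
    and init: "u 0 = v 0" and t: "t \<in> {0..T}"
  shows "u t = v t"
proof -
  have cu: "continuous_on {0..T} u" "continuous_on {0..T} v"
    unfolding continuous_on_eq_continuous_within
    by (metis u has_vector_derivative_continuous) (metis v has_vector_derivative_continuous)
  define K where "K = u ` {0..T} \<union> v ` {0..T}"
  have "compact K" unfolding K_def using cu by (intro compact_Un compact_continuous_image) auto
  moreover have "local_lipschitz {0::real} K (\<lambda>t. X)"
    by (rule local_lipschitz_subset[OF Ck_open_local_lipschitz[OF U C1]]) (use uU vU in \<open>auto simp: K_def\<close>)
  ultimately obtain L where L: "L-lipschitz_on K X"
    using local_lipschitz_compact_implies_lipschitz[of "{0::real}" K "\<lambda>t. X"] by auto
  define w where "w = (\<lambda>t. exp (- (2 * L) * t) * ((u t - v t) \<bullet> (u t - v t)))"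
  have "w t \<le> w 0"
  proof (rule DERIV_nonpos_imp_decreasing_open[of 0 t w])
    show "0 \<le> t" using t by simp
    show "continuous_on {0..t} w"
      unfolding w_def using t by (intro continuous_intros continuous_on_subset[OF cu(1)] continuous_on_subset[OF cu(2)]) auto
    fix s assume s: "0 < s" "s < t"
    have "at s within {0..T} = at s" using s t by (intro at_within_Icc_at) auto
    then have du: "(u has_vector_derivative X (u s)) (at s)" and dv: "(v has_vector_derivative X (v s)) (at s)"
      using u[of s] v[of s] s t by auto
    have d: "((\<lambda>t. (u t - v t) \<bullet> (u t - v t)) has_vector_derivative 2 * ((u s - v s) \<bullet> (X (u s) - X (v s)))) (at s)"
      using bounded_bilinear.has_vector_derivative[OF bounded_bilinear_inner, OF has_vector_derivative_diff[OF du dv] has_vector_derivative_diff[OF du dv]]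
      by (simp add: inner_commute)
    define Y where "Y = exp (- (2 * L) * s) * (2 * ((u s - v s) \<bullet> (X (u s) - X (v s)))) + - (2 * L) * exp (- (2 * L) * s) * ((u s - v s) \<bullet> (u s - v s))"
    have "(w has_real_derivative Y) (at s)"
      unfolding w_def Y_def using d
      by (auto intro!: derivative_eq_intros simp: has_real_derivative_iff_has_vector_derivative[symmetric])
    moreover have "Y \<le> 0"
    proof -
      have "(u s - v s) \<bullet> (X (u s) - X (v s)) \<le> norm (u s - v s) * norm (X (u s) - X (v s))"
        by (rule norm_cauchy_schwarz)
      also have "\<dots> \<le> norm (u s - v s) * (L * norm (u s - v s))"
        using lipschitz_onD[OF L, of "u s" "v s"] s t
        by (intro mult_left_mono) (auto simp: K_def dist_norm)
      also have "\<dots> = L * ((u s - v s) \<bullet> (u s - v s))" by (simp add: dot_square_norm power2_eq_square)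
      finally have "exp (- (2 * L) * s) * (2 * ((u s - v s) \<bullet> (X (u s) - X (v s)))) \<le> exp (- (2 * L) * s) * (2 * (L * ((u s - v s) \<bullet> (u s - v s))))"
        by simp
      then show ?thesis by (simp add: Y_def)
    qed
    ultimately show "\<exists>y. (w has_real_derivative y) (at s) \<and> y \<le> 0" by blast
  qed
  then have "(u t - v t) \<bullet> (u t - v t) \<le> 0"
    by (simp add: w_def init mult_le_0_iff)
  then have "(u t - v t) \<bullet> (u t - v t) = 0" using inner_ge_zero[of "u t - v t"] by linarith
  then show ?thesis by simp
qed

section \<open>Integrals of angular times radial functions\<close>

lemma has_integral_ball_scale:
  fixes F :: "'a::euclidean_space \<Rightarrow> real"
  assumes r: "r > 0"
  shows "((\<lambda>x. F (r *\<^sub>R x)) has_integral I / r ^ DIM('a)) (ball 0 1) \<longleftrightarrow> (F has_integral I) (ball 0 r)"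
proof -
  obtain a where a: "ball 0 r \<subseteq> cbox (- a) (a::'a)"
    using bounded_subset_cbox_symmetric[of "ball 0 r :: 'a set"] by auto
  have sub: "ball (0::'a) 1 \<subseteq> cbox (- a /\<^sub>R r) (a /\<^sub>R r)"
  proof
    fix x :: 'a assume "x \<in> ball 0 1"
    then have "r *\<^sub>R x \<in> ball 0 r" using r by simp
    then have "r *\<^sub>R x \<in> cbox (-a) a" using a by blast
    then show "x \<in> cbox (- a /\<^sub>R r) (a /\<^sub>R r)" using r by (auto simp: mem_box field_simps)
  qed
  define G where "G = (\<lambda>x. if x \<in> ball 0 r then F x else 0)"
  have "(F has_integral I) (ball 0 r) \<longleftrightarrow> (G has_integral I) (cbox (-a) a)"
    unfolding G_def by (rule has_integral_restrict[OF a, symmetric])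
  also have "\<dots> \<longleftrightarrow> ((\<lambda>x. G (r *\<^sub>R x + 0)) has_integral (I /\<^sub>R r ^ DIM('a))) (cbox ((- a - 0) /\<^sub>R r) ((a - 0) /\<^sub>R r))"
    by (rule has_integral_affinity_iff[OF r, symmetric])
  also have "(\<lambda>x. G (r *\<^sub>R x + 0)) = (\<lambda>x. if x \<in> ball 0 1 then F (r *\<^sub>R x) else 0)"
    using r by (auto simp: G_def)
  also have "(\<dots> has_integral (I /\<^sub>R r ^ DIM('a))) (cbox ((- a - 0) /\<^sub>R r) ((a - 0) /\<^sub>R r)) \<longleftrightarrow>
      ((\<lambda>x. F (r *\<^sub>R x)) has_integral I / r ^ DIM('a)) (ball 0 1)"
    using has_integral_restrict[OF sub] by (simp add: divide_inverse mult.commute)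
  finally show ?thesis by simp
qed

text \<open>Functions of \<open>sgn x\<close> are usually discontinuous at the origin, so continuity
  is asked only off this negligible point.\<close>

lemma absolutely_integrable_continuous_except_0:
  fixes F :: "'a::euclidean_space \<Rightarrow> real"
  assumes S: "S \<in> lmeasurable" and c: "continuous_on (S - {0}) F" and B: "\<And>x. x \<in> S \<Longrightarrow> x \<noteq> 0 \<Longrightarrow> \<bar>F x\<bar> \<le> B"
  shows "F absolutely_integrable_on S"
proof -
  have S0: "S - {0} \<in> lmeasurable" using S lmeasurable_compact[of "{0::'a}"] by (intro fmeasurable.Diff) auto
  have "F absolutely_integrable_on (S - {0})"
  proof (rule measurable_bounded_by_integrable_imp_absolutely_integrable)
    show "F \<in> borel_measurable (lebesgue_on (S - {0}))"
      using S0 by (intro continuous_imp_measurable_on_sets_lebesgue c) auto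
    show "(\<lambda>x. B) integrable_on (S - {0})" by (rule integrable_on_const[OF S0])
  qed (use S0 B in auto)
  moreover have "negligible {x \<in> S - {0} - S. F x \<noteq> 0}" "negligible {x \<in> S - (S - {0}). F x \<noteq> 0}"
    by (auto intro: negligible_subset[of "{0::'a}"])
  ultimately show ?thesis using absolutely_integrable_spike_set_eq by blast
qed

lemma continuous_on_sgn_compose:
  fixes u :: "'a::euclidean_space \<Rightarrow> 'b::topological_space"
  assumes "continuous_on (sphere 0 1) u"
  shows "continuous_on (- {0}) (\<lambda>x. u (sgn x))"
proof (rule continuous_on_compose2[OF assms])
  show "continuous_on (- {0}) (sgn :: 'a \<Rightarrow> 'a)"
    unfolding sgn_div_norm by (intro continuous_intros) auto
qed (simp add: image_subset_iff norm_sgn)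

lemma sphere_bound:
  fixes u :: "'a::euclidean_space \<Rightarrow> real"
  assumes "continuous_on (sphere 0 1) u"
  obtains B where "0 \<le> B" "\<And>x. x \<in> sphere 0 1 \<Longrightarrow> \<bar>u x\<bar> \<le> B"
proof -
  have "bounded (u ` sphere 0 1)"
    by (intro compact_imp_bounded compact_continuous_image assms) auto
  then obtain B where "0 < B" "\<forall>y\<in>u ` sphere 0 1. norm y \<le> B" unfolding bounded_pos by blast
  then show ?thesis using that[of B] by auto
qed

lemma integrable_sgn_radial:
  fixes u :: "'a::euclidean_space \<Rightarrow> real"
  assumes u: "continuous_on (sphere 0 1) u" and \<rho>: "continuous_on {0..} \<rho>"
    and S: "S \<in> lmeasurable" "bounded S"
  shows "(\<lambda>x. u (sgn x) * \<rho> (norm x)) integrable_on S"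
proof -
  obtain B where B: "0 \<le> B" "\<And>x. x \<in> sphere 0 1 \<Longrightarrow> \<bar>u x\<bar> \<le> B"
    using sphere_bound[OF u] by blast
  obtain R where R: "\<And>x. x \<in> S \<Longrightarrow> norm x \<le> R" using S(2) by (auto simp: bounded_iff)
  have "continuous_on {0..R} \<rho>" using \<rho> by (rule continuous_on_subset) auto
  then have "bounded (\<rho> ` {0..R})" by (intro compact_imp_bounded compact_continuous_image) auto
  then obtain M where M: "0 < M" "\<And>t. t \<in> {0..R} \<Longrightarrow> \<bar>\<rho> t\<bar> \<le> M"
    unfolding bounded_pos by fastforce
  have "(\<lambda>x. u (sgn x) * \<rho> (norm x)) absolutely_integrable_on S"
  proof (rule absolutely_integrable_continuous_except_0[OF S(1)])
    show "continuous_on (S - {0}) (\<lambda>x. u (sgn x) * \<rho> (norm x))"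
      by (intro continuous_on_mult continuous_on_subset[OF continuous_on_sgn_compose[OF u]]
            continuous_on_compose2[OF \<rho>] continuous_intros) auto
    show "\<bar>u (sgn x) * \<rho> (norm x)\<bar> \<le> B * M" if "x \<in> S" "x \<noteq> 0" for x
      unfolding abs_mult using B(2)[of "sgn x"] M(2)[of "norm x"] R[OF that(1)] that(2) B(1)
      by (intro mult_mono) (auto simp: norm_sgn)
  qed
  then show ?thesis by (rule set_lebesgue_integral_eq_integral(1))
qed

definition radial_integral :: "('a::euclidean_space \<Rightarrow> real) \<Rightarrow> (real \<Rightarrow> real) \<Rightarrow> real \<Rightarrow> real" where
  "radial_integral u \<rho> r = integral (ball 0 r) (\<lambda>x. u (sgn x) * \<rho> (norm x))"

lemma radial_integral_1:
  fixes u :: "'a::euclidean_space \<Rightarrow> real"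
  assumes u: "continuous_on (sphere 0 1) u" and r: "0 \<le> r"
  shows "integral (ball 0 r) (\<lambda>x. u (sgn x)) = r ^ DIM('a) * integral (ball 0 1) (\<lambda>x. u (sgn x))"
proof (cases "r = 0")
  case False
  with r have r: "r > 0" by simp
  have "(\<lambda>x. u (sgn x)) integrable_on ball 0 r"
    using integrable_sgn_radial[OF u, of "\<lambda>_. 1"] by simp
  then have "((\<lambda>x. u (sgn x)) has_integral integral (ball 0 r) (\<lambda>x. u (sgn x))) (ball 0 r)"
    by (rule integrable_integral)
  then have "((\<lambda>x. u (sgn (r *\<^sub>R x))) has_integral integral (ball 0 r) (\<lambda>x. u (sgn x)) / r ^ DIM('a)) (ball 0 1)"
    using has_integral_ball_scale[OF r, of "\<lambda>x. u (sgn x)"] by simp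
  then have "integral (ball 0 1) (\<lambda>x. u (sgn x)) = integral (ball 0 r) (\<lambda>x. u (sgn x)) / r ^ DIM('a)"
    using r by (simp add: sgn_scaleR integral_unique)
  then show ?thesis using r by simp
qed simp

text \<open>On a thin annulus the radial factor is replaced by the constant \<open>c\<close>; by
  \<open>radial_integral_1\<close> what remains is the angular integral times b^n - a^n, where n is
  the dimension. Keeping the error proportional to b^n - a^n lets the errors of adjacent annuli
  telescope.\<close>

lemma radial_integral_step:
  fixes u :: "'a::euclidean_space \<Rightarrow> real"
  assumes u: "continuous_on (sphere 0 1) u" and upos: "\<And>x. 0 \<le> u x"
    and \<rho>: "continuous_on {0..} \<rho>" and ab: "0 \<le> a" "a \<le> b"
    and e: "\<And>t. t \<in> {a..b} \<Longrightarrow> \<bar>\<rho> t - c\<bar> \<le> e" 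
  shows "\<bar>radial_integral u \<rho> b - radial_integral u \<rho> a - c * ((b ^ DIM('a) - a ^ DIM('a)) * integral (ball 0 1) (\<lambda>x. u (sgn x)))\<bar>
      \<le> e * ((b ^ DIM('a) - a ^ DIM('a)) * integral (ball 0 1) (\<lambda>x. u (sgn x)))"
proof -
  let ?U = "\<lambda>x. u (sgn x)"
  let ?A = "ball (0::'a) b - ball 0 a"
  have sub: "ball (0::'a) a \<subseteq> ball 0 b" using ab by auto
  then have neg: "negligible (ball (0::'a) a - ball 0 b)" by (metis Diff_eq_empty_iff negligible_empty)
  have A: "?A \<in> lmeasurable" "bounded ?A" by (auto intro: fmeasurable.Diff bounded_subset[OF bounded_ball])
  have i1: "(\<lambda>x. ?U x * \<rho> (norm x)) integrable_on S" if "S \<in> lmeasurable" "bounded S" for S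
    using integrable_sgn_radial[OF u \<rho> that] .
  have i2: "?U integrable_on S" if "S \<in> lmeasurable" "bounded S" for S
    using integrable_sgn_radial[OF u, of "\<lambda>_. 1", OF _ that] by simp
  have 1: "radial_integral u \<rho> b - radial_integral u \<rho> a = integral ?A (\<lambda>x. ?U x * \<rho> (norm x))"
    unfolding radial_integral_def by (rule integral_setdiff[symmetric]) (use i1 neg in auto)
  have 2: "(b ^ DIM('a) - a ^ DIM('a)) * integral (ball 0 1) ?U = integral ?A ?U"
  proof -
    have "integral ?A ?U = integral (ball 0 b) ?U - integral (ball 0 a) ?U"
      by (rule integral_setdiff) (use i2 neg in auto)
    also have "integral (ball 0 b) ?U = b ^ DIM('a) * integral (ball 0 1) ?U"
      using radial_integral_1[OF u, of b] ab by simp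
    also have "integral (ball 0 a) ?U = a ^ DIM('a) * integral (ball 0 1) ?U"
      using radial_integral_1[OF u, of a] ab by simp
    finally show ?thesis by (simp only: left_diff_distrib)
  qed
  have i3: "(\<lambda>x. c * ?U x) integrable_on ?A" "(\<lambda>x. e * ?U x) integrable_on ?A"
    using i2[OF A] integrable_on_cmult_left[of ?U ?A] by auto
  have "norm (integral ?A (\<lambda>x. ?U x * \<rho> (norm x) - c * ?U x)) \<le> integral ?A (\<lambda>x. e * ?U x)"
  proof (rule integral_norm_bound_integral[OF integrable_diff[OF i1[OF A] i3(1)] i3(2)])
    fix x assume x: "x \<in> ?A"
    have "norm x \<in> {a..b}" using x by auto
    from e[OF this] have "\<bar>\<rho> (norm x) - c\<bar> * ?U x \<le> e * ?U x" by (intro mult_right_mono upos)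
    moreover have "norm (?U x * \<rho> (norm x) - c * ?U x) = \<bar>\<rho> (norm x) - c\<bar> * ?U x"
    proof -
      have "?U x * \<rho> (norm x) - c * ?U x = (\<rho> (norm x) - c) * ?U x" by (metis left_diff_distrib mult.commute)
      then show ?thesis using abs_of_nonneg[OF upos[of "sgn x"]] by (metis abs_mult real_norm_def)
    qed
    ultimately show "norm (?U x * \<rho> (norm x) - c * ?U x) \<le> e * ?U x" by simp
  qed
  moreover have "integral ?A (\<lambda>x. ?U x * \<rho> (norm x) - c * ?U x) = integral ?A (\<lambda>x. ?U x * \<rho> (norm x)) - c * integral ?A ?U"
    using integral_diff[OF i1[OF A] i3(1)] by simp
  ultimately show ?thesis using 1 2 by simp
qed

text \<open>Integration in polar coordinates, for products of an angular and a radial function only: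
  Riemann sums over thin annuli.\<close>

lemma radial_integral_product:
  fixes u :: "'a::euclidean_space \<Rightarrow> real"
  assumes u: "continuous_on (sphere 0 1) u" and upos: "\<And>x. 0 \<le> u x"
    and \<rho>: "continuous_on {0..} \<rho>" and R: "0 < R"
  shows "radial_integral u \<rho> R * integral (ball (0::'a) 1) (\<lambda>x. 1::real) =
     radial_integral (\<lambda>x::'a. 1) \<rho> R * integral (ball 0 1) (\<lambda>x. u (sgn x))"
proof -
  define I where "I = integral (ball 0 1) (\<lambda>x. u (sgn x))"
  define J where "J = integral (ball (0::'a) 1) (\<lambda>x. 1::real)"
  let ?n = "DIM('a)"
  \<comment> \<open>The claim is that this cross difference vanishes at \<open>R\<close>. Over one
    annulus from a to b, the leading terms of its two products are both \<rho> a times (b^n - a^n) I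
    J and cancel.\<close>
  define H where "H = (\<lambda>r. radial_integral u \<rho> r * J - radial_integral (\<lambda>x::'a. 1) \<rho> r * I)"
  have I0: "I \<ge> 0"
    unfolding I_def by (rule integral_nonneg) (use integrable_sgn_radial[OF u, of "\<lambda>_. 1"] upos in auto)
  have J0: "J \<ge> 0" unfolding J_def by (rule integral_nonneg[OF integrable_on_const]) auto
  have step: "\<bar>H b - H a\<bar> \<le> 2 * e * (b ^ ?n - a ^ ?n) * (I * J)"
    if ab: "0 \<le> a" "a \<le> b" and e: "\<And>t. t \<in> {a..b} \<Longrightarrow> \<bar>\<rho> t - \<rho> a\<bar> \<le> e" for a b e
  proof -
    define X where "X = radial_integral u \<rho> b - radial_integral u \<rho> a"
    define Y where "Y = radial_integral (\<lambda>x::'a. 1) \<rho> b - radial_integral (\<lambda>x::'a. 1) \<rho> a"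
    define D where "D = b ^ ?n - a ^ ?n"
    have "\<bar>X - \<rho> a * (D * I)\<bar> \<le> e * (D * I)"
      using radial_integral_step[OF u upos \<rho> ab e] by (simp add: X_def D_def I_def)
    moreover have "\<bar>Y - \<rho> a * (D * J)\<bar> \<le> e * (D * J)"
      using radial_integral_step[OF continuous_on_const _ \<rho> ab e, of 1] by (simp add: Y_def D_def J_def)
    ultimately have "\<bar>X - \<rho> a * (D * I)\<bar> * J \<le> e * (D * I) * J" "\<bar>Y - \<rho> a * (D * J)\<bar> * I \<le> e * (D * J) * I"
      using I0 J0 by (auto intro: mult_right_mono)
    then have "\<bar>(X - \<rho> a * (D * I)) * J\<bar> \<le> e * D * (I * J)" "\<bar>(Y - \<rho> a * (D * J)) * I\<bar> \<le> e * D * (I * J)"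
      using I0 J0 by (auto simp: abs_mult mult_ac)
    moreover have "H b - H a = (X - \<rho> a * (D * I)) * J - (Y - \<rho> a * (D * J)) * I"
      unfolding H_def X_def Y_def by (simp add: algebra_simps)
    ultimately show ?thesis unfolding D_def[symmetric] by linarith
  qed
  have H0: "H 0 = 0" by (simp add: H_def radial_integral_def)
  have "\<bar>H R\<bar> \<le> d" if d: "d > 0" for d
  proof -
    \<comment> \<open>Telescoping leaves the error 2 e R^n I J; this \<open>e\<close> pushes it
      below \<open>d\<close>, and the 1 keeps the denominator positive even for I = 0.\<close>
    define e where "e = d / (2 * R ^ ?n * (I * J) + 1)"
    have den: "2 * R ^ ?n * (I * J) + 1 > 0" using R I0 J0 by (intro add_nonneg_pos mult_nonneg_nonneg) auto
    have e: "e > 0" using d den by (simp add: e_def)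
    have "continuous_on {0..R} \<rho>" using \<rho> by (rule continuous_on_subset) auto
    then have "uniformly_continuous_on {0..R} \<rho>" by (intro compact_uniformly_continuous) auto
    then obtain \<delta> where \<delta>: "\<delta> > 0" "\<And>s t. s \<in> {0..R} \<Longrightarrow> t \<in> {0..R} \<Longrightarrow> dist t s < \<delta> \<Longrightarrow> dist (\<rho> t) (\<rho> s) < e"
      unfolding uniformly_continuous_on_def using e by metis
    obtain N :: nat where N: "N > 0" "R / N < \<delta>"
    proof -
      obtain N :: nat where "R / \<delta> < N" using reals_Archimedean2 by blast
      moreover from this have "N > 0" using R \<delta>(1) by (metis divide_pos_pos of_nat_0_less_iff less_trans)
      ultimately show ?thesis using that[of N] \<delta>(1) by (simp add: field_simps)
    qed
    define p where "p = (\<lambda>i::nat. R * i / N)"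
    have pmono: "p i \<le> p (Suc i)" "0 \<le> p i" for i using R N by (auto simp: p_def divide_right_mono)
    have "i \<le> N \<Longrightarrow> \<bar>H (p i)\<bar> \<le> 2 * e * p i ^ ?n * (I * J)" for i
    proof (induction i)
      case 0
      then show ?case using e I0 J0 by (simp add: p_def H0)
    next
      case (Suc i)
      have pR: "p (Suc i) \<le> R" using Suc.prems R N by (simp add: p_def divide_le_eq mult_left_mono)
      have pd: "p (Suc i) - p i = R / N" by (simp add: p_def add_divide_distrib distrib_left)
      have "\<bar>\<rho> t - \<rho> (p i)\<bar> \<le> e" if t: "t \<in> {p i..p (Suc i)}" for t
      proof -
        have "dist t (p i) < \<delta>" using t pd N by (auto simp: dist_real_def)
        then have "dist (\<rho> t) (\<rho> (p i)) < e"
          using t pR pmono[of i] by (intro \<delta>(2)) auto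
        then show ?thesis by (simp add: dist_real_def)
      qed
      from step[OF pmono(2) pmono(1) this]
      have "\<bar>H (p (Suc i)) - H (p i)\<bar> \<le> 2 * e * (p (Suc i) ^ ?n - p i ^ ?n) * (I * J)" .
      moreover have "\<bar>H (p i)\<bar> \<le> 2 * e * p i ^ ?n * (I * J)" using Suc by simp
      ultimately show ?case by (simp add: algebra_simps)
    qed
    from this[of N] have "\<bar>H R\<bar> \<le> 2 * e * R ^ ?n * (I * J)" using N by (simp add: p_def)
    also have "\<dots> = e * (2 * R ^ ?n * (I * J))" by simp
    also have "\<dots> \<le> e * (2 * R ^ ?n * (I * J) + 1)" using e by (intro mult_left_mono) auto
    also have "\<dots> = d" using den by (simp add: e_def)
    finally show ?thesis .
  qed
  then have "\<bar>H R\<bar> \<le> 0" by (rule field_le_epsilon[of _ 0, simplified])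
  then have "H R = 0" by simp
  then show ?thesis by (simp add: H_def I_def J_def)
qed

text \<open>For \<open>gain_const_near_1\<close>: an inner and an outer ball have almost the same
  model volume when both radii are close to \<open>R\<close>.\<close>

lemma radial_integral_continuous:
  assumes \<rho>: "continuous_on {0..} \<rho>" and R: "0 < R"
  shows "isCont (radial_integral (\<lambda>x::'a::euclidean_space. 1) \<rho>) R"
proof -
  let ?W = "radial_integral (\<lambda>x::'a. 1) \<rho>"
  let ?J = "integral (ball (0::'a) 1) (\<lambda>x. 1::real)"
  have J0: "?J \<ge> 0" by (rule integral_nonneg[OF integrable_on_const]) auto
  have "continuous_on {0..2*R} \<rho>" using \<rho> by (rule continuous_on_subset) auto
  then have "bounded (\<rho> ` {0..2*R})" by (intro compact_imp_bounded compact_continuous_image) auto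
  then obtain M where "0 < M" "\<forall>y\<in>\<rho> ` {0..2*R}. norm y \<le> M" unfolding bounded_pos by blast
  then have M: "0 < M" "\<And>t. t \<in> {0..2*R} \<Longrightarrow> \<bar>\<rho> t\<bar> \<le> M" by auto
  have step: "\<bar>?W b - ?W a\<bar> \<le> M * ?J * \<bar>b ^ DIM('a) - a ^ DIM('a)\<bar>" if "0 \<le> a" "a \<le> b" "b \<le> 2 * R" for a b
  proof -
    have "\<bar>?W b - ?W a\<bar> \<le> M * ((b ^ DIM('a) - a ^ DIM('a)) * ?J)"
      using radial_integral_step[OF continuous_on_const _ \<rho> that(1,2), of 1 0 M] M(2) that by simp
    moreover have "\<bar>b ^ DIM('a) - a ^ DIM('a)\<bar> = b ^ DIM('a) - a ^ DIM('a)"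
      using power_mono[OF that(2,1), of "DIM('a)"] by (rule abs_of_nonneg[OF diff_ge_0_iff_ge[THEN iffD2]])
    ultimately show ?thesis by (metis mult.assoc mult.commute)
  qed
  have ev: "\<forall>\<^sub>F y in at R. norm (?W y - ?W R) \<le> M * ?J * \<bar>y ^ DIM('a) - R ^ DIM('a)\<bar>"
    unfolding eventually_at
  proof (intro exI[of _ R] conjI ballI impI)
    fix y assume "y \<noteq> R \<and> dist y R < R"
    then have y: "0 \<le> y" "y \<le> 2 * R" by (auto simp: dist_real_def abs_if split: if_splits)
    show "norm (?W y - ?W R) \<le> M * ?J * \<bar>y ^ DIM('a) - R ^ DIM('a)\<bar>"
    proof (cases "y \<le> R")
      case True
      then have "\<bar>?W R - ?W y\<bar> \<le> M * ?J * \<bar>R ^ DIM('a) - y ^ DIM('a)\<bar>"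
        using y R by (intro step) auto
      then show ?thesis unfolding real_norm_def by (metis abs_minus_commute)
    next
      case False
      then show ?thesis unfolding real_norm_def using y R by (intro step) auto
    qed
  qed (rule R)
  have "((\<lambda>y. y ^ DIM('a)) \<longlongrightarrow> R ^ DIM('a)) (at R)"
    by (rule tendsto_power[OF tendsto_ident_at])
  then have "((\<lambda>y. M * ?J * \<bar>y ^ DIM('a) - R ^ DIM('a)\<bar>) \<longlongrightarrow> 0) (at R)"
    by (intro tendsto_mult_right_zero tendsto_rabs_zero LIM_zero)
  then have "((\<lambda>y. ?W y - ?W R) \<longlongrightarrow> 0) (at R)"
    by (rule Lim_null_comparison[OF ev])
  then show ?thesis unfolding isCont_def by (rule LIM_zero_cancel)
qed

lemma integral_ball_1_pos: "0 < integral (ball (0::'a::euclidean_space) 1) (\<lambda>x. 1::real)"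
proof -
  have "integral (ball (0::'a) 1) (\<lambda>x. 1::real) = measure lebesgue (ball (0::'a) 1)"
    by (rule lmeasure_integral[symmetric]) simp
  also have "\<dots> > 0" using content_ball_pos[of 1 "0::'a"] by simp
  finally show ?thesis .
qed

lemma radial_integral_pos:
  assumes \<rho>: "continuous_on {0..} \<rho>" and ge: "\<And>t. t \<ge> 0 \<Longrightarrow> \<rho> t \<ge> 1" and R: "0 < R"
  shows "radial_integral (\<lambda>x::'a::euclidean_space. 1) \<rho> R > 0"
proof -
  have "0 < R ^ DIM('a) * integral (ball (0::'a) 1) (\<lambda>x. 1::real)"
    using R by (intro mult_pos_pos integral_ball_1_pos) simp
  also have "\<dots> = integral (ball (0::'a) R) (\<lambda>x. 1::real)"
    using radial_integral_1[of "\<lambda>x::'a. 1" R] R by simp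
  also have "\<dots> \<le> radial_integral (\<lambda>x::'a. 1) \<rho> R"
    unfolding radial_integral_def
  proof (rule integral_le)
    show "(\<lambda>x::'a. 1::real) integrable_on ball 0 R" by (rule integrable_on_const) simp
    show "(\<lambda>x::'a. 1 * \<rho> (norm x)) integrable_on ball 0 R"
      using integrable_sgn_radial[of "\<lambda>x::'a. 1" \<rho> "ball 0 R"] \<rho> by simp
  qed (use ge in simp)
  finally show ?thesis .
qed

text \<open>Concavity of the logarithm gives (1 + z)^(n - 1) \<le> (1 + t z)^n for t = (n - 1) / n;
  strictness comes from \<open>c\<close> exceeding t.\<close>

lemma bernoulli_isoperimetric:
  fixes z c :: real
  assumes n: "n \<ge> 1" and z: "0 < z" and c: "c > (real n - 1) / n"
  shows "(1 + z) ^ (n - 1) < (1 + c * z) ^ n"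
proof -
  define t where "t = (real n - 1) / n"
  have t: "0 \<le> t" "t \<le> 1" using n by (auto simp: t_def)
  have "t * ln (1 + z) + (1 - t) * ln 1 \<le> ln (t * (1 + z) + (1 - t) * 1)"
    using concave_onD[OF ln_concave, of t 1 "1 + z"] t z by (simp add: algebra_simps)
  then have 1: "t * ln (1 + z) \<le> ln (1 + t * z)" by (simp add: algebra_simps)
  have "(1 + z) ^ (n - 1) = exp ((real n - 1) * ln (1 + z))"
    using z n exp_of_nat_mult[of "n - 1" "ln (1 + z)"] by (simp add: of_nat_diff)
  also have "(real n - 1) * ln (1 + z) = n * (t * ln (1 + z))" using n by (simp add: t_def)
  also have "exp \<dots> \<le> exp (n * ln (1 + t * z))" using 1 n by simp
  also have "\<dots> = (1 + t * z) ^ n" using t z by (simp add: exp_of_nat_mult add_pos_nonneg)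
  also have "\<dots> < (1 + c * z) ^ n"
    using n z c t unfolding t_def[symmetric] by (intro power_strict_mono) auto
  finally show ?thesis .
qed

section \<open>Christoffel symbols and Jacobi fields\<close>

lemma bounded_bilinear_matrix_vector_mult:
  "bounded_bilinear (\<lambda>(A::real^'n^'m) v. A *v v)"
  unfolding bilinear_conv_bounded_bilinear[symmetric] bilinear_def
  by (auto intro!: linearI simp: matrix_vector_right_distrib matrix_vector_mult_add_rdistrib
      matrix_vector_mult_scaleR scaleR_matrix_vector_assoc)

lemma has_vector_derivative_vecI:
  fixes f :: "real \<Rightarrow> real^'n"
  assumes "\<And>i. ((\<lambda>t. f t $ i) has_vector_derivative f' $ i) (at t within S)"
  shows "(f has_vector_derivative f') (at t within S)"
proof -
  have "((\<lambda>t. \<Sum>i\<in>UNIV. f t $ i *\<^sub>R axis i 1) has_vector_derivative (\<Sum>i\<in>UNIV. f' $ i *\<^sub>R axis i (1::real))) (at t within S)"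
    by (intro has_vector_derivative_sum bounded_linear.has_vector_derivative[OF bounded_linear_scaleR_left] assms)
  then show ?thesis by (simp add: basis_expansion flip: scalar_mult_eq_scaleR)
qed

lemma sum3_rotate: 
  "(\<Sum>p\<in>A. \<Sum>i\<in>B. \<Sum>j\<in>C. f p i j) = (\<Sum>i\<in>B. \<Sum>j\<in>C. \<Sum>p\<in>A. f p i j)"
proof -
  have "(\<Sum>p\<in>A. \<Sum>i\<in>B. \<Sum>j\<in>C. f p i j) = (\<Sum>i\<in>B. \<Sum>p\<in>A. \<Sum>j\<in>C. f p i j)" by (rule sum.swap)
  also have "\<dots> = (\<Sum>i\<in>B. \<Sum>j\<in>C. \<Sum>p\<in>A. f p i j)" by (intro sum.cong refl sum.swap)
  finally show ?thesis .
qed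

lemma matrix_vector_sum_scale:
  fixes A :: "'i \<Rightarrow> real^'n^'m"
  shows "(\<Sum>i\<in>I. c i *\<^sub>R A i) *v v = (\<Sum>i\<in>I. c i *\<^sub>R (A i *v v))"
  by (induction I rule: infinite_finite_induct)
     (auto simp: matrix_vector_mult_add_rdistrib scaleR_matrix_vector_assoc)

text \<open>The calculus takes place on the open set \<open>W\<close>, while the definitions take
  derivatives within the larger region \<open>S\<close>; on \<open>W\<close> both agree. The
  instances are the open ball in the closed ball, for \<open>g\<close>, and the interior of
  \<open>Omega g\<close> in \<open>Omega g\<close>, for \<open>gbar g\<close>.\<close>

locale smooth_metric =
  fixes W S :: "(real^'n) set" and g :: "('n::finite) metric"
  assumes open_W: "open W" and W_sub: "W \<subseteq> S" and Ck_g: "\<And>m. Ck_open m W g"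
    and pos_def_g: "\<And>x. x \<in> W \<Longrightarrow> pos_def_sym (g x)"
begin

definition dg :: "real^'n \<Rightarrow> real^'n \<Rightarrow> real^'n^'n" where
  "dg x w = frechet_derivative g (at x) w"

text \<open>The Christoffel form \<Gamma>(u, v): for a field U along a curve c,
  \<open>U' + gam (c t) (c' t) (U t)\<close> is the covariant derivative. It keeps indices out of
  the later computations.\<close>

definition gam :: "real^'n \<Rightarrow> real^'n \<Rightarrow> real^'n \<Rightarrow> real^'n" where
  "gam x u v = (\<chi> l. \<Sum>i\<in>UNIV. \<Sum>j\<in>UNIV. christoffel S g l i j x * u $ i * v $ j)"

definition dgam :: "real^'n \<Rightarrow> real^'n \<Rightarrow> real^'n \<Rightarrow> real^'n \<Rightarrow> real^'n" where
  "dgam x w u v = (\<chi> l. \<Sum>i\<in>UNIV. \<Sum>j\<in>UNIV. frechet_derivative (christoffel S g l i j) (at x) w * u $ i * v $ j)"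

lemma sym_g: "x \<in> W \<Longrightarrow> transpose (g x) = g x"
  using pos_def_g by (simp add: pos_def_sym_def)

lemma pos_g: "x \<in> W \<Longrightarrow> v \<noteq> 0 \<Longrightarrow> 0 < v \<bullet> (g x *v v)"
  using pos_def_g by (simp add: pos_def_sym_def)

lemma partial_within_eq:
  assumes "x \<in> W"
  shows "partial_within S f i x = frechet_derivative f (at x) (axis i 1)"
proof -
  have "x \<in> interior S" using assms interior_maximal[OF W_sub open_W] by blast
  then show ?thesis using at_within_interior[of x S] by (simp add: partial_within_def)
qed

lemma has_derivative_g: "x \<in> W \<Longrightarrow> (g has_derivative dg x) (at x)"
  using Ck_open_Suc_has_derivative[OF Ck_g] unfolding dg_def by (simp add: frechet_derivative_works)

lemma has_derivative_g_nth:
  "x \<in> W \<Longrightarrow> ((\<lambda>y. g y $ i $ j) has_derivative (\<lambda>w. dg x w $ i $ j)) (at x)"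
  by (intro bounded_linear.has_derivative[OF bounded_linear_vec_nth] has_derivative_g)

lemma dg_nth: "x \<in> W \<Longrightarrow> frechet_derivative (\<lambda>y. g y $ i $ j) (at x) w = dg x w $ i $ j"
  using has_derivative_g_nth by (metis frechet_derivative_at)

lemma linear_dg: "x \<in> W \<Longrightarrow> linear (dg x)"
  using has_derivative_g has_derivative_linear by blast

lemma dg_expand: "x \<in> W \<Longrightarrow> dg x u = (\<Sum>i\<in>UNIV. u $ i *\<^sub>R dg x (axis i 1))"
proof -
  assume x: "x \<in> W"
  have "dg x u = dg x (\<Sum>i\<in>UNIV. u $ i *\<^sub>R axis i 1)" by (simp add: basis_expansion flip: scalar_mult_eq_scaleR)
  then show ?thesis by (simp add: linear_sum[OF linear_dg[OF x]] linear_scale[OF linear_dg[OF x]])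
qed

lemma sym_dg: "x \<in> W \<Longrightarrow> transpose (dg x w) = dg x w"
proof -
  assume x: "x \<in> W"
  have "g y $ i $ j = g y $ j $ i" if "y \<in> W" for y i j
    using arg_cong[OF sym_g[OF that], of "\<lambda>A. A $ j $ i"] by (simp add: transpose_def)
  then have "frechet_derivative (\<lambda>y. g y $ i $ j) (at x) = frechet_derivative (\<lambda>y. g y $ j $ i) (at x)" for i j
    by (intro frechet_derivative_cong_open[OF open_W x])
  then have "dg x w $ i $ j = dg x w $ j $ i" for i j by (metis dg_nth[OF x])
  then show ?thesis by (simp add: transpose_def vec_eq_iff)
qed

lemma Ck_dg_nth: "Ck_open m W (\<lambda>x. dg x w $ i $ j)"
  unfolding dg_def
  by (intro Ck_open_vec_nth[OF open_W] Ck_open_Suc_derivative Ck_g)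

lemma Ck_christoffel: "Ck_open m W (christoffel S g l i j)"
proof (rule Ck_open_transform[OF open_W])
  show "(1/2) * (\<Sum>m\<in>UNIV. matrix_inv (g x) $ l $ m *
        (dg x (axis i 1) $ j $ m + dg x (axis j 1) $ i $ m - dg x (axis m 1) $ i $ j)) = christoffel S g l i j x"
    if "x \<in> W" for x
    using that by (simp add: christoffel_def partial_within_eq dg_nth)
  show "Ck_open m W (\<lambda>x. (1/2) * (\<Sum>m\<in>UNIV. matrix_inv (g x) $ l $ m *
        (dg x (axis i 1) $ j $ m + dg x (axis j 1) $ i $ m - dg x (axis m 1) $ i $ j)))"
    by (intro Ck_open_mult Ck_open_sum Ck_open_add Ck_open_diff Ck_open_const open_W Ck_dg_nth
        Ck_open_matrix_inv Ck_g pos_def_sym_invertible pos_def_g)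
qed

lemma has_derivative_christoffel:
  "x \<in> W \<Longrightarrow> (christoffel S g l i j has_derivative frechet_derivative (christoffel S g l i j) (at x)) (at x)"
  using Ck_open_Suc_has_derivative[OF Ck_christoffel] .

lemma gam_expand: "gam x u v = (\<Sum>i\<in>UNIV. \<Sum>j\<in>UNIV. (u $ i * v $ j) *\<^sub>R (\<chi> l. christoffel S g l i j x))"
  by (simp add: gam_def vec_eq_iff mult_ac)

lemma gam_add_right: "gam x u (a + b) = gam x u a + gam x u b"
  by (simp add: gam_def vec_eq_iff algebra_simps sum.distrib)

lemma gam_scale_left: "gam x (c *\<^sub>R a) v = c *\<^sub>R gam x a v"
  by (simp add: gam_def vec_eq_iff sum_distrib_left mult_ac)

lemma gam_scale_right: "gam x u (c *\<^sub>R a) = c *\<^sub>R gam x u a"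
  by (simp add: gam_def vec_eq_iff sum_distrib_left mult_ac)

lemma dgam_scale: 
  "dgam x w (c *\<^sub>R a) v = c *\<^sub>R dgam x w a v" "dgam x w a (c *\<^sub>R v) = c *\<^sub>R dgam x w a v"
  by (simp_all add: dgam_def vec_eq_iff sum_distrib_left mult_ac)

lemma dgam_scale_dir: "x \<in> W \<Longrightarrow> dgam x (c *\<^sub>R w) a v = c *\<^sub>R dgam x w a v"
  using has_derivative_linear[OF has_derivative_christoffel]
  by (simp add: dgam_def vec_eq_iff sum_distrib_left mult_ac linear_scale)

lemma g_gam_nth:
  assumes x: "x \<in> W"
  shows "(g x *v gam x u v) $ p = (\<Sum>i\<in>UNIV. \<Sum>j\<in>UNIV. 
     (1/2) * (dg x (axis i 1) $ j $ p + dg x (axis j 1) $ i $ p - dg x (axis p 1) $ i $ j) * u $ i * v $ j)"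
proof -
  define X where "X = (\<lambda>i j. (\<chi> m. dg x (axis i 1) $ j $ m + dg x (axis j 1) $ i $ m - dg x (axis m 1) $ i $ j))"
  have "(\<chi> l. christoffel S g l i j x) = (1/2) *\<^sub>R (matrix_inv (g x) *v X i j)" for i j
    using x by (simp add: christoffel_def partial_within_eq dg_nth X_def matrix_vector_mult_def vec_eq_iff)
  moreover have "g x *v ((1/2) *\<^sub>R (matrix_inv (g x) *v X i j)) = (1/2) *\<^sub>R X i j" for i j
    using matrix_inv_mult(1)[OF pos_def_sym_invertible[OF pos_def_g[OF x]]]
    by (simp add: matrix_vector_mult_scaleR matrix_vector_mul_assoc)
  ultimately have "g x *v gam x u v = (\<Sum>i\<in>UNIV. \<Sum>j\<in>UNIV. (u $ i * v $ j) *\<^sub>R ((1/2) *\<^sub>R X i j))"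
    unfolding gam_expand
    by (simp add: linear_sum[OF matrix_vector_mul_linear] matrix_vector_mult_scaleR)
  then show ?thesis by (simp add: X_def mult_ac)
qed

lemma dg_form:
  assumes x: "x \<in> W"
  shows "v \<bullet> (dg x u *v w) = (\<Sum>i\<in>UNIV. \<Sum>j\<in>UNIV. \<Sum>p\<in>UNIV. dg x (axis i 1) $ j $ p * u $ i * v $ j * w $ p)"
proof -
  have "dg x u *v w = (\<Sum>i\<in>UNIV. u $ i *\<^sub>R (dg x (axis i 1) *v w))"
    by (subst dg_expand[OF x]) (rule matrix_vector_sum_scale)
  then have "v \<bullet> (dg x u *v w) = (\<Sum>i\<in>UNIV. u $ i * (v \<bullet> (dg x (axis i 1) *v w)))"
    by (simp add: inner_sum_right)
  then show ?thesis
    by (simp add: inner_vec_def matrix_vector_mult_def sum_distrib_left mult_ac)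
qed

text \<open>Koszul's formula for constant fields: the inverse matrix in \<open>christoffel\<close>
  cancels against \<open>g\<close>, and three derivatives of \<open>g\<close> remain. Symmetry and
  metric compatibility of the connection are read off from it.\<close>

lemma g_gam:
  assumes x: "x \<in> W"
  shows "(g x *v gam x u v) \<bullet> w = (v \<bullet> (dg x u *v w) + u \<bullet> (dg x v *v w) - u \<bullet> (dg x w *v v)) / 2"
proof -
  let ?e = "\<lambda>i. axis i (1::real) :: real^'n"
  have "(g x *v gam x u v) \<bullet> w = (\<Sum>p\<in>UNIV. \<Sum>i\<in>UNIV. \<Sum>j\<in>UNIV. 
     (1/2) * (dg x (?e i) $ j $ p + dg x (?e j) $ i $ p - dg x (?e p) $ i $ j) * u $ i * v $ j * w $ p)"
    by (simp add: inner_vec_def g_gam_nth[OF x] sum_distrib_right)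
  also have "\<dots> = ((\<Sum>p\<in>UNIV. \<Sum>i\<in>UNIV. \<Sum>j\<in>UNIV. dg x (?e i) $ j $ p * u $ i * v $ j * w $ p) +
      (\<Sum>p\<in>UNIV. \<Sum>i\<in>UNIV. \<Sum>j\<in>UNIV. dg x (?e j) $ i $ p * v $ j * u $ i * w $ p) -
      (\<Sum>p\<in>UNIV. \<Sum>i\<in>UNIV. \<Sum>j\<in>UNIV. dg x (?e p) $ i $ j * w $ p * u $ i * v $ j)) / 2"
    by (simp add: sum.distrib[symmetric] sum_subtractf[symmetric] sum_divide_distrib field_simps)
  also have "(\<Sum>p\<in>UNIV. \<Sum>i\<in>UNIV. \<Sum>j\<in>UNIV. dg x (?e i) $ j $ p * u $ i * v $ j * w $ p) = v \<bullet> (dg x u *v w)"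
    unfolding dg_form[OF x] by (rule sum3_rotate)
  also have "(\<Sum>p\<in>UNIV. \<Sum>i\<in>UNIV. \<Sum>j\<in>UNIV. dg x (?e j) $ i $ p * v $ j * u $ i * w $ p) = u \<bullet> (dg x v *v w)"
    unfolding dg_form[OF x] by (subst sum3_rotate) (rule sum.swap)
  also have "(\<Sum>p\<in>UNIV. \<Sum>i\<in>UNIV. \<Sum>j\<in>UNIV. dg x (?e p) $ i $ j * w $ p * u $ i * v $ j) = u \<bullet> (dg x w *v v)"
    unfolding dg_form[OF x] by (rule refl)
  finally show ?thesis .
qed

text \<open>Since \<open>dg x w\<close> is symmetric, the right side of \<open>g_gam\<close> is
  symmetric in \<open>u\<close> and \<open>v\<close>; then \<open>g x\<close> is
  nondegenerate.\<close>

lemma gam_commute: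
  assumes x: "x \<in> W"
  shows "gam x u v = gam x v u"
proof -
  have "(g x *v gam x u v) \<bullet> w = (g x *v gam x v u) \<bullet> w" for w
    unfolding g_gam[OF x]
    using symmetric_dot_swap[OF sym_dg[OF x], of w u v] by (simp add: inner_commute)
  then have "(g x *v (gam x u v - gam x v u)) \<bullet> w = 0" for w
    by (simp add: matrix_vector_mult_diff_distrib inner_diff_left)
  then have "(gam x u v - gam x v u) \<bullet> (g x *v (gam x u v - gam x v u)) = 0"
    by (metis inner_commute)
  then show ?thesis using pos_g[OF x, of "gam x u v - gam x v u"] by fastforce
qed

text \<open>Metric compatibility in algebraic form. In the sum of the two instances of
  \<open>g_gam\<close> the derivatives in the directions \<open>u\<close> and \<open>v\<close>
  cancel and only the one along \<open>w\<close> survives.\<close>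

lemma dg_compat:
  assumes x: "x \<in> W"
  shows "u \<bullet> (dg x w *v v) = gam x w u \<bullet> (g x *v v) + u \<bullet> (g x *v gam x w v)"
proof -
  have "gam x w u \<bullet> (g x *v v) = (g x *v gam x w u) \<bullet> v"
    using symmetric_dot_swap[OF sym_g[OF x]] by simp
  moreover have "u \<bullet> (g x *v gam x w v) = (g x *v gam x w v) \<bullet> u" by (rule inner_commute)
  ultimately show ?thesis
    unfolding g_gam[OF x]
    using symmetric_dot_swap[OF sym_dg[OF x], of w v u] symmetric_dot_swap[OF sym_dg[OF x], of u w v]
      symmetric_dot_swap[OF sym_dg[OF x], of v w u] 
    by (simp add: inner_commute field_simps)
qed

lemma metric_inner_derivative:
  assumes c: "(c has_vector_derivative c') (at t within T)" and cW: "c t \<in> W"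
    and U: "(U has_vector_derivative U') (at t within T)" and V: "(V has_vector_derivative V') (at t within T)"
  shows "((\<lambda>t. U t \<bullet> (g (c t) *v V t)) has_vector_derivative
      (U' + gam (c t) c' (U t)) \<bullet> (g (c t) *v V t) + U t \<bullet> (g (c t) *v (V' + gam (c t) c' (V t)))) (at t within T)"
proof -
  have "((\<lambda>t. g (c t)) has_vector_derivative dg (c t) c') (at t within T)"
    by (rule has_vector_derivative_compose[OF c has_derivative_g[OF cW]])
  from bounded_bilinear.has_vector_derivative[OF bounded_bilinear_matrix_vector_mult this V]
  have "((\<lambda>t. g (c t) *v V t) has_vector_derivative g (c t) *v V' + dg (c t) c' *v V t) (at t within T)" .
  from bounded_bilinear.has_vector_derivative[OF bounded_bilinear_inner U this]
  show ?thesis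
    using dg_compat[OF cW, of "U t" c' "V t"]
    by (simp add: inner_add_left inner_add_right matrix_vector_right_distrib add_ac)
qed

lemma gam_derivative:
  assumes c: "(c has_vector_derivative c') (at t within T)" and cW: "c t \<in> W"
    and U: "(U has_vector_derivative U') (at t within T)" and V: "(V has_vector_derivative V') (at t within T)"
  shows "((\<lambda>t. gam (c t) (U t) (V t)) has_vector_derivative
      dgam (c t) c' (U t) (V t) + gam (c t) U' (V t) + gam (c t) (U t) V') (at t within T)"
proof (rule has_vector_derivative_vecI)
  fix l
  have comp: "((\<lambda>t. U t $ i) has_vector_derivative U' $ i) (at t within T)" 
    "((\<lambda>t. V t $ i) has_vector_derivative V' $ i) (at t within T)" for i
    using bounded_linear.has_vector_derivative[OF bounded_linear_vec_nth U]
      bounded_linear.has_vector_derivative[OF bounded_linear_vec_nth V] by auto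
  have chr: "((\<lambda>t. christoffel S g l i j (c t)) has_vector_derivative frechet_derivative (christoffel S g l i j) (at (c t)) c') (at t within T)" for i j
    by (rule has_vector_derivative_compose[OF c has_derivative_christoffel[OF cW]])
  have "((\<lambda>t. \<Sum>i\<in>UNIV. \<Sum>j\<in>UNIV. christoffel S g l i j (c t) * U t $ i * V t $ j) has_vector_derivative
    (\<Sum>i\<in>UNIV. \<Sum>j\<in>UNIV. (christoffel S g l i j (c t) * U t $ i) * V' $ j +
       (christoffel S g l i j (c t) * U' $ i + frechet_derivative (christoffel S g l i j) (at (c t)) c' * U t $ i) * V t $ j)) (at t within T)"
    by (intro has_vector_derivative_sum has_vector_derivative_mult chr comp)
  then show "((\<lambda>t. gam (c t) (U t) (V t) $ l) has_vector_derivative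
      (dgam (c t) c' (U t) (V t) + gam (c t) U' (V t) + gam (c t) (U t) V') $ l) (at t within T)"
    by (simp add: gam_def dgam_def sum.distrib algebra_simps)
qed

text \<open>Fields with constant components commute, so their curvature is the commutator of
  covariant derivatives. This index-free form is matched with the Jacobi equation in
  \<open>jacobi_derivative\<close>.\<close>

lemma riem_curv_gam:
  assumes x: "x \<in> W"
  shows "riem_curv S g x u v w = dgam x u v w - dgam x v u w + gam x u (gam x v w) - gam x v (gam x u w)"
proof (rule vec_eq_iff[THEN iffD2], rule allI)
  fix l
  let ?d = "\<lambda>i l j k. frechet_derivative (christoffel S g l j k) (at x) (axis i 1)"
  let ?G = "\<lambda>l i j. christoffel S g l i j x"
  have dexp: "frechet_derivative (christoffel S g l j k) (at x) u = (\<Sum>i\<in>UNIV. u $ i * ?d i l j k)" for u l j k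
  proof -
    have lin: "linear (frechet_derivative (christoffel S g l j k) (at x))"
      using has_derivative_linear[OF has_derivative_christoffel[OF x]] .
    have "u = (\<Sum>i\<in>UNIV. u $ i *\<^sub>R axis i 1)" by (simp add: basis_expansion flip: scalar_mult_eq_scaleR)
    then have "frechet_derivative (christoffel S g l j k) (at x) u = frechet_derivative (christoffel S g l j k) (at x) (\<Sum>i\<in>UNIV. u $ i *\<^sub>R axis i 1)" by simp
    also have "\<dots> = (\<Sum>i\<in>UNIV. u $ i * ?d i l j k)" by (simp add: linear_sum[OF lin] linear_scale[OF lin])
    finally show ?thesis .
  qed
  have D: "dgam x u v w $ l = (\<Sum>i\<in>UNIV. \<Sum>j\<in>UNIV. \<Sum>k\<in>UNIV. ?d i l j k * u $ i * v $ j * w $ k)" for u v w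
  proof -
    have "dgam x u v w $ l = (\<Sum>j\<in>UNIV. \<Sum>k\<in>UNIV. \<Sum>i\<in>UNIV. ?d i l j k * u $ i * v $ j * w $ k)"
      unfolding dgam_def vec_lambda_beta dexp[where u=u] sum_distrib_right
      by (intro sum.cong refl) (simp only: mult.commute[of "u $ _"])
    also have "\<dots> = (\<Sum>i\<in>UNIV. \<Sum>j\<in>UNIV. \<Sum>k\<in>UNIV. ?d i l j k * u $ i * v $ j * w $ k)"
      by (rule sum3_rotate[symmetric])
    finally show ?thesis .
  qed
  have G: "gam x u (gam x v w) $ l = (\<Sum>i\<in>UNIV. \<Sum>j\<in>UNIV. \<Sum>k\<in>UNIV. (\<Sum>m\<in>UNIV. ?G l i m * ?G m j k) * u $ i * v $ j * w $ k)" for u v w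
  proof -
    have "gam x u (gam x v w) $ l = (\<Sum>i\<in>UNIV. \<Sum>m\<in>UNIV. \<Sum>j\<in>UNIV. \<Sum>k\<in>UNIV. ?G l i m * ?G m j k * u $ i * v $ j * w $ k)"
      by (simp add: gam_def sum_distrib_left sum_distrib_right mult_ac)
    also have "\<dots> = (\<Sum>i\<in>UNIV. \<Sum>j\<in>UNIV. \<Sum>k\<in>UNIV. \<Sum>m\<in>UNIV. ?G l i m * ?G m j k * u $ i * v $ j * w $ k)"
      by (intro sum.cong refl sum3_rotate)
    finally show ?thesis by (simp add: sum_distrib_right)
  qed
  have "riem_curv S g x u v w $ l = (\<Sum>i\<in>UNIV. \<Sum>j\<in>UNIV. \<Sum>k\<in>UNIV. 
     (?d i l j k - ?d j l i k + (\<Sum>m\<in>UNIV. ?G l i m * ?G m j k - ?G l j m * ?G m i k)) * u $ i * v $ j * w $ k)"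
    by (simp add: riem_curv_def riem_coeff_def partial_within_eq[OF x])
  also have "\<dots> = (\<Sum>i\<in>UNIV. \<Sum>j\<in>UNIV. \<Sum>k\<in>UNIV. ?d i l j k * u $ i * v $ j * w $ k) - 
     (\<Sum>i\<in>UNIV. \<Sum>j\<in>UNIV. \<Sum>k\<in>UNIV. ?d j l i k * v $ j * u $ i * w $ k) +
     (\<Sum>i\<in>UNIV. \<Sum>j\<in>UNIV. \<Sum>k\<in>UNIV. (\<Sum>m\<in>UNIV. ?G l i m * ?G m j k) * u $ i * v $ j * w $ k) -
     (\<Sum>i\<in>UNIV. \<Sum>j\<in>UNIV. \<Sum>k\<in>UNIV. (\<Sum>m\<in>UNIV. ?G l j m * ?G m i k) * v $ j * u $ i * w $ k)"
    by (simp add: sum.distrib sum_subtractf algebra_simps)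
  also have "(\<Sum>i\<in>UNIV. \<Sum>j\<in>UNIV. \<Sum>k\<in>UNIV. ?d j l i k * v $ j * u $ i * w $ k) = dgam x v u w $ l"
    unfolding D by (rule sum.swap)
  also have "(\<Sum>i\<in>UNIV. \<Sum>j\<in>UNIV. \<Sum>k\<in>UNIV. (\<Sum>m\<in>UNIV. ?G l j m * ?G m i k) * v $ j * u $ i * w $ k) = gam x v (gam x u w) $ l"
    unfolding G by (rule sum.swap)
  finally show "riem_curv S g x u v w $ l = (dgam x u v w - dgam x v u w + gam x u (gam x v w) - gam x v (gam x u w)) $ l"
    unfolding D[of u v w, symmetric] G[of u v w, symmetric] by simp
qed

text \<open>The second derivative of \<open>J\<close> below is the geodesic equation differentiated in a parameter;
  the conclusion is the Jacobi equation, paired with \<open>J\<close>.\<close>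

lemma jacobi_derivative:
  assumes cW: "c t \<in> W" and c: "(c has_vector_derivative c' t) (at t within T)"
    and c': "(c' has_vector_derivative - gam (c t) (c' t) (c' t)) (at t within T)"
    and J: "(J has_vector_derivative J' t) (at t within T)"
    and J': "(J' has_vector_derivative - dgam (c t) (J t) (c' t) (c' t) - 2 *\<^sub>R gam (c t) (c' t) (J' t)) (at t within T)"
  defines "K \<equiv> \<lambda>t. J' t + gam (c t) (c' t) (J t)"
  shows "((\<lambda>t. J t \<bullet> (g (c t) *v J t)) has_vector_derivative 2 * (J t \<bullet> (g (c t) *v K t))) (at t within T)"
    and "((\<lambda>t. J t \<bullet> (g (c t) *v K t)) has_vector_derivative
       K t \<bullet> (g (c t) *v K t) - J t \<bullet> (g (c t) *v riem_curv S g (c t) (J t) (c' t) (c' t))) (at t within T)"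
proof -
  show "((\<lambda>t. J t \<bullet> (g (c t) *v J t)) has_vector_derivative 2 * (J t \<bullet> (g (c t) *v K t))) (at t within T)"
    using metric_inner_derivative[OF c cW J J] symmetric_dot_swap[OF sym_g[OF cW], of "K t" "J t"]
    by (simp add: K_def inner_commute)
  define K' where "K' = - dgam (c t) (J t) (c' t) (c' t) - 2 *\<^sub>R gam (c t) (c' t) (J' t) +
     (dgam (c t) (c' t) (c' t) (J t) + gam (c t) (- gam (c t) (c' t) (c' t)) (J t) + gam (c t) (c' t) (J' t))"
  have K: "(K has_vector_derivative K') (at t within T)"
    unfolding K_def K'_def by (intro has_vector_derivative_add J' gam_derivative c cW c' J)
  have neg: "gam (c t) (- a) b = - gam (c t) a b" for a b
    using gam_scale_left[of "c t" "-1" a b] by simp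
  have dc: "dgam (c t) (c' t) (c' t) (J t) = dgam (c t) (c' t) (J t) (c' t)"
  proof -
    have "christoffel S g l i j y = christoffel S g l j i y" if "y \<in> W" for l i j y
    proof -
      have "gam y (axis i 1) (axis j 1) $ l = gam y (axis j 1) (axis i 1) $ l" using gam_commute[OF that] by metis
      then show ?thesis
        by (simp add: gam_def axis_def if_distrib[where f="\<lambda>c. _ * c"] cong: if_cong)
    qed
    then have "frechet_derivative (christoffel S g l i j) (at (c t)) = frechet_derivative (christoffel S g l j i) (at (c t))" for l i j
      by (intro frechet_derivative_cong_open[OF open_W cW])
    then have "(\<Sum>i\<in>UNIV. \<Sum>j\<in>UNIV. frechet_derivative (christoffel S g l i j) (at (c t)) (c' t) * c' t $ i * J t $ j) =
       (\<Sum>i\<in>UNIV. \<Sum>j\<in>UNIV. frechet_derivative (christoffel S g l j i) (at (c t)) (c' t) * J t $ j * c' t $ i)" for l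
      by (intro sum.cong refl) (simp add: mult.assoc mult.commute[of "c' t $ _"])
    then show ?thesis unfolding dgam_def by (subst (2) sum.swap) simp
  qed
  \<comment> \<open>The Jacobi equation: the left side is the second covariant derivative of
    \<open>J\<close>. The terms containing \<open>J'\<close> cancel, and
    \<open>riem_curv_gam\<close> recognizes the rest.\<close>
  have "K' + gam (c t) (c' t) (K t) = - riem_curv S g (c t) (J t) (c' t) (c' t)"
    unfolding K'_def K_def riem_curv_gam[OF cW] gam_add_right neg dc
    using gam_commute[OF cW, of "gam (c t) (c' t) (c' t)" "J t"] gam_commute[OF cW, of "c' t" "J t"]
    by (simp add: scaleR_2)
  then show "((\<lambda>t. J t \<bullet> (g (c t) *v K t)) has_vector_derivative
       K t \<bullet> (g (c t) *v K t) - J t \<bullet> (g (c t) *v riem_curv S g (c t) (J t) (c' t) (c' t))) (at t within T)"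
    using metric_inner_derivative[OF c cW J K]
    by (simp add: K_def vec.neg)
qed

text \<open>The geodesic equation is the first order system with the smooth field (v, - \<Gamma>(v,
  v)) on W x R^n, to which \<open>ode_unique\<close> applies.\<close>

lemma geodesic_unique:
  assumes 1: "geodesic_on S g T c1 c1'" and 2: "geodesic_on S g T c2 c2'"
    and W1: "\<And>t. t \<in> {0..T} \<Longrightarrow> c1 t \<in> W" and W2: "\<And>t. t \<in> {0..T} \<Longrightarrow> c2 t \<in> W"
    and init: "c1 0 = c2 0" "c1' 0 = c2' 0" and t: "t \<in> {0..T}"
  shows "c1 t = c2 t \<and> c1' t = c2' t"
proof -
  define X where "X = (\<lambda>z::(real^'n) \<times> (real^'n). (snd z, - gam (fst z) (snd z) (snd z)))"
  have U: "open (W \<times> (UNIV :: (real^'n) set))" using open_W by (intro open_Times) auto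
  have fst: "Ck_open (Suc 0) (W \<times> UNIV) (fst :: (real^'n) \<times> (real^'n) \<Rightarrow> _)"
    and snd: "Ck_open (Suc 0) (W \<times> UNIV) (snd :: (real^'n) \<times> (real^'n) \<Rightarrow> _)"
    using Ck_open_linear[OF U linear_fst] Ck_open_linear[OF U linear_snd] by blast+
  have "Ck_open (Suc 0) (W \<times> UNIV) (\<lambda>z::(real^'n) \<times> (real^'n). gam (fst z) (snd z) (snd z))"
  proof (rule Ck_open_vecI[OF U])
    fix l
    have "Ck_open (Suc 0) (W \<times> UNIV) (\<lambda>z::(real^'n) \<times> (real^'n). christoffel S g l i j (fst z))" for i j
      by (rule Ck_open_compose[OF U fst open_W Ck_christoffel]) auto
    then show "Ck_open (Suc 0) (W \<times> UNIV) (\<lambda>z::(real^'n) \<times> (real^'n). gam (fst z) (snd z) (snd z) $ l)"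
      unfolding gam_def vec_lambda_beta using snd
      by (intro Ck_open_sum Ck_open_mult Ck_open_vec_nth U) auto
  qed
  then have g1: "Ck_open (Suc 0) (W \<times> UNIV) (\<lambda>z::(real^'n) \<times> (real^'n). - gam (fst z) (snd z) (snd z))"
    by (rule Ck_open_minus[OF U])
  have "Ck_open (Suc 0) (W \<times> UNIV) (\<lambda>z. (snd z, 0) + (0, - gam (fst z) (snd z) (snd z)))"
    by (intro Ck_open_add[OF U] Ck_open_bounded_linear[OF U bounded_linear_Pair[OF bounded_linear_ident bounded_linear_zero] snd]
        Ck_open_bounded_linear[OF U bounded_linear_Pair[OF bounded_linear_zero bounded_linear_ident] g1])
  then have X: "Ck_open (Suc 0) (W \<times> UNIV) X" by (simp add: X_def)
  have der: "((\<lambda>t. (c t, c' t)) has_vector_derivative X (c t, c' t)) (at t within {0..T})"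
    if "geodesic_on S g T c c'" "t \<in> {0..T}" for c c' t
    using that unfolding geodesic_on_def X_def gam_def by (auto intro!: has_vector_derivative_Pair)
  have "(c1 t, c1' t) = (c2 t, c2' t)"
    by (rule ode_unique[OF U X der[OF 1] der[OF 2]]) (use W1 W2 init t in auto)
  then show ?thesis by simp
qed

end

section \<open>The exponential map of a star-shaped metric\<close>

lemma smooth_on_imp_continuous_on:
  assumes "smooth_on S f" shows "continuous_on S f"
proof -
  obtain U F where "S \<subseteq> U" "\<forall>m. Ck_open m U F" "\<forall>x\<in>S. F x = f x"
    using assms unfolding smooth_on_def by blast
  then have "continuous_on S F" using Ck_open_continuous_on continuous_on_subset by blast
  then show ?thesis using \<open>\<forall>x\<in>S. F x = f x\<close> by (simp cong: continuous_on_cong)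
qed

lemma geodesic_on_restrict:
  assumes "geodesic_on S g T c c'" "0 < s" "s \<le> T"
  shows "geodesic_on S g s c c'"
  using assms unfolding geodesic_on_def
  by (auto intro: has_vector_derivative_within_subset[where S="{0..T}"])

lemma geodesic_on_rescale:
  assumes geo: "geodesic_on S g T c c'" and s: "0 < s" "s \<le> T"
  shows "geodesic_on S g 1 (\<lambda>t. c (s * t)) (\<lambda>t. s *\<^sub>R c' (s * t))"
  unfolding geodesic_on_def
proof (intro conjI ballI)
  fix t :: real assume t: "t \<in> {0..1}"
  have sT: "s * r \<in> {0..T}" if "r \<in> {0..1}" for r
    using s that mult_mono[of s T r 1] by auto
  then have st: "s * t \<in> {0..T}" using t by blast
  have sub: "(*) s ` {0..1} \<subseteq> {0..T}" using sT by blast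
  have ds: "((*) s has_vector_derivative s) (at t within {0..1})"
    by (auto intro!: derivative_eq_intros simp: has_vector_derivative_def)
  have c: "(c has_vector_derivative c' (s * t)) (at (s * t) within (*) s ` {0..1})"
    using geo st sub unfolding geodesic_on_def by (blast intro: has_vector_derivative_within_subset)
  let ?a = "\<lambda>s v. - (\<chi> l. \<Sum>i\<in>UNIV. \<Sum>j\<in>UNIV. christoffel S g l i j (c s) * v $ i * v $ j)"
  have c': "(c' has_vector_derivative ?a (s * t) (c' (s * t))) (at (s * t) within (*) s ` {0..1})"
    using geo st sub unfolding geodesic_on_def by (blast intro: has_vector_derivative_within_subset)
  show "c (s * t) \<in> S" using geo st unfolding geodesic_on_def by blast
  show "((\<lambda>t. c (s * t)) has_vector_derivative s *\<^sub>R c' (s * t)) (at t within {0..1})"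
    using vector_diff_chain_within[OF ds c] by (simp add: o_def)
  have "((\<lambda>t. s *\<^sub>R c' (s * t)) has_vector_derivative s *\<^sub>R (s *\<^sub>R ?a (s * t) (c' (s * t)))) (at t within {0..1})"
    using vector_diff_chain_within[OF ds c']
    by (intro bounded_linear.has_vector_derivative[OF bounded_linear_scaleR_right]) (simp add: o_def)
  also have "s *\<^sub>R (s *\<^sub>R ?a (s * t) (c' (s * t))) = ?a (s * t) (s *\<^sub>R c' (s * t))"
    by (simp add: vec_eq_iff sum_distrib_left mult_ac)
  finally show "((\<lambda>t. s *\<^sub>R c' (s * t)) has_vector_derivative ?a (s * t) (s *\<^sub>R c' (s * t))) (at t within {0..1})" .
qed simp

text \<open>Identities along a curve are first known inside the open region; this carries them to
  the endpoint, where the curve may reach the boundary.\<close>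

lemma continuous_on_agree_endpoint:
  fixes f h :: "real \<Rightarrow> 'a::real_normed_vector"
  assumes "continuous_on {0..T} f" "continuous_on {0..T} h" "0 < T" "\<And>t. 0 \<le> t \<Longrightarrow> t < T \<Longrightarrow> f t = h t"
  shows "f T = h T"
proof -
  have "continuous_on (closure {0..<T}) (\<lambda>t. f t - h t)" using assms by (auto intro: continuous_on_diff)
  then have "f T - h T = 0"
    by (rule continuous_constant_on_closure) (use assms in auto)
  then show ?thesis by simp
qed

locale star_metric =
  fixes k :: real and g :: "('n::finite) metric"
  assumes star: "g \<in> star_metrics_ball k"
begin

lemma g_ball: "g \<in> metrics_ball k" and transverse: "radial_transverse g" and exp_domain_ex: "\<exists>V. is_exp_domain g V"
  using star by (auto simp: star_metrics_ball_def)

lemma smooth_g: "smooth_on (cball 0 1) g" and pos_def_cball: "x \<in> cball 0 1 \<Longrightarrow> pos_def_sym (g x)"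
  using g_ball by (auto simp: metrics_ball_def riem_metric_on_def)

lemma curvature_le:
  "x \<in> cball 0 1 \<Longrightarrow> u \<noteq> v \<Longrightarrow> independent {u, v} \<Longrightarrow> sectional_curvature (cball 0 1) g x u v \<le> k"
  using g_ball by (auto simp: metrics_ball_def)

end

sublocale star_metric \<subseteq> B: smooth_metric "ball 0 1" "cball 0 1" g
proof
  obtain U F where U: "cball 0 1 \<subseteq> U" "\<forall>m. Ck_open m U F" "\<forall>x\<in>cball 0 1. F x = g x"
    using smooth_g unfolding smooth_on_def by blast
  have "Ck_open m (ball 0 1) F" for m
    using U ball_subset_cball by (blast intro: Ck_open_subset)
  then show "Ck_open m (ball 0 1) g" for m
    by (rule Ck_open_transform[rotated 2]) (use U(3) in auto)
qed (use pos_def_cball in auto)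

context star_metric
begin

text \<open>At a time before \<open>T\<close>, touching the sphere would be a local maximum of
  |c|^2, whose derivative 2 c' . c is nonzero there by transversality.\<close>

lemma geodesic_in_ball:
  assumes geo: "geodesic_on (cball 0 1) g T c c'" and c0: "c 0 = 0" and t: "0 \<le> t" "t < T"
  shows "c t \<in> ball 0 1"
proof (rule ccontr)
  assume "c t \<notin> ball 0 1"
  moreover have "c t \<in> cball 0 1" using geo t unfolding geodesic_on_def by auto
  ultimately have ct: "c t \<in> sphere 0 1" by auto
  then have t0: "0 < t" using t c0 by (cases "t = 0") auto
  have "geodesic_on (cball 0 1) g t c c'" using geodesic_on_restrict[OF geo t0] t by simp
  then have nz: "c' t \<bullet> c t \<noteq> 0" using transverse ct c0 unfolding radial_transverse_def by blast
  have "(c has_vector_derivative c' t) (at t within {0..T})" using geo t unfolding geodesic_on_def by auto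
  moreover have "at t within {0..T} = at t" using t0 t by (intro at_within_Icc_at) auto
  ultimately have dc: "(c has_vector_derivative c' t) (at t)" by simp
  have "((\<lambda>s. c s \<bullet> c s) has_real_derivative 2 * (c' t \<bullet> c t)) (at t)"
    using bounded_bilinear.has_vector_derivative[OF bounded_bilinear_inner dc dc]
    by (simp add: has_real_derivative_iff_has_vector_derivative inner_commute)
  moreover have "c s \<bullet> c s \<le> c t \<bullet> c t" if "\<bar>t - s\<bar> < min t (T - t)" for s
  proof -
    have "s \<in> {0..T}" using that by auto
    then have "norm (c s) \<le> 1" using geo unfolding geodesic_on_def by auto
    then have "(norm (c s))\<^sup>2 \<le> 1" by (simp add: power_le_one)
    moreover have "(norm (c t))\<^sup>2 = 1" using ct by simp
    ultimately show ?thesis by (simp add: power2_norm_eq_inner)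
  qed
  ultimately have "2 * (c' t \<bullet> c t) = 0"
    using DERIV_local_max[of "\<lambda>s. c s \<bullet> c s" "2 * (c' t \<bullet> c t)" t "min t (T - t)"] t0 t by auto
  then show False using nz by simp
qed

text \<open>By \<open>geodesic_in_ball\<close> only the endpoint can lie on the sphere, beyond the
  reach of \<open>B.geodesic_unique\<close>; there continuity decides. This makes the description in
  \<open>exp_o\<close> well defined.\<close>

lemma geodesic_unique_cball:
  assumes 1: "geodesic_on (cball 0 1) g T c1 c1'" and 2: "geodesic_on (cball 0 1) g T c2 c2'"
    and init: "c1 0 = 0" "c2 0 = 0" "c1' 0 = c2' 0" and t: "t \<in> {0..T}"
  shows "c1 t = c2 t"
proof -
  have T: "0 < T" using 1 by (simp add: geodesic_on_def)
  have less: "c1 t = c2 t" if t: "0 \<le> t" "t < T" for t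
  proof (cases "t = 0")
    case False
    then have "0 < t" using t by simp
    then show ?thesis
      using B.geodesic_unique[OF geodesic_on_restrict[OF 1] geodesic_on_restrict[OF 2], of t t]
        geodesic_in_ball[OF 1 init(1)] geodesic_in_ball[OF 2 init(2)] t init by auto
  qed (use init in auto)
  have cont: "continuous_on {0..T} c" if "geodesic_on (cball 0 1) g T c c'" for c c'
    unfolding continuous_on_eq_continuous_within
    using that has_vector_derivative_continuous unfolding geodesic_on_def by blast
  show ?thesis
    using less[of t] continuous_on_agree_endpoint[OF cont[OF 1] cont[OF 2] T less] t
    by (cases "t = T") auto
qed

lemma exp_o_eq:
  assumes "exp_rel g v y" shows "exp_o g v = y"
proof -
  have "y' = y" if "exp_rel g v y'" for y'
    using assms that geodesic_unique_cball[where T=1 and t=1] unfolding exp_rel_def by force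
  then show ?thesis using assms unfolding exp_o_def by blast
qed

lemma exp_rel_scale:
  assumes geo: "geodesic_on (cball 0 1) g 1 c c'" and c0: "c 0 = 0" and t: "t \<in> {0..1}"
  shows "exp_rel g (t *\<^sub>R c' 0) (c t)"
proof (cases "t = 0")
  case True
  have "geodesic_on (cball 0 1) g 1 (\<lambda>_. 0) (\<lambda>_. 0)"
    by (simp add: geodesic_on_def zero_vec_def[symmetric] del: vec_lambda_beta)
  then show ?thesis using True c0 unfolding exp_rel_def by fastforce
next
  case False
  then have "geodesic_on (cball 0 1) g 1 (\<lambda>s. c (t * s)) (\<lambda>s. t *\<^sub>R c' (t * s))"
    using geodesic_on_rescale[OF geo] t by auto
  then show ?thesis unfolding exp_rel_def using c0
    by (intro exI[of _ "\<lambda>s. c (t * s)"] exI[of _ "\<lambda>s. t *\<^sub>R c' (t * s)"]) auto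
qed

section \<open>Topology of the domain of the exponential map\<close>

definition V where "V = exp_domain g"

lemma V_is_exp_domain: "is_exp_domain g V"
  unfolding V_def exp_domain_def using someI_ex[OF exp_domain_ex] .

lemma V_bij: "bij_betw (exp_o g) V (cball 0 1)"
  and V_cont: "continuous_on V (exp_o g)"
  and V_inv: "continuous_on (cball 0 1) (the_inv_into V (exp_o g))"
  using V_is_exp_domain unfolding is_exp_domain_def diffeo_between_def by (auto intro: smooth_on_imp_continuous_on)

lemma V_inv_image: "the_inv_into V (exp_o g) ` cball 0 1 = V"
  using V_bij by (metis bij_betw_def bij_betw_the_inv_into)

lemma V_compact: "compact V"
  using compact_continuous_image[OF V_inv compact_cball] V_inv_image by simp

text \<open>Invariance of domain in both directions: for the inverse map on the open ball, and for
  \<open>exp_o g\<close> on the interior of \<open>V\<close>.\<close>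

lemma V_interior_iff:
  assumes v: "v \<in> V" shows "exp_o g v \<in> ball 0 1 \<longleftrightarrow> v \<in> interior V"
proof
  assume b: "exp_o g v \<in> ball 0 1"
  let ?i = "the_inv_into V (exp_o g)"
  have "open (?i ` ball 0 1)"
  proof (rule invariance_of_domain)
    show "continuous_on (ball 0 1) ?i" using V_inv ball_subset_cball by (blast intro: continuous_on_subset)
    show "inj_on ?i (ball 0 1)"
      using bij_betw_the_inv_into[OF V_bij] ball_subset_cball by (meson bij_betw_def inj_on_subset)
  qed auto
  moreover have "?i ` ball 0 1 \<subseteq> V" using V_inv_image ball_subset_cball by blast
  moreover have "v = ?i (exp_o g v)" using v V_bij by (simp add: bij_betw_def the_inv_into_f_f)
  ultimately show "v \<in> interior V" using b by (metis image_eqI interiorI)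
next
  assume "v \<in> interior V"
  have "open (exp_o g ` interior V)"
    using V_cont V_bij interior_subset
    by (intro invariance_of_domain) (auto intro: continuous_on_subset simp: bij_betw_def intro: inj_on_subset)
  moreover have "exp_o g ` interior V \<subseteq> cball 0 1" using V_bij interior_subset by (auto simp: bij_betw_def)
  ultimately have "exp_o g ` interior V \<subseteq> interior (cball 0 1)" by (rule interior_maximal[rotated])
  then show "exp_o g v \<in> ball 0 1" using \<open>v \<in> interior V\<close> by (auto simp: interior_cball)
qed

text \<open>The times t in \<open>I\<close> with t v in \<open>V\<close>, where v is the initial
  velocity, form a closed set because \<open>V\<close> is compact, and an open one because a point
  of \<open>V\<close> mapped into the open ball is interior to \<open>V\<close>. Connectedness of
  \<open>I\<close> spreads membership from \<open>i\<close> to all of \<open>I\<close>.\<close>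

lemma V_ray:
  assumes geo: "geodesic_on (cball 0 1) g 1 c c'" and c0: "c 0 = 0" and I: "I \<subseteq> {0..1}" "connected I"
    and ball: "\<And>t. t \<in> I \<Longrightarrow> c t \<in> ball 0 1" and i: "i \<in> I" "i *\<^sub>R c' 0 \<in> V" and t: "t \<in> I"
  shows "t *\<^sub>R c' 0 \<in> interior V"
proof -
  let ?f = "\<lambda>t::real. t *\<^sub>R c' 0"
  have iff: "?f t \<in> V \<longleftrightarrow> ?f t \<in> interior V" if "t \<in> I" for t
    using V_interior_iff[of "?f t"] exp_o_eq[OF exp_rel_scale[OF geo c0, of t]] ball[OF that] that I interior_subset
    by auto
  have cont: "continuous_on I ?f" by (intro continuous_intros)
  have "closedin (top_of_set I) (I \<inter> ?f -` V)"
    by (rule continuous_closedin_preimage[OF cont compact_imp_closed[OF V_compact]])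
  moreover have "I \<inter> ?f -` V = I \<inter> ?f -` interior V" using iff by auto
  moreover have "openin (top_of_set I) (I \<inter> ?f -` interior V)"
    by (rule continuous_openin_preimage_gen[OF cont open_interior])
  ultimately have "I \<inter> ?f -` interior V = {} \<or> I \<inter> ?f -` interior V = I"
    using I(2) unfolding connected_clopen by metis
  moreover have "i \<in> I \<inter> ?f -` interior V" using i iff by auto
  ultimately show ?thesis using t by blast
qed

text \<open>Some v in \<open>V\<close> is mapped to the center. Its geodesic is then a curve from
  the center to the center inside the open ball, along which \<open>V_ray\<close> runs from time 1
  back to time 0.\<close>

lemma zero_interior_V: "0 \<in> interior V"
proof -
  have "0 \<in> exp_o g ` V" using V_bij by (simp add: bij_betw_def)
  then obtain v where v: "v \<in> V" "exp_o g v = 0" by force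
  obtain c c' where geo: "geodesic_on (cball 0 1) g 1 c c'" and c: "c 0 = 0" "c' 0 = v"
    using V_is_exp_domain v(1) unfolding is_exp_domain_def exp_rel_def by metis
  have c1: "c 1 = 0" using exp_o_eq[OF exp_rel_scale[OF geo c(1), of 1]] v(2) c(2) by simp
  have "0 *\<^sub>R c' 0 \<in> interior V"
  proof (rule V_ray[OF geo c(1), of "{0..1}" 1])
    show "c t \<in> ball 0 1" if "t \<in> {0..1}" for t
      using geodesic_in_ball[OF geo c(1), of t] that c1 by (cases "t = 1") auto
  qed (use v c in auto)
  then show ?thesis by simp
qed

text \<open>\<open>V_ray\<close> started at time 0; the half-open interval keeps the geodesic off
  the sphere.\<close>

lemma V_star:
  assumes v: "v \<in> V" and t: "0 \<le> t" "t < 1" shows "t *\<^sub>R v \<in> interior V"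
proof -
  obtain c c' where geo: "geodesic_on (cball 0 1) g 1 c c'" and c: "c 0 = 0" "c' 0 = v"
    using V_is_exp_domain v(1) unfolding is_exp_domain_def exp_rel_def by metis
  have "t *\<^sub>R c' 0 \<in> interior V"
    by (rule V_ray[OF geo c(1), of "{0..<1}" 0])
       (use geodesic_in_ball[OF geo c(1)] zero_interior_V interior_subset t in auto)
  then show ?thesis using c by simp
qed

text \<open>The matrix of \<open>normal_phi g\<close>; by \<open>P_inner\<close> it is an isometry
  from the Euclidean inner product to \<open>g 0\<close>.\<close>

definition P where "P = matrix_inv (matrix_sqrt (g 0))"

lemma sqrt_g0: "pos_def_sym (matrix_sqrt (g 0))" "matrix_sqrt (g 0) ** matrix_sqrt (g 0) = g 0"
  using matrix_sqrt[OF pos_def_cball[of 0]] by auto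

lemma P_inv: "matrix_sqrt (g 0) ** P = mat 1" "P ** matrix_sqrt (g 0) = mat 1"
  using matrix_inv_mult[OF pos_def_sym_invertible[OF sqrt_g0(1)]] by (auto simp: P_def)

lemma normal_phi_eq: "normal_phi g x = P *v x"
proof -
  have "P *v x = P *v (\<Sum>i\<in>UNIV. x $ i *\<^sub>R axis i 1)" by (simp add: basis_expansion flip: scalar_mult_eq_scaleR)
  then show ?thesis
    by (simp add: normal_phi_def normal_frame_def P_def linear_sum[OF matrix_vector_mul_linear] matrix_vector_mult_scaleR)
qed

lemma P_inner: "(P *v x) \<bullet> (g 0 *v (P *v y)) = x \<bullet> y"
proof -
  let ?h = "matrix_sqrt (g 0)"
  have "transpose ?h = ?h" using sqrt_g0(1) by (simp add: pos_def_sym_def)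
  then have "(?h *v (P *v x)) \<bullet> (?h *v (P *v y)) = (P *v x) \<bullet> (?h *v (?h *v (P *v y)))"
    by (rule symmetric_dot_swap)
  moreover have "?h *v (?h *v z) = g 0 *v z" for z by (simp only: matrix_vector_mul_assoc sqrt_g0(2))
  moreover have "?h *v (P *v z) = z" for z by (simp only: matrix_vector_mul_assoc P_inv matrix_vector_mul_lid)
  ultimately show ?thesis by metis
qed

abbreviation Om where "Om \<equiv> Omega g"
abbreviation W where "W \<equiv> interior (Omega g)"
abbreviation ex where "ex \<equiv> exp_tilde g"

lemma P_cancel: "P *v (matrix_sqrt (g 0) *v x) = x" "matrix_sqrt (g 0) *v (P *v x) = x"
  by (simp_all only: matrix_vector_mul_assoc P_inv matrix_vector_mul_lid)

lemma Om_eq: "Om = (*v) (matrix_sqrt (g 0)) ` V"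
  unfolding Omega_def V_def[symmetric]
proof (intro equalityI subsetI)
  fix x assume "x \<in> normal_phi g -` V"
  then show "x \<in> (*v) (matrix_sqrt (g 0)) ` V" 
    using P_cancel(2)[of x] by (intro image_eqI[of _ _ "P *v x"]) (auto simp: normal_phi_eq)
next
  fix x assume "x \<in> (*v) (matrix_sqrt (g 0)) ` V"
  then show "x \<in> normal_phi g -` V" by (auto simp: normal_phi_eq P_cancel)
qed

lemma Om_iff: "x \<in> Om \<longleftrightarrow> P *v x \<in> V"
  by (simp add: Omega_def V_def normal_phi_eq)

lemma W_eq: "W = (*v) (matrix_sqrt (g 0)) ` interior V"
  unfolding Om_eq
  by (rule interior_injective_linear_image) (auto intro!: injI, metis P_cancel(1))

lemma W_iff: "x \<in> W \<longleftrightarrow> P *v x \<in> interior V"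
  unfolding W_eq by (auto simp: P_cancel image_iff intro!: bexI[of _ "P *v x"])

lemma ex_eq: "ex x = exp_o g (P *v x)"
  by (simp add: exp_tilde_def normal_phi_eq)

lemma Om_compact: "compact Om"
  unfolding Om_eq by (intro compact_continuous_image V_compact matrix_vector_mult_linear_continuous_on)

lemma zero_W: "0 \<in> W"
  by (simp add: W_iff zero_interior_V)

lemma Om_star: "x \<in> Om \<Longrightarrow> 0 \<le> t \<Longrightarrow> t < 1 \<Longrightarrow> t *\<^sub>R x \<in> W"
  by (simp add: W_iff Om_iff matrix_vector_mult_scaleR V_star)

lemma W_sub: "W \<subseteq> Om" by (rule interior_subset)

lemma Om_geodesic:
  assumes x: "x \<in> Om"
  obtains c c' where "geodesic_on (cball 0 1) g 1 c c'" "c 0 = 0" "c' 0 = P *v x"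
    "\<And>t. t \<in> {0..1} \<Longrightarrow> ex (t *\<^sub>R x) = c t"
proof -
  obtain c c' where geo: "geodesic_on (cball 0 1) g 1 c c'" and c: "c 0 = 0" "c' 0 = P *v x"
    using V_is_exp_domain x unfolding is_exp_domain_def exp_rel_def Om_iff by metis
  then show ?thesis
    using that[OF geo c] exp_o_eq[OF exp_rel_scale[OF geo c(1)]] by (simp add: ex_eq matrix_vector_mult_scaleR)
qed

lemma ex_bij: "bij_betw ex Om (cball 0 1)"
proof -
  have "bij_betw ((*v) P) Om V"
    unfolding bij_betw_def Om_eq by (auto simp: P_cancel image_image intro!: inj_onI)
  from bij_betw_trans[OF this V_bij] show ?thesis
    by (simp add: o_def ex_eq[abs_def])
qed

lemma ex_ball_iff: "x \<in> Om \<Longrightarrow> ex x \<in> ball 0 1 \<longleftrightarrow> x \<in> W"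
  using V_interior_iff by (simp add: Om_iff W_iff ex_eq)

lemma ex_in_cball: "x \<in> Om \<Longrightarrow> ex x \<in> cball 0 1"
  using ex_bij by (auto simp: bij_betw_def)

lemma ex_extension:
  obtains U E where "open U" "Om \<subseteq> U" "\<And>m. Ck_open m U E" "\<And>x. x \<in> Om \<Longrightarrow> E x = ex x"
proof -
  obtain U F where U: "open U" "V \<subseteq> U" "\<forall>m. Ck_open m U F" "\<forall>x\<in>V. F x = exp_o g x"
    using V_is_exp_domain unfolding is_exp_domain_def diffeo_between_def smooth_on_def by metis
  let ?U = "(*v) P -` U"
  have oU: "open ?U" by (intro open_vimage U matrix_vector_mult_linear_continuous_on)
  have "Ck_open m ?U (\<lambda>x. F (P *v x))" for m
    by (rule Ck_open_compose[OF oU Ck_open_linear[OF oU matrix_vector_mul_linear] U(1)]) (use U in auto)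
  then show ?thesis
    using oU U by (intro that[of ?U "\<lambda>x. F (P *v x)"]) (auto simp: Om_iff ex_eq)
qed

lemma Ck_ex: "Ck_open m W ex"
proof -
  obtain U E where U: "Om \<subseteq> U" "\<And>m. Ck_open m U E" "\<And>x. x \<in> Om \<Longrightarrow> E x = ex x"
    using ex_extension by metis
  have "Ck_open m W E" using U(2) by (rule Ck_open_subset) (use U W_sub in blast)
  then show ?thesis by (rule Ck_open_transform[rotated 2]) (use U W_sub in auto)
qed

text \<open>A smooth extension of the inverse of \<open>exp_o g\<close>, composed with
  \<open>ex\<close>, is the linear map \<open>P\<close> near \<open>z\<close>, and \<open>P\<close>
  is injective.\<close>

lemma ex_derivative_inj:
  assumes z: "z \<in> W" and w: "frechet_derivative ex (at z) w = 0"
  shows "w = 0"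
proof -
  let ?i = "the_inv_into V (exp_o g)"
  obtain U F where U: "open U" "cball 0 1 \<subseteq> U" "\<forall>m. Ck_open m U F" "\<forall>x\<in>cball 0 1. F x = ?i x"
    using V_is_exp_domain unfolding is_exp_domain_def diffeo_between_def smooth_on_def by metis
  have dex: "(ex has_derivative frechet_derivative ex (at z)) (at z)"
    using Ck_open_Suc_has_derivative[OF Ck_ex z] .
  have exz: "ex z \<in> U" using ex_in_cball z W_sub U(2) by blast
  then have dF: "(F has_derivative frechet_derivative F (at (ex z))) (at (ex z))"
    using U(3) Ck_open_Suc_has_derivative by blast
  have "((\<lambda>y. F (ex y)) has_derivative (\<lambda>v. frechet_derivative F (at (ex z)) (frechet_derivative ex (at z) v))) (at z)"
    using diff_chain_at[OF dex dF] by (simp add: o_def)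
  moreover have "((\<lambda>y. F (ex y)) has_derivative (*v) P) (at z)"
  proof (rule has_derivative_transform_within_open[OF _ open_interior z])
    show "((*v) P has_derivative (*v) P) (at z)" by (intro linear_imp_has_derivative) simp
    show "P *v y = F (ex y)" if "y \<in> W" for y
    proof -
      have y: "y \<in> Om" using that W_sub by blast
      then have "F (ex y) = ?i (exp_o g (P *v y))" using U(4) ex_in_cball[OF y] by (simp add: ex_eq)
      also have "\<dots> = P *v y" using y V_bij by (simp add: Om_iff bij_betw_def the_inv_into_f_f)
      finally show ?thesis by simp
    qed
  qed
  ultimately have "(\<lambda>v. frechet_derivative F (at (ex z)) (frechet_derivative ex (at z) v)) = (*v) P"
    by (rule has_derivative_unique)
  then have "P *v w = frechet_derivative F (at (ex z)) 0" using w by metis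
  also have "\<dots> = 0" using has_derivative_linear[OF dF] by (rule linear_0)
  finally show "w = 0" by (metis P_cancel(2) matrix_vector_mult_0_right)
qed

end

section \<open>Gauss lemma and Rauch comparison\<close>

text \<open>For a Jacobi field J with covariant derivative K take Q = |J|^2, A = J . K and N =
  |K|^2. Then \<open>w\<close> is the Wronskian |J|' \<sigma> - |J| \<sigma>' against the model
  solution of \<sigma>'' = \<kappa> \<sigma>. It is nondecreasing by \<open>A'\<close> and
  \<open>CS\<close> and tends to 0 at 0, hence is nonnegative, and it carries the sign of the
  derivative of Q / \<sigma>^2. Everything is differentiated in the open interval because
  \<open>Q\<close> vanishes at 0.\<close>

lemma sturm_comparison:
  fixes Q A A' N \<sigma> \<sigma>' :: "real \<Rightarrow> real"
  assumes Q: "\<And>t. 0 < t \<Longrightarrow> t < 1 \<Longrightarrow> 0 < Q t"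
    and dQ: "\<And>t. 0 < t \<Longrightarrow> t < 1 \<Longrightarrow> (Q has_real_derivative 2 * A t) (at t)"
    and dA: "\<And>t. 0 < t \<Longrightarrow> t < 1 \<Longrightarrow> (A has_real_derivative A' t) (at t)"
    and A': "\<And>t. 0 < t \<Longrightarrow> t < 1 \<Longrightarrow> N t + \<kappa> * Q t \<le> A' t"
    and CS: "\<And>t. 0 < t \<Longrightarrow> t < 1 \<Longrightarrow> (A t)\<^sup>2 \<le> N t * Q t"
    and Q0: "(Q \<longlongrightarrow> 0) (at_right 0)" and N0: "(N \<longlongrightarrow> L) (at_right 0)"
    and \<sigma>: "\<And>t. 0 < t \<Longrightarrow> 0 < \<sigma> t" and d\<sigma>: "\<And>t. (\<sigma> has_real_derivative \<sigma>' t) (at t)"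
    and d\<sigma>': "\<And>t. (\<sigma>' has_real_derivative \<kappa> * \<sigma> t) (at t)" and \<sigma>0: "\<sigma> 0 = 0"
    and st: "0 < s" "s \<le> t" "t < 1"
  shows "Q s / (\<sigma> s)\<^sup>2 \<le> Q t / (\<sigma> t)\<^sup>2"
proof -
  define w where "w = (\<lambda>t. (A t * \<sigma> t - Q t * \<sigma>' t) / sqrt (Q t))"
  have dw: "\<exists>y. (w has_real_derivative y) (at t) \<and> 0 \<le> y" if t: "0 < t" "t < 1" for t
  proof -
    have q: "0 < Q t" using Q t by blast
    have sq: "sqrt (Q t) * sqrt (Q t) = Q t" "sqrt (Q t) > 0" using q by auto
    have dsq: "((\<lambda>t. sqrt (Q t)) has_real_derivative A t / sqrt (Q t)) (at t)"
      using q dQ[OF t] by (auto intro!: derivative_eq_intros simp: field_simps)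
    define y where "y = ((A' t * \<sigma> t + \<sigma>' t * A t - (2 * A t * \<sigma>' t + \<kappa> * \<sigma> t * Q t)) * sqrt (Q t)
         - (A t * \<sigma> t - Q t * \<sigma>' t) * (A t / sqrt (Q t))) / (sqrt (Q t) * sqrt (Q t))"
    have "(w has_real_derivative y) (at t)"
      unfolding w_def y_def
      by (intro DERIV_divide DERIV_diff DERIV_mult dA dQ d\<sigma> d\<sigma>' dsq t) (use q in auto)
    moreover have "y * sqrt (Q t) * Q t = \<sigma> t * (A' t * Q t - \<kappa> * Q t * Q t - (A t)\<^sup>2)"
    proof -
      define r where "r = sqrt (Q t)"
      have r: "r > 0" "Q t = r * r" using sq by (auto simp: r_def)
      show ?thesis unfolding y_def r_def[symmetric] r(2)
        using r(1) by (simp add: field_simps power2_eq_square)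
    qed
    moreover have "0 \<le> A' t * Q t - \<kappa> * Q t * Q t - (A t)\<^sup>2"
    proof -
      have "(N t + \<kappa> * Q t) * Q t \<le> A' t * Q t" using A'[OF t] q by (intro mult_right_mono) auto
      then show ?thesis using CS[OF t] by (simp add: algebra_simps)
    qed
    ultimately have "0 \<le> y * (sqrt (Q t) * Q t)" using \<sigma>[OF t(1)] by (simp add: mult.assoc)
    then have "0 \<le> y" using mult_pos_pos[OF sq(2) q] by (meson mult_neg_pos not_less)
    with \<open>(w has_real_derivative y) (at t)\<close> show ?thesis by blast
  qed
  have \<sigma>_lim: "(\<sigma> \<longlongrightarrow> 0) (at_right 0)" "(\<sigma>' \<longlongrightarrow> \<sigma>' 0) (at_right 0)"
    using DERIV_isCont[OF d\<sigma>[of 0]] DERIV_isCont[OF d\<sigma>'[of 0]] \<sigma>0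
    by (auto simp: isCont_def intro: filterlim_at_split[THEN iffD1, THEN conjunct2])
  \<comment> \<open>Both Q and \<sigma> tend to 0, so the quotient A / sqrt Q has to be controlled:
    by \<open>CS\<close> it is at most sqrt N, which has a limit.\<close>
  have lim: "(w \<longlongrightarrow> 0) (at_right 0)"
  proof (rule Lim_null_comparison)
    show "((\<lambda>t. sqrt (N t) * \<sigma> t + sqrt (Q t) * \<bar>\<sigma>' t\<bar>) \<longlongrightarrow> 0) (at_right 0)"
      using tendsto_add[OF tendsto_mult[OF tendsto_real_sqrt[OF N0] \<sigma>_lim(1)] tendsto_mult[OF tendsto_real_sqrt[OF Q0] tendsto_rabs[OF \<sigma>_lim(2)]]]
      by simp
    have "norm (w t) \<le> sqrt (N t) * \<sigma> t + sqrt (Q t) * \<bar>\<sigma>' t\<bar>" if t: "0 < t" "t < 1" for t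
    proof -
      have q: "0 < Q t" using Q t by blast
      have "\<bar>A t\<bar> \<le> sqrt (N t * Q t)" using real_sqrt_le_mono[OF CS[OF t]] by simp
      then have 1: "\<bar>A t\<bar> / sqrt (Q t) \<le> sqrt (N t)" using q by (simp add: real_sqrt_mult field_simps)
      have "\<bar>w t\<bar> \<le> \<bar>A t\<bar> / sqrt (Q t) * \<sigma> t + Q t / sqrt (Q t) * \<bar>\<sigma>' t\<bar>"
        unfolding w_def using q \<sigma>[OF t(1)] abs_triangle_ineq4[of "A t * \<sigma> t" "Q t * \<sigma>' t"]
        by (simp add: abs_mult divide_right_mono add_divide_distrib[symmetric])
      also have "\<dots> \<le> sqrt (N t) * \<sigma> t + sqrt (Q t) * \<bar>\<sigma>' t\<bar>"
        using 1 \<sigma>[OF t(1)] q by (intro add_mono mult_right_mono) (auto simp: real_div_sqrt)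
      finally show ?thesis by simp
    qed
    then show "\<forall>\<^sub>F t in at_right 0. norm (w t) \<le> sqrt (N t) * \<sigma> t + sqrt (Q t) * \<bar>\<sigma>' t\<bar>"
      by (auto simp: eventually_at_right_field intro!: exI[of _ 1])
  qed
  have w0: "0 \<le> w t" if t: "0 < t" "t < 1" for t
  proof (rule tendsto_upperbound[OF lim])
    have "w s \<le> w t" if "0 < s" "s < t" for s
      by (rule DERIV_nonneg_imp_nondecreasing[of s t w]) (use dw that t in auto)
    then show "\<forall>\<^sub>F s in at_right 0. w s \<le> w t"
      using t by (auto simp: eventually_at_right_field intro!: exI[of _ t])
  qed simp
  have pos: "0 \<le> A t * \<sigma> t - Q t * \<sigma>' t" if t: "0 < t" "t < 1" for t
    using w0[OF t] Q[OF t] by (simp add: w_def zero_le_divide_iff)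
  show ?thesis
  proof (rule DERIV_nonneg_imp_nondecreasing[OF st(2)])
    fix r assume "s \<le> r" "r \<le> t"
    then have r: "0 < r" "r < 1" using st by auto
    have sr: "\<sigma> r > 0" using \<sigma> r by blast
    define y where "y = (2 * A r * (\<sigma> r)\<^sup>2 - Q r * (2 * \<sigma> r * \<sigma>' r)) / ((\<sigma> r)\<^sup>2 * (\<sigma> r)\<^sup>2)"
    have "((\<lambda>t. (\<sigma> t)\<^sup>2) has_real_derivative 2 * \<sigma> r * \<sigma>' r) (at r)"
      using d\<sigma>[of r] by (auto intro!: derivative_eq_intros)
    then have "((\<lambda>a. Q a / (\<sigma> a)\<^sup>2) has_real_derivative y) (at r)"
      unfolding y_def by (intro DERIV_divide dQ r) (use sr in auto)
    moreover have "y = 2 * \<sigma> r * (A r * \<sigma> r - Q r * \<sigma>' r) / ((\<sigma> r)\<^sup>2 * (\<sigma> r)\<^sup>2)"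
      unfolding y_def by (simp add: algebra_simps power2_eq_square)
    then have "0 \<le> y" using pos[OF r] sr by simp
    ultimately show "\<exists>y. ((\<lambda>a. Q a / (\<sigma> a)\<^sup>2) has_real_derivative y) (at r) \<and> 0 \<le> y" by blast
  qed
qed

definition c_model :: "real \<Rightarrow> real \<Rightarrow> real" where
  "c_model k r = (if k = 0 then 1 else cosh (sqrt (- k) * r))"

lemma s_model_derivative:
  assumes "k \<le> 0"
  shows "((\<lambda>t. s_model k (r * t)) has_real_derivative r * c_model k (r * t)) (at t)"
    and "((\<lambda>t. r * c_model k (r * t)) has_real_derivative (- k * r\<^sup>2) * s_model k (r * t)) (at t)"
proof -
  define a where "a = sqrt (- k)"
  have a: "a * a = - k" using assms by (simp add: a_def)
  have "((\<lambda>t. s_model k (r * t)) has_real_derivative r * c_model k (r * t)) (at t) \<and>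
    ((\<lambda>t. r * c_model k (r * t)) has_real_derivative (- k * r\<^sup>2) * s_model k (r * t)) (at t)"
  proof (cases "k = 0")
    case True
    then show ?thesis by (auto simp: s_model_def[abs_def] c_model_def[abs_def] intro!: derivative_eq_intros)
  next
    case False
    then have a0: "a \<noteq> 0" using a by auto
    have s: "s_model k = (\<lambda>x. sinh (a * x) / a)" "c_model k = (\<lambda>x. cosh (a * x))"
      using False by (auto simp: s_model_def[abs_def] c_model_def[abs_def] a_def)
    have "((\<lambda>t. sinh (a * (r * t)) / a) has_real_derivative r * cosh (a * (r * t))) (at t)"
      using a0 by (auto intro!: derivative_eq_intros)
    moreover have "((\<lambda>t. r * cosh (a * (r * t))) has_real_derivative r * (sinh (a * (r * t)) * (a * r))) (at t)"
      by (auto intro!: derivative_eq_intros)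
    moreover have "r * (sinh (a * (r * t)) * (a * r)) = (- k * r\<^sup>2) * (sinh (a * (r * t)) / a)"
      unfolding a[symmetric] using a0 by (simp add: power2_eq_square)
    ultimately show ?thesis unfolding s by simp
  qed
  then show "((\<lambda>t. s_model k (r * t)) has_real_derivative r * c_model k (r * t)) (at t)"
    "((\<lambda>t. r * c_model k (r * t)) has_real_derivative (- k * r\<^sup>2) * s_model k (r * t)) (at t)" by auto
qed

lemma s_model_0 [simp]: "s_model k 0 = 0"
  by (simp add: s_model_def)

lemma s_model_pos: "k \<le> 0 \<Longrightarrow> 0 < r \<Longrightarrow> 0 < s_model k r"
  by (simp add: s_model_def)

lemma pos_def_cauchy_schwarz:
  assumes "pos_def_sym G"
  shows "(u \<bullet> (G *v v))\<^sup>2 \<le> (u \<bullet> (G *v u)) * (v \<bullet> (G *v v))"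
proof -
  define h where "h = matrix_sqrt G"
  have h: "transpose h = h" "h ** h = G" using matrix_sqrt[OF assms] by (auto simp: h_def pos_def_sym_def)
  have "x \<bullet> (G *v y) = (h *v x) \<bullet> (h *v y)" for x y
    using symmetric_dot_swap[OF h(1), of x "h *v y"] by (simp add: matrix_vector_mul_assoc h)
  then show ?thesis using Cauchy_Schwarz_ineq[of "h *v u" "h *v v"] by simp
qed

section \<open>Jacobi fields as derivatives of the exponential map\<close>

context star_metric
begin

text \<open>Orthogonality reduces the denominator of \<open>sectional_curvature\<close> to a product
  of squared lengths and also supplies the independence of \<open>u\<close> and
  \<open>v\<close>.\<close>

lemma curvature_bound:
  assumes x: "x \<in> ball 0 1" and u: "u \<noteq> 0" and v: "v \<noteq> 0" and uv: "u \<bullet> (g x *v v) = 0"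
  shows "u \<bullet> (g x *v riem_curv (cball 0 1) g x u v v) \<le> k * ((u \<bullet> (g x *v u)) * (v \<bullet> (g x *v v)))"
proof -
  have pos: "0 < u \<bullet> (g x *v u)" "0 < v \<bullet> (g x *v v)" using B.pos_g[OF x] u v by auto
  have "u \<notin> span {v}"
  proof
    assume "u \<in> span {v}"
    then obtain a where "u = a *\<^sub>R v" by (auto simp: span_singleton)
    then show False using uv pos by auto
  qed
  then have "u \<noteq> v" "independent {u, v}"
    using v span_base[of v "{v}"] by (auto simp: independent_insert)
  then have "sectional_curvature (cball 0 1) g x u v \<le> k" using curvature_le x by auto
  moreover have "riem_inner (g x) (riem_curv (cball 0 1) g x u v v) u = u \<bullet> (g x *v riem_curv (cball 0 1) g x u v v)"
    unfolding riem_inner_def by (subst inner_commute) (rule symmetric_dot_swap[OF B.sym_g[OF x]])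
  ultimately have "u \<bullet> (g x *v riem_curv (cball 0 1) g x u v v) / ((u \<bullet> (g x *v u)) * (v \<bullet> (g x *v v))) \<le> k"
    by (simp add: sectional_curvature_def riem_inner_def uv)
  then show ?thesis using mult_pos_pos[OF pos] by (simp add: pos_divide_le_eq)
qed

text \<open>Directions come first and the point last, so that fixing the directions leaves a
  function of the point that can be differentiated again.\<close>

definition D1 where "D1 u z = frechet_derivative ex (at z) u"
definition D2 where "D2 u v z = frechet_derivative (D1 u) (at z) v"
definition D3 where "D3 u v w z = frechet_derivative (D2 u v) (at z) w"

lemma Ck_D1: "Ck_open m W (D1 u)"
  using Ck_open_Suc_derivative[OF Ck_ex] by (simp add: D1_def[abs_def])

lemma Ck_D2: "Ck_open m W (D2 u v)"
  using Ck_open_Suc_derivative[OF Ck_D1] by (simp add: D2_def[abs_def])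

lemma has_derivative_ex: "z \<in> W \<Longrightarrow> (ex has_derivative (\<lambda>u. D1 u z)) (at z)"
  using Ck_open_Suc_has_derivative[OF Ck_ex] unfolding D1_def by auto

lemma has_derivative_D1: "z \<in> W \<Longrightarrow> (D1 u has_derivative (\<lambda>v. D2 u v z)) (at z)"
  using Ck_open_Suc_has_derivative[OF Ck_D1] unfolding D2_def by auto

lemma has_derivative_D2: "z \<in> W \<Longrightarrow> (D2 u v has_derivative (\<lambda>w. D3 u v w z)) (at z)"
  using Ck_open_Suc_has_derivative[OF Ck_D2] unfolding D3_def by auto

lemma linear_D1: "z \<in> W \<Longrightarrow> linear (\<lambda>u. D1 u z)"
  using has_derivative_ex has_derivative_linear by blast

lemma linear_D2: "z \<in> W \<Longrightarrow> linear (\<lambda>v. D2 u v z)"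
  using has_derivative_D1 has_derivative_linear by blast

lemma D2_commute: "z \<in> W \<Longrightarrow> D2 u v z = D2 v u z"
  using second_derivative_symmetric[OF open_interior Ck_ex, of z u v] by (simp add: D1_def[abs_def] D2_def)

lemma D3_commute: "z \<in> W \<Longrightarrow> D3 u v w z = D3 u w v z" "z \<in> W \<Longrightarrow> D3 u v w z = D3 v u w z"
proof -
  show "z \<in> W \<Longrightarrow> D3 u v w z = D3 u w v z"
    using second_derivative_symmetric[OF open_interior Ck_D1, of z u v w] by (simp add: D2_def[abs_def] D3_def)
  show "z \<in> W \<Longrightarrow> D3 u v w z = D3 v u w z"
    unfolding D3_def using frechet_derivative_cong_open[OF open_interior, of z _ "D2 u v" "D2 v u"] D2_commute by simp
qed

lemma D1_linear_simps:
  assumes "z \<in> W"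
  shows "D1 (u + v) z = D1 u z + D1 v z" "D1 (c *\<^sub>R u) z = c *\<^sub>R D1 u z"
  using linear_add[OF linear_D1[OF assms]] linear_scale[OF linear_D1[OF assms]] by auto

lemma D2_linear_simps:
  assumes "z \<in> W"
  shows "D2 u (v + w) z = D2 u v z + D2 u w z" "D2 u (c *\<^sub>R v) z = c *\<^sub>R D2 u v z"
    "D2 (v + w) u z = D2 v u z + D2 w u z" "D2 (c *\<^sub>R v) u z = c *\<^sub>R D2 v u z"
  using linear_add[OF linear_D2[OF assms]] linear_scale[OF linear_D2[OF assms]] D2_commute[OF assms] by metis+

lemma D3_scale:
  assumes z: "z \<in> W"
  shows "D3 (c *\<^sub>R u) (d *\<^sub>R v) w z = (c * d) *\<^sub>R D3 u v w z"
proof -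
  have "((\<lambda>y. (c * d) *\<^sub>R D2 u v y) has_derivative (\<lambda>w. (c * d) *\<^sub>R D3 u v w z)) (at z)"
    by (intro has_derivative_scaleR_right has_derivative_D2 z)
  then have "(D2 (c *\<^sub>R u) (d *\<^sub>R v) has_derivative (\<lambda>w. (c * d) *\<^sub>R D3 u v w z)) (at z)"
    by (rule has_derivative_transform_within_open[OF _ open_interior z]) (simp add: D2_linear_simps)
  then show ?thesis unfolding D3_def using frechet_derivative_at by metis
qed

lemma curve_derivatives:
  assumes p: "(p has_vector_derivative p') (at t within T)" and W: "p t \<in> W"
  shows "((\<lambda>t. ex (p t)) has_vector_derivative D1 p' (p t)) (at t within T)"
    "((\<lambda>t. D1 u (p t)) has_vector_derivative D2 u p' (p t)) (at t within T)"
    "((\<lambda>t. D2 u v (p t)) has_vector_derivative D3 u v p' (p t)) (at t within T)"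
  using has_vector_derivative_compose[OF p has_derivative_ex[OF W]]
    has_vector_derivative_compose[OF p has_derivative_D1[OF W]]
    has_vector_derivative_compose[OF p has_derivative_D2[OF W]] by auto

lemma ray_derivative: "((\<lambda>t. t *\<^sub>R x) has_vector_derivative x) (at t within T)"
  by (auto intro!: derivative_eq_intros simp: has_vector_derivative_def)

lemma line_derivative: "((\<lambda>t. z + t *\<^sub>R x) has_vector_derivative x) (at t within T)"
  by (auto intro!: derivative_eq_intros simp: has_vector_derivative_def)

lemma ex_ball: "z \<in> W \<Longrightarrow> ex z \<in> ball 0 1"
  using ex_ball_iff W_sub by blast

lemma ex_0: "ex 0 = 0"
proof -
  obtain c c' where "c 0 = 0" "\<And>t. t \<in> {0..1} \<Longrightarrow> ex (t *\<^sub>R 0) = c t"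
    using Om_geodesic[of 0] zero_W W_sub by (metis subsetD)
  then show ?thesis by (metis atLeastAtMost_iff order_refl scaleR_zero_right zero_le_one)
qed

lemma small_multiple_in_W: 
  obtains e where "e > 0" "e *\<^sub>R x \<in> W"
proof -
  obtain d where d: "d > 0" "ball 0 d \<subseteq> W"
    using zero_W open_interior open_contains_ball by blast
  have "norm x + 1 > 0" by (simp add: add_nonneg_pos)
  then have "norm ((d / (norm x + 1)) *\<^sub>R x) < d" using d(1) 
    by (simp add: divide_less_eq mult_strict_left_mono)
  then have "(d / (norm x + 1)) *\<^sub>R x \<in> W" by (intro subsetD[OF d(2)]) simp
  then show ?thesis using d(1) \<open>norm x + 1 > 0\<close> by (intro that[of "d / (norm x + 1)"]) auto
qed

lemma larger_multiple_in_W: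
  assumes "z \<in> W"
  obtains s where "s > 1" "s *\<^sub>R z \<in> W"
proof -
  have "continuous_on UNIV (\<lambda>t::real. t *\<^sub>R z)" by (intro continuous_intros)
  then have "open ((\<lambda>t::real. t *\<^sub>R z) -` W)" by (intro open_vimage open_interior)
  moreover have "1 \<in> (\<lambda>t::real. t *\<^sub>R z) -` W" using assms by simp
  ultimately obtain d where d: "d > 0" "ball 1 d \<subseteq> (\<lambda>t::real. t *\<^sub>R z) -` W"
    using open_contains_ball by blast
  then have "1 + d / 2 \<in> (\<lambda>t::real. t *\<^sub>R z) -` W" by (intro subsetD[OF d(2)]) (auto simp: dist_real_def)
  then show ?thesis using that[of "1 + d / 2"] d(1) by auto
qed

text \<open>For \<open>x\<close> in \<open>W\<close> the ray starts like the geodesic with velocity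
  \<open>P *v x\<close>, which determines the one-sided derivative at 0; otherwise a small multiple
  of \<open>x\<close> is taken and linearity scales back.\<close>

lemma D1_at_0: "D1 x 0 = P *v x"
proof -
  have *: "D1 x 0 = P *v x" if x: "x \<in> W" for x
  proof -
    obtain c c' where geo: "geodesic_on (cball 0 1) g 1 c c'" and c: "c' 0 = P *v x"
      and exc: "\<And>t. t \<in> {0..1} \<Longrightarrow> ex (t *\<^sub>R x) = c t"
      using Om_geodesic[of x] x W_sub by (metis subsetD)
    have "(c has_vector_derivative c' 0) (at 0 within {0..1})" using geo by (simp add: geodesic_on_def)
    then have 1: "((\<lambda>t. ex (t *\<^sub>R x)) has_vector_derivative P *v x) (at 0 within {0..1})"
      unfolding c by (rule has_vector_derivative_transform[rotated 2]) (use exc in auto)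
    have 2: "((\<lambda>t. ex (t *\<^sub>R x)) has_vector_derivative D1 x 0) (at 0 within {0..1})"
      using curve_derivatives(1)[OF ray_derivative, of 0 x] zero_W by simp
    show ?thesis
      using vector_derivative_unique_within_closed_interval[of 0 1 0, OF _ _ 2[unfolded box_real[symmetric]] 1[unfolded box_real[symmetric]]] by simp
  qed
  obtain e where e: "e > 0" "e *\<^sub>R x \<in> W" using small_multiple_in_W .
  have "e *\<^sub>R D1 x 0 = e *\<^sub>R (P *v x)"
    using *[OF e(2)] by (simp add: D1_linear_simps[OF zero_W] matrix_vector_mult_scaleR)
  then show ?thesis using e(1) by simp
qed

text \<open>\<open>D1 x\<close> and \<open>D2 x x\<close> are the velocity and acceleration of the
  curve t \<mapsto> ex (t x), which is a geodesic; uniqueness of derivatives transfers its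
  equation.\<close>

lemma ray_equation:
  assumes x: "x \<in> Om" and t: "0 < t" "t < 1"
  shows "D2 x x (t *\<^sub>R x) = - B.gam (ex (t *\<^sub>R x)) (D1 x (t *\<^sub>R x)) (D1 x (t *\<^sub>R x))"
proof -
  obtain c c' where geo: "geodesic_on (cball 0 1) g 1 c c'"
    and exc: "\<And>t. t \<in> {0..1} \<Longrightarrow> ex (t *\<^sub>R x) = c t"
    using Om_geodesic[OF x] by metis
  have W: "s *\<^sub>R x \<in> W" if "s \<in> {0<..<1}" for s using Om_star[OF x, of s] that by auto
  have "at s within {0..1} = at s" if "s \<in> {0<..<1}" for s :: real using that by (intro at_within_Icc_at) auto
  moreover have "(c has_vector_derivative c' s) (at s within {0..1})"
    "(c' has_vector_derivative - B.gam (c s) (c' s) (c' s)) (at s within {0..1})" if "s \<in> {0<..<1}" for s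
    using geo that unfolding geodesic_on_def B.gam_def by auto
  ultimately have dc: "(c has_vector_derivative c' s) (at s)"
    and dc': "(c' has_vector_derivative - B.gam (c s) (c' s) (c' s)) (at s)" if "s \<in> {0<..<1}" for s
    using that by force+
  have c'eq: "c' s = D1 x (s *\<^sub>R x)" if s: "s \<in> {0<..<1}" for s
  proof -
    have "((\<lambda>t. ex (t *\<^sub>R x)) has_vector_derivative c' s) (at s)"
      by (rule has_vector_derivative_transform_within_open[OF dc[OF s] _ s]) (use exc in auto)
    then show ?thesis using curve_derivatives(1)[OF ray_derivative W[OF s]] vector_derivative_unique_at by blast
  qed
  have s: "t \<in> {0<..<1}" using t by simp
  have "((\<lambda>t. D1 x (t *\<^sub>R x)) has_vector_derivative - B.gam (c t) (c' t) (c' t)) (at t)"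
    by (rule has_vector_derivative_transform_within_open[OF dc'[OF s] _ s]) (use c'eq in auto)
  then have "D2 x x (t *\<^sub>R x) = - B.gam (c t) (c' t) (c' t)"
    using curve_derivatives(2)[OF ray_derivative W[OF s]] vector_derivative_unique_at by blast
  then show ?thesis using c'eq[OF s] exc[of t] t by simp
qed

text \<open>The geodesic equation of all rays at once, as a differential equation for \<open>ex\<close> on \<open>W\<close>.\<close>

lemma geodesic_pde:
  assumes z: "z \<in> W"
  shows "D2 z z z + B.gam (ex z) (D1 z z) (D1 z z) = 0"
proof -
  \<comment> \<open>The ray is prolonged beyond \<open>z\<close>, because
    \<open>ray_equation\<close> speaks of times below 1: \<open>z\<close> is the point at time 1 / s
    on the ray through s z, and homogeneity of degree two produces the factor s * s.\<close>
  obtain s where s: "s > 1" "s *\<^sub>R z \<in> W" using larger_multiple_in_W[OF z] .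
  then have "s *\<^sub>R z \<in> Om" using W_sub by blast
  from ray_equation[OF this, of "1 / s"] s(1)
  have "(s * s) *\<^sub>R D2 z z z = - ((s * s) *\<^sub>R B.gam (ex z) (D1 z z) (D1 z z))"
    by (simp add: D2_linear_simps[OF z] D1_linear_simps[OF z] B.gam_scale_left B.gam_scale_right)
  then have "(s * s) *\<^sub>R (D2 z z z + B.gam (ex z) (D1 z z) (D1 z z)) = 0" by (simp add: scaleR_add_right)
  then show ?thesis using s(1) by simp
qed

lemma line_in_W:
  assumes z: "z \<in> W"
  obtains d where "d > 0" "\<And>s. s \<in> {- d<..<d} \<Longrightarrow> z + s *\<^sub>R w \<in> W"
proof -
  have "continuous_on UNIV (\<lambda>t::real. z + t *\<^sub>R w)" by (intro continuous_intros)
  then have "open ((\<lambda>t::real. z + t *\<^sub>R w) -` W)" by (intro open_vimage open_interior)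
  moreover have "0 \<in> (\<lambda>t::real. z + t *\<^sub>R w) -` W" using z by simp
  ultimately obtain d where d: "d > 0" "ball 0 d \<subseteq> (\<lambda>t::real. z + t *\<^sub>R w) -` W"
    using open_contains_ball by blast
  have "z + s *\<^sub>R w \<in> W" if "s \<in> {- d<..<d}" for s
    using subsetD[OF d(2), of s] that by (auto simp: dist_real_def abs_less_iff)
  then show ?thesis using that d(1) by blast
qed

lemma line_D1:
  assumes z: "z \<in> W"
  shows "((\<lambda>s. D1 (z + s *\<^sub>R w) (z + s *\<^sub>R w)) has_vector_derivative D2 z w z + D1 w z) (at 0)"
proof -
  obtain d where d: "d > 0" "\<And>s. s \<in> {- d<..<d} \<Longrightarrow> z + s *\<^sub>R w \<in> W" using line_in_W[OF z] by blast
  have W0: "z + 0 *\<^sub>R w \<in> W" using z by simp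
  have "((\<lambda>s. D1 z (z + s *\<^sub>R w) + s *\<^sub>R D1 w (z + s *\<^sub>R w)) has_vector_derivative
      D2 z w (z + 0 *\<^sub>R w) + (0 *\<^sub>R D2 w w (z + 0 *\<^sub>R w) + 1 *\<^sub>R D1 w (z + 0 *\<^sub>R w))) (at 0)"
    by (intro has_vector_derivative_add has_vector_derivative_scaleR DERIV_ident
        curve_derivatives(2)[OF line_derivative W0])
  then have "((\<lambda>s. D1 z (z + s *\<^sub>R w) + s *\<^sub>R D1 w (z + s *\<^sub>R w)) has_vector_derivative D2 z w z + D1 w z) (at 0)"
    by simp
  then show ?thesis
    by (rule has_vector_derivative_transform_within_open[of _ _ _ "{- d<..<d}"]) (use d in \<open>auto simp: D1_linear_simps\<close>)
qed

text \<open>\<open>geodesic_pde\<close> holds at every point of \<open>W\<close>, so it may be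
  differentiated in the direction \<open>w\<close>. The point and the radial direction both move
  with it; the second movement yields the terms \<open>2 *\<^sub>R D2 z w z\<close> and
  \<open>D1 w z\<close>.\<close>

lemma geodesic_pde_derivative:
  assumes z: "z \<in> W"
  shows "D3 z z w z + 2 *\<^sub>R D2 z w z + B.dgam (ex z) (D1 w z) (D1 z z) (D1 z z)
     + 2 *\<^sub>R B.gam (ex z) (D1 z z) (D2 z w z + D1 w z) = 0"
proof -
  obtain d where d: "d > 0" "\<And>s. s \<in> {- d<..<d} \<Longrightarrow> z + s *\<^sub>R w \<in> W" using line_in_W[OF z] by blast
  have W0: "z + 0 *\<^sub>R w \<in> W" using z by simp
  let ?p = "\<lambda>s. z + s *\<^sub>R w"
  let ?Y' = "D2 z w z + D1 w z"
  have Y: "((\<lambda>s. D1 (?p s) (?p s)) has_vector_derivative ?Y') (at 0)" by (rule line_D1[OF z])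
  have e: "((\<lambda>s. ex (?p s)) has_vector_derivative D1 w z) (at 0)"
    using curve_derivatives(1)[OF line_derivative W0] by simp
  have 1: "((\<lambda>s. B.gam (ex (?p s)) (D1 (?p s) (?p s)) (D1 (?p s) (?p s))) has_vector_derivative
     B.dgam (ex z) (D1 w z) (D1 z z) (D1 z z) + B.gam (ex z) ?Y' (D1 z z) + B.gam (ex z) (D1 z z) ?Y') (at 0)"
    using B.gam_derivative[OF e _ Y Y] ex_ball[OF z] by simp
  have sq: "((\<lambda>s::real. s * s) has_real_derivative 0) (at 0)" by (auto intro!: derivative_eq_intros)
  have D2': "((\<lambda>s. D2 z z (?p s) + s *\<^sub>R (D2 z w (?p s) + D2 z w (?p s)) + (s * s) *\<^sub>R D2 w w (?p s)) has_vector_derivative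
     D3 z z w (?p 0) + (0 *\<^sub>R (D3 z w w (?p 0) + D3 z w w (?p 0)) + 1 *\<^sub>R (D2 z w (?p 0) + D2 z w (?p 0))) + ((0 * 0) *\<^sub>R D3 w w w (?p 0) + 0 *\<^sub>R D2 w w (?p 0))) (at 0)"
    by (intro has_vector_derivative_add has_vector_derivative_scaleR DERIV_ident sq
        curve_derivatives(3)[OF line_derivative W0])
  have D2'': "((\<lambda>s. D2 z z (?p s) + s *\<^sub>R (D2 z w (?p s) + D2 z w (?p s)) + (s * s) *\<^sub>R D2 w w (?p s)) has_vector_derivative
     D3 z z w z + (D2 z w z + D2 z w z)) (at 0)"
    using D2' by simp
  have 2: "((\<lambda>s. D2 (?p s) (?p s) (?p s)) has_vector_derivative D3 z z w z + (D2 z w z + D2 z w z)) (at 0)"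
    by (rule has_vector_derivative_transform_within_open[of _ _ _ "{- d<..<d}", OF D2''])
       (use d in \<open>auto simp: D2_linear_simps D2_commute[of _ w z] scaleR_add_right\<close>)
  have "((\<lambda>s. D2 (?p s) (?p s) (?p s) + B.gam (ex (?p s)) (D1 (?p s) (?p s)) (D1 (?p s) (?p s))) has_vector_derivative
     (D3 z z w z + (D2 z w z + D2 z w z)) + (B.dgam (ex z) (D1 w z) (D1 z z) (D1 z z) + B.gam (ex z) ?Y' (D1 z z) + B.gam (ex z) (D1 z z) ?Y')) (at 0)"
    by (intro has_vector_derivative_add 1 2)
  moreover have "((\<lambda>s. D2 (?p s) (?p s) (?p s) + B.gam (ex (?p s)) (D1 (?p s) (?p s)) (D1 (?p s) (?p s))) has_vector_derivative 0) (at 0)"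
    by (rule has_vector_derivative_transform_within_open[of "\<lambda>_. 0" _ _ "{- d<..<d}"]) (use d geodesic_pde in auto)
  ultimately have "(D3 z z w z + (D2 z w z + D2 z w z)) + (B.dgam (ex z) (D1 w z) (D1 z z) (D1 z z) + B.gam (ex z) ?Y' (D1 z z) + B.gam (ex z) (D1 z z) ?Y') = 0"
    by (rule vector_derivative_unique_at)
  then show ?thesis
    using B.gam_commute[OF ex_ball[OF z], of ?Y' "D1 z z"] by (simp add: scaleR_2 add_ac)
qed

text \<open>The speed is constant along the ray, and at the center \<open>P_inner\<close> gives its
  Euclidean value.\<close>

lemma speed:
  assumes z: "z \<in> W"
  shows "D1 z z \<bullet> (g (ex z) *v D1 z z) = z \<bullet> z"
proof -
  have Om: "z \<in> Om" using z W_sub by blast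
  have W: "t *\<^sub>R z \<in> W" if "0 \<le> t" "t \<le> 1" for t
    using Om_star[OF Om, of t] z that by (cases "t = 1") auto
  define e where "e = (\<lambda>t. D1 z (t *\<^sub>R z) \<bullet> (g (ex (t *\<^sub>R z)) *v D1 z (t *\<^sub>R z)))"
  have de: "(e has_vector_derivative (D2 z z (t *\<^sub>R z) + B.gam (ex (t *\<^sub>R z)) (D1 z (t *\<^sub>R z)) (D1 z (t *\<^sub>R z))) \<bullet> (g (ex (t *\<^sub>R z)) *v D1 z (t *\<^sub>R z))
      + D1 z (t *\<^sub>R z) \<bullet> (g (ex (t *\<^sub>R z)) *v (D2 z z (t *\<^sub>R z) + B.gam (ex (t *\<^sub>R z)) (D1 z (t *\<^sub>R z)) (D1 z (t *\<^sub>R z))))) (at t)"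
    if t: "0 \<le> t" "t \<le> 1" for t
    unfolding e_def
    by (rule B.metric_inner_derivative[OF curve_derivatives(1)[OF ray_derivative W[OF t]] ex_ball[OF W[OF t]]
          curve_derivatives(2)[OF ray_derivative W[OF t]] curve_derivatives(2)[OF ray_derivative W[OF t]]])
  have "e 1 = e 0"
  proof (rule DERIV_isconst_end[of 0 1 e])
    show "continuous_on {0..1} e"
      by (intro continuous_at_imp_continuous_on ballI has_vector_derivative_continuous[OF de]) auto
    show "(e has_real_derivative 0) (at t)" if "0 < t" "t < 1" for t
      using de[of t] that ray_equation[OF Om that]
      by (simp add: has_real_derivative_iff_has_vector_derivative)
  qed simp
  then show ?thesis using P_inner[of z z] by (simp add: e_def D1_at_0 ex_0)
qed

text \<open>The derivative of \<open>speed\<close> in the direction \<open>w\<close>. It gives the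
  rate of change of the inner product between velocity and Jacobi field in
  \<open>gauss_lemma\<close>.\<close>

lemma speed_derivative:
  assumes z: "z \<in> W"
  shows "D1 z z \<bullet> (g (ex z) *v (D2 z w z + D1 w z + B.gam (ex z) (D1 w z) (D1 z z))) = z \<bullet> w"
proof -
  obtain d where d: "d > 0" "\<And>s. s \<in> {- d<..<d} \<Longrightarrow> z + s *\<^sub>R w \<in> W" using line_in_W[OF z] by blast
  have W0: "z + 0 *\<^sub>R w \<in> W" using z by simp
  let ?p = "\<lambda>s. z + s *\<^sub>R w"
  let ?K = "D2 z w z + D1 w z + B.gam (ex z) (D1 w z) (D1 z z)"
  have e: "((\<lambda>s. ex (?p s)) has_vector_derivative D1 w z) (at 0)"
    using curve_derivatives(1)[OF line_derivative W0] by simp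
  have "((\<lambda>s. D1 (?p s) (?p s) \<bullet> (g (ex (?p s)) *v D1 (?p s) (?p s))) has_vector_derivative
     ?K \<bullet> (g (ex z) *v D1 z z) + D1 z z \<bullet> (g (ex z) *v ?K)) (at 0)"
    using B.metric_inner_derivative[OF e _ line_D1[OF z] line_D1[OF z]] ex_ball[OF z] by simp
  moreover have "((\<lambda>s. D1 (?p s) (?p s) \<bullet> (g (ex (?p s)) *v D1 (?p s) (?p s))) has_vector_derivative 2 * (z \<bullet> w)) (at 0)"
  proof (rule has_vector_derivative_transform_within_open[of "\<lambda>s. ?p s \<bullet> ?p s" _ _ "{- d<..<d}"])
    show "((\<lambda>s. ?p s \<bullet> ?p s) has_vector_derivative 2 * (z \<bullet> w)) (at 0)"
      using bounded_bilinear.has_vector_derivative[OF bounded_bilinear_inner line_derivative[of z w 0 UNIV] line_derivative[of z w 0 UNIV]]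
      by (simp add: inner_commute)
  qed (use d speed in auto)
  ultimately have "?K \<bullet> (g (ex z) *v D1 z z) + D1 z z \<bullet> (g (ex z) *v ?K) = 2 * (z \<bullet> w)"
    by (rule vector_derivative_unique_at)
  moreover have "?K \<bullet> (g (ex z) *v D1 z z) = D1 z z \<bullet> (g (ex z) *v ?K)"
    using symmetric_dot_swap[OF B.sym_g[OF ex_ball[OF z]], of "D1 z z" ?K] by (simp add: inner_commute)
  ultimately show ?thesis by simp
qed

lemma jacobi_first_derivative:
  assumes W: "t *\<^sub>R x \<in> W"
  shows "((\<lambda>t. t *\<^sub>R D1 w (t *\<^sub>R x)) has_vector_derivative D1 w (t *\<^sub>R x) + t *\<^sub>R D2 w x (t *\<^sub>R x)) (at t)"
  using has_vector_derivative_scaleR[OF DERIV_ident curve_derivatives(2)[OF ray_derivative W, where u=w]]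
  by (simp add: add.commute)

text \<open>The inner product of the velocity with the Jacobi field t \<open>D1 w (t z)\<close>
  vanishes at t = 0, and by \<open>ray_equation\<close> and \<open>speed_derivative\<close> its
  derivative is the constant z . w.\<close>

lemma gauss_lemma:
  assumes z: "z \<in> W"
  shows "D1 z z \<bullet> (g (ex z) *v D1 w z) = z \<bullet> w"
proof -
  have Om: "z \<in> Om" using z W_sub by blast
  have W: "t *\<^sub>R z \<in> W" if "0 \<le> t" "t \<le> 1" for t
    using Om_star[OF Om, of t] z that by (cases "t = 1") auto
  define q where "q = (\<lambda>t. D1 z (t *\<^sub>R z) \<bullet> (g (ex (t *\<^sub>R z)) *v (t *\<^sub>R D1 w (t *\<^sub>R z))) - t * (z \<bullet> w))"
  have dq: "(q has_vector_derivative (D2 z z (t *\<^sub>R z) + B.gam (ex (t *\<^sub>R z)) (D1 z (t *\<^sub>R z)) (D1 z (t *\<^sub>R z))) \<bullet> (g (ex (t *\<^sub>R z)) *v (t *\<^sub>R D1 w (t *\<^sub>R z)))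
      + D1 z (t *\<^sub>R z) \<bullet> (g (ex (t *\<^sub>R z)) *v (D1 w (t *\<^sub>R z) + t *\<^sub>R D2 w z (t *\<^sub>R z) + B.gam (ex (t *\<^sub>R z)) (D1 z (t *\<^sub>R z)) (t *\<^sub>R D1 w (t *\<^sub>R z)))) - z \<bullet> w) (at t)"
    if t: "0 \<le> t" "t \<le> 1" for t
    unfolding q_def
    by (intro has_vector_derivative_diff B.metric_inner_derivative[OF curve_derivatives(1)[OF ray_derivative W[OF t]] ex_ball[OF W[OF t]]
          curve_derivatives(2)[OF ray_derivative W[OF t]] jacobi_first_derivative[OF W[OF t]]])
       (auto intro!: derivative_eq_intros simp: has_real_derivative_iff_has_vector_derivative[symmetric])
  have "q 1 = q 0"
  proof (rule DERIV_isconst_end[of 0 1 q])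
    show "continuous_on {0..1} q"
      by (intro continuous_at_imp_continuous_on ballI has_vector_derivative_continuous[OF dq]) auto
    show "(q has_real_derivative 0) (at t)" if t: "0 < t" "t < 1" for t
    proof -
      have Wt: "t *\<^sub>R z \<in> W" using W[of t] t by simp
      have "t * (D1 z (t *\<^sub>R z) \<bullet> (g (ex (t *\<^sub>R z)) *v (D1 w (t *\<^sub>R z) + t *\<^sub>R D2 w z (t *\<^sub>R z) + B.gam (ex (t *\<^sub>R z)) (D1 z (t *\<^sub>R z)) (t *\<^sub>R D1 w (t *\<^sub>R z))))) = t * (z \<bullet> w)"
        using speed_derivative[OF Wt, of w] D2_commute[OF Wt, of z w]
          B.gam_commute[OF ex_ball[OF Wt], of "D1 z (t *\<^sub>R z)" "D1 w (t *\<^sub>R z)"]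
        by (simp add: D1_linear_simps[OF Wt] D2_linear_simps[OF Wt] B.gam_scale_left B.gam_scale_right add_ac)
      then show ?thesis using dq[of t] t ray_equation[OF Om t]
        by (simp add: has_real_derivative_iff_has_vector_derivative)
    qed
  qed simp
  then show ?thesis by (simp add: q_def)
qed

text \<open>The variation t \<mapsto> ex (t (x + s w)) has the variation field J(t) = t
  \<open>D1 w (t x)\<close>. Its equation is \<open>geodesic_pde_derivative\<close> at the point t
  x, from which one factor t cancels; the right side has the form required by
  \<open>jacobi_derivative\<close>.\<close>

lemma jacobi_second_derivative:
  assumes x: "x \<in> Om" and t: "0 < t" "t < 1"
  shows "((\<lambda>t. D1 w (t *\<^sub>R x) + t *\<^sub>R D2 w x (t *\<^sub>R x)) has_vector_derivative
    - B.dgam (ex (t *\<^sub>R x)) (t *\<^sub>R D1 w (t *\<^sub>R x)) (D1 x (t *\<^sub>R x)) (D1 x (t *\<^sub>R x))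
    - 2 *\<^sub>R B.gam (ex (t *\<^sub>R x)) (D1 x (t *\<^sub>R x)) (D1 w (t *\<^sub>R x) + t *\<^sub>R D2 w x (t *\<^sub>R x))) (at t)"
proof -
  have W: "t *\<^sub>R x \<in> W" using Om_star[OF x] t by simp
  let ?z = "t *\<^sub>R x"
  have d: "((\<lambda>t. D1 w (t *\<^sub>R x) + t *\<^sub>R D2 w x (t *\<^sub>R x)) has_vector_derivative
      D2 w x ?z + (t *\<^sub>R D3 w x x ?z + 1 *\<^sub>R D2 w x ?z)) (at t)"
    by (intro has_vector_derivative_add has_vector_derivative_scaleR DERIV_ident
        curve_derivatives(2)[OF ray_derivative W] curve_derivatives(3)[OF ray_derivative W])
  have D3: "D3 w x x ?z = D3 x x w ?z" using D3_commute[OF W] by metis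
  have "(t * t) *\<^sub>R D3 x x w ?z + (2 * t) *\<^sub>R D2 x w ?z + (t * t) *\<^sub>R B.dgam (ex ?z) (D1 w ?z) (D1 x ?z) (D1 x ?z)
     + (2 * t) *\<^sub>R B.gam (ex ?z) (D1 x ?z) (t *\<^sub>R D2 x w ?z + D1 w ?z) = 0"
    using geodesic_pde_derivative[OF W, of w]
    by (simp add: D3_scale[OF W] D2_linear_simps[OF W] D1_linear_simps[OF W] B.dgam_scale B.gam_scale_left)
  then have "t *\<^sub>R (t *\<^sub>R D3 x x w ?z + 2 *\<^sub>R D2 x w ?z + t *\<^sub>R B.dgam (ex ?z) (D1 w ?z) (D1 x ?z) (D1 x ?z)
     + 2 *\<^sub>R B.gam (ex ?z) (D1 x ?z) (t *\<^sub>R D2 x w ?z + D1 w ?z)) = 0"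
    by (simp add: scaleR_add_right mult.commute)
  then have "t *\<^sub>R D3 x x w ?z + 2 *\<^sub>R D2 x w ?z + t *\<^sub>R B.dgam (ex ?z) (D1 w ?z) (D1 x ?z) (D1 x ?z)
     + 2 *\<^sub>R B.gam (ex ?z) (D1 x ?z) (t *\<^sub>R D2 x w ?z + D1 w ?z) = 0"
    using t(1) by simp
  then have "D2 w x ?z + (t *\<^sub>R D3 w x x ?z + 1 *\<^sub>R D2 w x ?z) = 
    - B.dgam (ex ?z) (t *\<^sub>R D1 w ?z) (D1 x ?z) (D1 x ?z) - 2 *\<^sub>R B.gam (ex ?z) (D1 x ?z) (D1 w ?z + t *\<^sub>R D2 w x ?z)"
    unfolding D3 B.dgam_scale_dir[OF ex_ball[OF W]] D2_commute[OF W, of w x] add.commute[of "D1 w ?z"] scaleR_2 scaleR_one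
    by (simp add: eq_neg_iff_add_eq_0 algebra_simps)
  with d show ?thesis by metis
qed

text \<open>Since \<open>w\<close> is orthogonal to \<open>x\<close>, the Gauss lemma makes J
  orthogonal to the velocity, whose squared length is |x|^2. The curvature bound then yields the
  Sturm hypotheses with \<kappa> = - k |x|^2, whose model solution is
  \<open>s_model k (norm x * t)\<close>.\<close>

lemma rauch_comparison:
  assumes x: "x \<in> Om" "x \<noteq> 0" and w: "w \<bullet> x = 0" and k: "k \<le> 0" and st: "0 < s" "s \<le> t" "t < 1"
  defines "Q \<equiv> \<lambda>t. (t *\<^sub>R D1 w (t *\<^sub>R x)) \<bullet> (g (ex (t *\<^sub>R x)) *v (t *\<^sub>R D1 w (t *\<^sub>R x)))"
  shows "Q s / (s_model k (norm x * s))\<^sup>2 \<le> Q t / (s_model k (norm x * t))\<^sup>2"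
\<comment> \<open>The Sturm argument divides by the length of J, which is positive at interior times
  exactly when \<open>w\<close> is nonzero.\<close>
proof (cases "w = 0")
  case True
  have "D1 0 z = 0" if "z \<in> W" for z using linear_0[OF linear_D1[OF that]] .
  then have "Q s = 0" "Q t = 0" using True st Om_star[OF x(1)] by (auto simp: Q_def)
  then show ?thesis by simp
next
  case False
  have W: "t *\<^sub>R x \<in> W" if "0 \<le> t" "t < 1" for t using Om_star[OF x(1)] that by simp
  define c where "c = (\<lambda>t. ex (t *\<^sub>R x))"
  define c' where "c' = (\<lambda>t. D1 x (t *\<^sub>R x))"
  define J where "J = (\<lambda>t. t *\<^sub>R D1 w (t *\<^sub>R x))"
  define J' where "J' = (\<lambda>t. D1 w (t *\<^sub>R x) + t *\<^sub>R D2 w x (t *\<^sub>R x))"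
  define K where "K = (\<lambda>t. J' t + B.gam (c t) (c' t) (J t))"
  define N where "N = (\<lambda>t. K t \<bullet> (g (c t) *v K t))"
  define A where "A = (\<lambda>t. J t \<bullet> (g (c t) *v K t))"
  define A' where "A' = (\<lambda>t. N t - J t \<bullet> (g (c t) *v riem_curv (cball 0 1) g (c t) (J t) (c' t) (c' t)))"
  have Qeq: "Q = (\<lambda>t. J t \<bullet> (g (c t) *v J t))" by (simp add: Q_def J_def c_def)
  have cb: "c t \<in> ball 0 1" if "0 \<le> t" "t < 1" for t unfolding c_def by (rule ex_ball[OF W[OF that]])
  have dc: "(c has_vector_derivative c' t) (at t)" if "0 \<le> t" "t < 1" for t
    unfolding c_def c'_def by (rule curve_derivatives(1)[OF ray_derivative W[OF that]])
  have dc1: "(c' has_vector_derivative D2 x x (t *\<^sub>R x)) (at t)" if "0 \<le> t" "t < 1" for t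
    unfolding c_def c'_def by (rule curve_derivatives(2)[OF ray_derivative W[OF that]])
  have dc': "(c' has_vector_derivative - B.gam (c t) (c' t) (c' t)) (at t)" if "0 < t" "t < 1" for t
    using dc1[of t] ray_equation[OF x(1) that] that by (simp add: c_def c'_def)
  have dJ: "(J has_vector_derivative J' t) (at t)" if "0 \<le> t" "t < 1" for t
    unfolding J_def J'_def by (rule jacobi_first_derivative[OF W[OF that]])
  have dJ': "(J' has_vector_derivative - B.dgam (c t) (J t) (c' t) (c' t) - 2 *\<^sub>R B.gam (c t) (c' t) (J' t)) (at t)"
    if "0 < t" "t < 1" for t
    unfolding J_def J'_def c_def c'_def by (rule jacobi_second_derivative[OF x(1) that])
  have J0: "J t \<noteq> 0" if "0 < t" "t < 1" for t
    using ex_derivative_inj[OF W, of t w] that False by (auto simp: J_def D1_def)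
  have cc: "c' t \<bullet> (g (c t) *v c' t) = (norm x)\<^sup>2" if "0 < t" "t < 1" for t
  proof -
    have Wt: "t *\<^sub>R x \<in> W" using W that by simp
    have "(t * t) * (c' t \<bullet> (g (c t) *v c' t)) = (t * t) * (x \<bullet> x)"
      using speed[OF Wt] by (simp add: D1_linear_simps[OF Wt] c_def c'_def matrix_vector_mult_scaleR)
    then show ?thesis using that by (simp add: power2_norm_eq_inner)
  qed
  have Jc: "J t \<bullet> (g (c t) *v c' t) = 0" if "0 < t" "t < 1" for t
  proof -
    have Wt: "t *\<^sub>R x \<in> W" using W that by simp
    have "t * (c' t \<bullet> (g (c t) *v D1 w (t *\<^sub>R x))) = 0"
      using gauss_lemma[OF Wt, of w] w by (simp add: D1_linear_simps[OF Wt] c_def c'_def inner_commute)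
    then have "c' t \<bullet> (g (c t) *v J t) = 0" by (simp add: J_def matrix_vector_mult_scaleR)
    then show ?thesis using symmetric_dot_swap[OF B.sym_g[OF cb[of t]], of "J t" "c' t"] that by (simp add: inner_commute)
  qed
  show ?thesis
  proof (rule sturm_comparison[where Q=Q and A=A and A'=A' and N=N and \<kappa>="- k * (norm x)\<^sup>2" and L="N 0"
        and \<sigma>="\<lambda>t. s_model k (norm x * t)" and \<sigma>'="\<lambda>t. norm x * c_model k (norm x * t)", OF _ _ _ _ _ _ _ _ _ _ _ st])
    fix t :: real assume t: "0 < t" "t < 1"
    show "0 < Q t" unfolding Qeq using B.pos_g[OF cb J0] t by simp
    have cW: "c t \<in> ball 0 1" and c0: "(c has_vector_derivative c' t) (at t)" and j0: "(J has_vector_derivative J' t) (at t)"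
      using cb dc dJ t by auto
    show "(Q has_real_derivative 2 * A t) (at t)"
      using B.jacobi_derivative(1)[OF cW c0 dc'[OF t] j0 dJ'[OF t]]
      by (simp add: Qeq A_def K_def has_real_derivative_iff_has_vector_derivative)
    show "(A has_real_derivative A' t) (at t)"
      using B.jacobi_derivative(2)[OF cW c0 dc'[OF t] j0 dJ'[OF t]]
      by (simp add: A_def A'_def N_def K_def has_real_derivative_iff_has_vector_derivative)
    have c'0: "c' t \<noteq> 0" using cc[OF t] x(2) by auto
    have "J t \<bullet> (g (c t) *v riem_curv (cball 0 1) g (c t) (J t) (c' t) (c' t)) \<le> k * (Q t * (norm x)\<^sup>2)"
      using curvature_bound[OF cW J0[OF t] c'0 Jc[OF t]] by (simp add: cc[OF t] Qeq)
    then show "N t + - k * (norm x)\<^sup>2 * Q t \<le> A' t" by (simp add: A'_def mult_ac)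
    show "(A t)\<^sup>2 \<le> N t * Q t"
      using pos_def_cauchy_schwarz[OF B.pos_def_g[OF cW], of "J t" "K t"]
      by (simp add: A_def N_def Qeq mult.commute)
  next
    \<comment> \<open>Continuity of N at 0 is obtained from differentiability of K there, which
      needs \<open>D2\<close> and \<open>D3\<close> at the center but no geodesic equation.\<close>
    have k0: "(K has_vector_derivative k') (at 0) \<Longrightarrow> (N \<longlongrightarrow> N 0) (at_right 0)" for k'
      using has_vector_derivative_continuous[OF B.metric_inner_derivative[OF dc[of 0] cb[of 0], of K k' K k']]
      by (auto simp: N_def continuous_at intro: filterlim_at_split[THEN iffD1, THEN conjunct2])
    have W0: "0 *\<^sub>R x \<in> W" using zero_W by simp
    have "(J' has_vector_derivative D2 w x (0 *\<^sub>R x) + (0 *\<^sub>R D3 w x x (0 *\<^sub>R x) + 1 *\<^sub>R D2 w x (0 *\<^sub>R x))) (at 0)"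
      unfolding J'_def
      by (intro has_vector_derivative_add has_vector_derivative_scaleR DERIV_ident
        curve_derivatives(2)[OF ray_derivative W0] curve_derivatives(3)[OF ray_derivative W0])
    from has_vector_derivative_add[OF this B.gam_derivative[OF dc[of 0] cb[of 0] dc1[of 0] dJ[of 0]]]
    show "(N \<longlongrightarrow> N 0) (at_right 0)" unfolding K_def[symmetric] by (intro k0) auto
    have "J 0 = 0" by (simp add: J_def)
    then have "Q 0 = 0" by (simp add: Qeq)
    moreover have "continuous (at 0) Q"
      using has_vector_derivative_continuous[OF B.metric_inner_derivative[OF dc[of 0] cb[of 0] dJ[of 0] dJ[of 0]]]
      by (simp add: Qeq)
    ultimately show "(Q \<longlongrightarrow> 0) (at_right 0)"
      by (auto simp: continuous_at intro: filterlim_at_split[THEN iffD1, THEN conjunct2])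
  qed (use s_model_derivative[OF k] s_model_pos[OF k] x(2) in auto)
qed

lemma gbar_W:
  assumes z: "z \<in> W"
  shows "u \<bullet> (gbar g z *v v) = D1 u z \<bullet> (g (ex z) *v D1 v z)"
proof -
  have a: "at z within Om = at z" using z by (rule at_within_interior)
  have J: "matrix (frechet_derivative ex (at z)) *v u = D1 u z" for u
    using linear_D1[OF z] by (simp add: D1_def matrix_works)
  have "gbar g z = transpose (matrix (frechet_derivative ex (at z))) ** g (ex z) ** matrix (frechet_derivative ex (at z))"
    unfolding gbar_def pullback_metric_def Let_def jacobian_def a by (rule refl)
  then show ?thesis by (simp only: bilinear_form_congruence J)
qed

end

section \<open>The radial function\<close>

text \<open>An implicit function theorem along rays for a continuous solution \<open>F\<close> of H
  (F x x) = 0. Formal differentiation gives L (dF(w) x0 + F(x0) w) = 0, which is solvable because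
  \<open>L x0\<close> is nonzero. To justify it, a coarse linearization first yields a Lipschitz
  bound for \<open>F\<close> at \<open>x0\<close>, which then feeds a fine one.\<close>

lemma implicit_scaling_derivative:
  fixes F H :: "'a::euclidean_space \<Rightarrow> real"
  assumes F: "isCont F x0" and H: "(H has_derivative L) (at (F x0 *\<^sub>R x0))"
    and S: "open S" "x0 \<in> S" and zero: "\<And>x. x \<in> S \<Longrightarrow> H (F x *\<^sub>R x) = 0" and a: "L x0 \<noteq> 0"
  shows "(F has_derivative (\<lambda>w. - (F x0 * L w / L x0))) (at x0)"
proof -
  let ?p = "F x0 *\<^sub>R x0"
  have bl: "bounded_linear L" using H by (rule has_derivative_bounded_linear)
  then obtain B where B: "B > 0" "\<And>v. \<bar>L v\<bar> \<le> norm v * B"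
    using bounded_linear.pos_bounded by (metis real_norm_def)
  define M where "M = \<bar>F x0\<bar> + 1"
  \<comment> \<open>Since \<open>e1 * norm x0\<close> is at most half of |L x0|, the part of the
    error proportional to |F x - F x0| is absorbed on the left; \<open>C\<close> is the Lipschitz
    constant that results.\<close>
  define e1 where "e1 = \<bar>L x0\<bar> / (2 * (norm x0 + 1))"
  define C where "C = 2 * (M * (B + e1)) / \<bar>L x0\<bar>"
  have e1: "e1 > 0" using a by (simp add: e1_def add_nonneg_pos)
  have M: "M > 0" by (simp add: M_def)
  have C: "C \<ge> 0" using M B e1 by (simp add: C_def)
  have lin: "linear L" using bl bounded_linear.linear by blast
  have near: "\<exists>d>0. \<forall>x. norm (x - x0) < d \<longrightarrow> x \<in> S \<and> \<bar>F x - F x0\<bar> \<le> e2 \<and> \<bar>F x\<bar> \<le> M \<and>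
     \<bar>L (F x *\<^sub>R x - ?p)\<bar> \<le> e * norm (F x *\<^sub>R x - ?p)" if e: "e > 0" and e2: "e2 > 0" for e e2
  proof -
    obtain d1 where d1: "d1 > 0" "\<And>y. norm (y - ?p) < d1 \<Longrightarrow> norm (H y - H ?p - L (y - ?p)) \<le> e * norm (y - ?p)"
      using H e unfolding has_derivative_at_alt by metis
    have "isCont (\<lambda>x. F x *\<^sub>R x) x0" using F by (intro continuous_intros)
    then obtain d2 where d2: "d2 > 0" "\<And>x. dist x x0 < d2 \<Longrightarrow> dist (F x *\<^sub>R x) ?p < d1"
      using d1(1) unfolding continuous_at_eps_delta by metis
    obtain d3 where d3: "d3 > 0" "\<And>x. dist x x0 < d3 \<Longrightarrow> dist (F x) (F x0) < min 1 e2"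
      using F e2 unfolding continuous_at_eps_delta by (metis min_less_iff_conj zero_less_one)
    obtain d4 where d4: "d4 > 0" "ball x0 d4 \<subseteq> S" using S open_contains_ball by blast
    have "x \<in> S \<and> \<bar>F x - F x0\<bar> \<le> e2 \<and> \<bar>F x\<bar> \<le> M \<and> \<bar>L (F x *\<^sub>R x - ?p)\<bar> \<le> e * norm (F x *\<^sub>R x - ?p)"
      if x: "norm (x - x0) < min d2 (min d3 d4)" for x
    proof -
      have xS: "x \<in> S" using x d4 by (auto simp: subset_iff dist_norm norm_minus_commute)
      have "\<bar>F x - F x0\<bar> < min 1 e2" using d3(2)[of x] x by (simp add: dist_norm)
      then have f: "\<bar>F x - F x0\<bar> \<le> e2" "\<bar>F x\<bar> \<le> M" by (auto simp: M_def)
      have "norm (H (F x *\<^sub>R x) - H ?p - L (F x *\<^sub>R x - ?p)) \<le> e * norm (F x *\<^sub>R x - ?p)"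
        using d1(2) d2(2)[of x] x by (simp add: dist_norm)
      then show ?thesis using xS f zero[OF xS] zero[OF S(2)] by simp
    qed
    then show ?thesis using d2(1) d3(1) d4(1) by (intro exI[of _ "min d2 (min d3 d4)"]) auto
  qed
  have split: "L (F x *\<^sub>R x - ?p) = (F x - F x0) * L x0 + F x * L (x - x0)" for x
  proof -
    have "F x *\<^sub>R x - ?p = (F x - F x0) *\<^sub>R x0 + F x *\<^sub>R (x - x0)" by (simp add: algebra_simps)
    then show ?thesis by (simp only: linear_add[OF lin] linear_scale[OF lin] real_scaleR_def)
  qed
  have nrm: "norm (F x *\<^sub>R x - ?p) \<le> \<bar>F x - F x0\<bar> * norm x0 + \<bar>F x\<bar> * norm (x - x0)" for x
  proof -
    have "F x *\<^sub>R x - ?p = (F x - F x0) *\<^sub>R x0 + F x *\<^sub>R (x - x0)" by (simp add: algebra_simps)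
    then show ?thesis using norm_triangle_ineq[of "(F x - F x0) *\<^sub>R x0" "F x *\<^sub>R (x - x0)"] by simp
  qed
  have lipschitz: "\<bar>F x - F x0\<bar> \<le> C * norm (x - x0)"
    if FM: "\<bar>F x\<bar> \<le> M" and est: "\<bar>L (F x *\<^sub>R x - ?p)\<bar> \<le> e1 * norm (F x *\<^sub>R x - ?p)" for x
  proof -
    let ?d = "\<bar>F x - F x0\<bar>" and ?h = "norm (x - x0)"
    have "\<bar>F x * L (x - x0)\<bar> \<le> M * (?h * B)"
      unfolding abs_mult using FM B by (intro mult_mono) auto
    then have "?d * \<bar>L x0\<bar> \<le> \<bar>L (F x *\<^sub>R x - ?p)\<bar> + M * (?h * B)"
      using split[of x] by (simp add: abs_mult[symmetric])
    also have "\<dots> \<le> e1 * (?d * norm x0 + M * ?h) + M * (?h * B)"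
    proof -
      have "norm (F x *\<^sub>R x - ?p) \<le> ?d * norm x0 + M * ?h"
        using nrm[of x] mult_right_mono[OF FM, of ?h] by simp
      then show ?thesis using est mult_left_mono[of _ _ e1] e1 by (smt (verit))
    qed
    also have "e1 * (?d * norm x0 + M * ?h) + M * (?h * B) = ?d * (e1 * norm x0) + M * (B + e1) * ?h"
      by (simp add: algebra_simps)
    also have "?d * (e1 * norm x0) \<le> ?d * (\<bar>L x0\<bar> / 2)"
    proof (rule mult_left_mono)
      have "e1 * norm x0 \<le> e1 * (norm x0 + 1)" using e1 by simp
      also have "\<dots> = \<bar>L x0\<bar> / 2"
      proof -
        have "norm x0 + 1 \<noteq> 0" by (metis add_nonneg_pos less_numeral_extra(1) norm_ge_zero order_less_irrefl)
        then show ?thesis by (simp add: e1_def field_simps)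
      qed
      finally show "e1 * norm x0 \<le> \<bar>L x0\<bar> / 2" .
    qed simp
    finally have "?d * (\<bar>L x0\<bar> / 2) \<le> M * (B + e1) * ?h" by (simp add: algebra_simps)
    then show ?thesis using a by (simp add: C_def field_simps)
  qed
  show ?thesis
    unfolding has_derivative_at_alt
  proof (intro conjI allI impI)
    have "bounded_linear (\<lambda>w. (- F x0 / L x0) *\<^sub>R L w)" by (intro bounded_linear_const_scaleR bl)
    moreover have "(\<lambda>w. (- F x0 / L x0) *\<^sub>R L w) = (\<lambda>w. - (F x0 * L w / L x0))" by (auto simp: fun_eq_iff)
    ultimately show "bounded_linear (\<lambda>w. - (F x0 * L w / L x0))" by metis
    fix e :: real assume e: "e > 0"
    \<comment> \<open>Half of the error comes from linearizing \<open>H\<close>, controlled by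
      \<open>e3\<close>, and half from replacing \<open>F x\<close> by \<open>F x0\<close> in front
      of \<open>L\<close>, controlled by \<open>e2\<close>.\<close>
    define e3 where "e3 = min e1 (e * \<bar>L x0\<bar> / (2 * (C * norm x0 + M)))"
    define e2 where "e2 = e * \<bar>L x0\<bar> / (2 * B)"
    have CM: "C * norm x0 + M > 0" using C M by (simp add: add_nonneg_pos)
    have pos: "e3 > 0" "e2 > 0" using e e1 CM a B by (auto simp: e3_def e2_def)
    obtain d where d: "d > 0" and dd: "\<And>x. norm (x - x0) < d \<Longrightarrow> x \<in> S \<and> \<bar>F x - F x0\<bar> \<le> e2 \<and> \<bar>F x\<bar> \<le> M \<and>
     \<bar>L (F x *\<^sub>R x - ?p)\<bar> \<le> e3 * norm (F x *\<^sub>R x - ?p)" using near[OF pos] by metis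
    have "norm (F x - F x0 - - (F x0 * L (x - x0) / L x0)) \<le> e * norm (x - x0)" if x: "norm (x - x0) < d" for x
    proof -
      let ?d = "\<bar>F x - F x0\<bar>" and ?h = "norm (x - x0)"
      have est: "\<bar>L (F x *\<^sub>R x - ?p)\<bar> \<le> e3 * norm (F x *\<^sub>R x - ?p)" and FM: "\<bar>F x\<bar> \<le> M" and d2: "?d \<le> e2"
        using dd[OF x] by auto
      have "e3 * norm (F x *\<^sub>R x - ?p) \<le> e1 * norm (F x *\<^sub>R x - ?p)"
        by (intro mult_right_mono) (auto simp: e3_def)
      then have lip: "?d \<le> C * ?h" using lipschitz[OF FM] est by linarith
      have 1: "(F x - F x0) * L x0 + F x0 * L (x - x0) = L (F x *\<^sub>R x - ?p) - (F x - F x0) * L (x - x0)"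
        unfolding split by (simp add: algebra_simps)
      have "norm (F x *\<^sub>R x - ?p) \<le> (C * norm x0 + M) * ?h"
        using nrm[of x] mult_right_mono[OF FM, of ?h] mult_right_mono[OF lip, of "norm x0"] by (simp add: algebra_simps)
      then have "e3 * norm (F x *\<^sub>R x - ?p) \<le> (e * \<bar>L x0\<bar> / (2 * (C * norm x0 + M))) * ((C * norm x0 + M) * ?h)"
        using pos(1) e CM by (intro mult_mono) (auto simp: e3_def)
      also have "\<dots> = e * \<bar>L x0\<bar> / 2 * ?h" using CM by (simp add: field_simps)
      finally have 2: "\<bar>L (F x *\<^sub>R x - ?p)\<bar> \<le> e * \<bar>L x0\<bar> / 2 * ?h" using est by linarith
      have "\<bar>(F x - F x0) * L (x - x0)\<bar> \<le> e2 * (?h * B)"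
        unfolding abs_mult using d2 B pos by (intro mult_mono) auto
      also have "\<dots> = e * \<bar>L x0\<bar> / 2 * ?h" using B(1) by (simp add: e2_def field_simps)
      finally have "\<bar>(F x - F x0) * L x0 + F x0 * L (x - x0)\<bar> \<le> e * \<bar>L x0\<bar> * ?h"
        unfolding 1 using 2 abs_triangle_ineq4[of "L (F x *\<^sub>R x - ?p)" "(F x - F x0) * L (x - x0)"] by simp
      moreover have "F x - F x0 - - (F x0 * L (x - x0) / L x0) = ((F x - F x0) * L x0 + F x0 * L (x - x0)) / L x0"
        using a by (simp add: field_simps)
      ultimately show ?thesis using a by (simp add: abs_divide divide_le_eq mult_ac)
    qed
    then show "\<exists>d>0. \<forall>x. norm (x - x0) < d \<longrightarrow> norm (F x - F x0 - - (F x0 * L (x - x0) / L x0)) \<le> e * norm (x - x0)"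
      using d by blast
  qed
qed

section \<open>Radial projection to the boundary\<close>

context star_metric
begin

abbreviation bp where "bp \<equiv> boundary_point Om"

lemma frontier_Om: "frontier Om = Om - W"
  using compact_imp_closed[OF Om_compact] by (simp add: frontier_def)

text \<open>Two boundary points on one ray are impossible: by \<open>Om_star\<close> the nearer one
  would be interior.\<close>

lemma bp_unique:
  assumes p: "p \<in> frontier Om" "p = t *\<^sub>R x" "0 < t"
  shows "bp x = p"
  unfolding boundary_point_def
proof (rule the_equality)
  show "p \<in> frontier Om \<and> (\<exists>t>0. p = t *\<^sub>R x)" using p by blast
  fix q assume "q \<in> frontier Om \<and> (\<exists>t>0. q = t *\<^sub>R x)"
  then obtain s where q: "q \<in> frontier Om" "q = s *\<^sub>R x" "0 < s" by blast
  have False if "0 < a" "a < b" "a *\<^sub>R x \<in> frontier Om" "b *\<^sub>R x \<in> frontier Om" for a b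
  proof -
    have "(a / b) *\<^sub>R (b *\<^sub>R x) \<in> W" using that by (intro Om_star) (auto simp: frontier_Om)
    then show False using that by (auto simp: frontier_Om)
  qed
  then have "s = t" using p q by (metis linorder_neqE_linordered_idom)
  then show "q = p" using p q by simp
qed

text \<open>Take the largest t with t x in the compact set \<open>Om\<close>; if that point were
  interior, t could be increased.\<close>

lemma bp:
  assumes x: "x \<noteq> 0"
  shows "bp x \<in> frontier Om" "\<exists>t>0. bp x = t *\<^sub>R x"
proof -
  let ?T = "(\<lambda>t::real. t *\<^sub>R x) -` Om \<inter> {0..}"
  have "closed ?T"
    by (intro closed_Int closed_vimage compact_imp_closed[OF Om_compact] continuous_intros)
  moreover have "bounded ?T"
  proof -
    obtain B where B: "\<And>y. y \<in> Om \<Longrightarrow> norm y \<le> B"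
      using compact_imp_bounded[OF Om_compact] by (auto simp: bounded_iff)
    have "\<bar>t\<bar> \<le> B / norm x" if "t \<in> ?T" for t
      using B[of "t *\<^sub>R x"] that x by (simp add: field_simps)
    then show ?thesis by (auto simp: bounded_iff)
  qed
  ultimately have cT: "compact ?T" by (simp add: compact_eq_bounded_closed)
  obtain e where e: "e > 0" "e *\<^sub>R x \<in> W" using small_multiple_in_W .
  then have eT: "e \<in> ?T" using W_sub by auto
  then obtain t where t: "t \<in> ?T" "\<And>s. s \<in> ?T \<Longrightarrow> s \<le> t"
    using compact_attains_sup[OF cT] by blast
  have t0: "t > 0" using t(2)[OF eT] e by simp
  have "t *\<^sub>R x \<notin> W"
  proof
    assume "t *\<^sub>R x \<in> W"
    then obtain s where s: "s > 1" "s *\<^sub>R (t *\<^sub>R x) \<in> W" using larger_multiple_in_W by blast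
    then have "s * t \<in> ?T" using t0 W_sub by auto
    then show False using t(2)[of "s * t"] s t0 by (simp add: mult_le_cancel_right1)
  qed
  then have "t *\<^sub>R x \<in> frontier Om" using t(1) by (simp add: frontier_Om)
  then have "bp x = t *\<^sub>R x" using t0 by (intro bp_unique) auto
  then show "bp x \<in> frontier Om" "\<exists>t>0. bp x = t *\<^sub>R x" using \<open>t *\<^sub>R x \<in> frontier Om\<close> t0 by auto
qed

lemma bp_Om: "x \<noteq> 0 \<Longrightarrow> bp x \<in> Om"
  using bp(1) by (simp add: frontier_Om)

lemma bp_nonzero: "x \<noteq> 0 \<Longrightarrow> bp x \<noteq> 0"
  using bp(2)[of x] by force

text \<open>The radial function extended to all nonzero vectors as constant on rays, which is the
  extension that \<open>C1_norm_sphere\<close> differentiates. Agreement with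
  \<open>radial_fun\<close> on unit vectors is \<open>radial_fun_eq\<close>.\<close>

definition rad where "rad x = norm (bp x)"

lemma rad_pos: "x \<noteq> 0 \<Longrightarrow> 0 < rad x"
  using bp_nonzero by (simp add: rad_def)

lemma bp_rad: "x \<noteq> 0 \<Longrightarrow> bp x = (rad x / norm x) *\<^sub>R x"
  using bp(2)[of x] by (auto simp: rad_def)

lemma bp_scale: "x \<noteq> 0 \<Longrightarrow> 0 < c \<Longrightarrow> bp (c *\<^sub>R x) = bp x"
  using bp_unique[OF bp(1), of x "rad x / norm x / c" "c *\<^sub>R x"] rad_pos[of x] by (simp add: bp_rad)

lemma bp_sgn: "bp (sgn x) = bp x"
  using bp_scale[of x "inverse (norm x)"] by (cases "x = 0") (auto simp: sgn_div_norm)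

lemma rad_sgn: "rad (sgn x) = rad x"
  by (simp add: rad_def bp_sgn)

lemma Om_iff_rad: "x \<noteq> 0 \<Longrightarrow> x \<in> Om \<longleftrightarrow> norm x \<le> rad x"
  and W_iff_rad: "x \<noteq> 0 \<Longrightarrow> x \<in> W \<longleftrightarrow> norm x < rad x"
proof -
  assume x: "x \<noteq> 0"
  define s where "s = norm x / rad x"
  have s: "s > 0" using x rad_pos[OF x] by (simp add: s_def)
  have xs: "x = s *\<^sub>R bp x" using x rad_pos[OF x] by (simp add: bp_rad s_def)
  have lt: "x \<in> W" if "s < 1" using Om_star[OF bp_Om[OF x], of s] s that xs by simp
  have eq: "x \<in> Om \<and> x \<notin> W" if "s = 1" using bp(1)[OF x] xs that by (simp add: frontier_Om)
  have gt: "x \<notin> Om" if "s > 1"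
  proof
    assume "x \<in> Om"
    then have "(1 / s) *\<^sub>R x \<in> W" using that by (intro Om_star) auto
    moreover have "(1 / s) *\<^sub>R x = (1 / s) *\<^sub>R (s *\<^sub>R bp x)" using xs by (rule arg_cong)
    ultimately have "bp x \<in> W" using s by simp
    then show False using bp(1)[OF x] by (simp add: frontier_Om)
  qed
  have s1: "s < 1 \<longleftrightarrow> norm x < rad x" "s = 1 \<longleftrightarrow> norm x = rad x" using rad_pos[OF x] by (auto simp: s_def)
  show "x \<in> Om \<longleftrightarrow> norm x \<le> rad x" using lt eq gt s1 W_sub by (metis linorder_neqE_linordered_idom order_le_less subsetD)
  show "x \<in> W \<longleftrightarrow> norm x < rad x" using lt eq gt s1 W_sub by (metis linorder_neqE_linordered_idom subsetD)
qed

text \<open>\<open>sgn\<close> maps the compact boundary bijectively and continuously onto the unit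
  sphere, so its inverse is continuous.\<close>

lemma continuous_on_bp: "continuous_on (- {0}) bp"
proof -
  have nz: "p \<noteq> 0" if "p \<in> frontier Om" for p using that zero_W by (auto simp: frontier_Om)
  have "continuous_on (sgn ` frontier Om) bp"
  proof (rule continuous_on_inv)
    show "continuous_on (frontier Om) sgn"
      unfolding sgn_div_norm by (intro continuous_intros) (use nz in auto)
    show "compact (frontier Om)" using Om_compact by (rule compact_frontier)
    show "\<forall>x\<in>frontier Om. bp (sgn x) = x"
      using nz bp_unique[of _ 1] by (simp add: bp_sgn)
  qed
  moreover have "sgn ` frontier Om = sphere 0 1"
  proof (intro equalityI subsetI)
    fix \<theta> assume "\<theta> \<in> sgn ` frontier Om"
    then show "\<theta> \<in> sphere 0 1" using nz by (auto simp: norm_sgn)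
  next
    fix \<theta> :: "real^'n" assume "\<theta> \<in> sphere 0 1"
    then have n: "norm \<theta> = 1" "\<theta> \<noteq> 0" by auto
    then have "sgn (bp \<theta>) = \<theta>"
      using rad_pos[OF n(2)] by (simp add: bp_rad sgn_scaleR sgn_div_norm)
    then show "\<theta> \<in> sgn ` frontier Om" using bp(1)[OF n(2)] by (metis image_eqI)
  qed
  ultimately have "continuous_on (- {0}) (\<lambda>x. bp (sgn x))" by (intro continuous_on_sgn_compose) simp
  then show ?thesis by (simp add: bp_sgn)
qed

text \<open>The radial derivative of a smooth extension of \<open>ex\<close> at the boundary point
  is the terminal velocity of the geodesic, read off as a one-sided derivative at time 1; there
  transversality applies.\<close>

lemma bp_transverse:
  assumes x: "x \<noteq> 0" and E: "open U" "Om \<subseteq> U" "\<And>m. Ck_open m U E" "\<And>x. x \<in> Om \<Longrightarrow> E x = ex x"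
  shows "E (bp x) \<bullet> E (bp x) = 1" "E (bp x) \<bullet> frechet_derivative E (at (bp x)) (bp x) \<noteq> 0"
proof -
  let ?p = "bp x"
  have p: "?p \<in> Om" "?p \<notin> W" using bp(1)[OF x] by (auto simp: frontier_Om)
  then have s: "ex ?p \<in> sphere 0 1" using ex_in_cball[OF p(1)] ex_ball_iff[OF p(1)] by auto
  then show "E ?p \<bullet> E ?p = 1" using E(4)[OF p(1)] by (simp add: norm_eq_1)
  obtain c c' where geo: "geodesic_on (cball 0 1) g 1 c c'" and c0: "c 0 = 0"
    and exc: "\<And>t. t \<in> {0..1} \<Longrightarrow> ex (t *\<^sub>R ?p) = c t" using Om_geodesic[OF p(1)] by metis
  have c1: "c 1 = ex ?p" using exc[of 1] by simp
  then have nz: "c' 1 \<bullet> c 1 \<noteq> 0" using transverse geo c0 s unfolding radial_transverse_def by metis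
  have tp: "t *\<^sub>R ?p \<in> Om" if "t \<in> {0..1}" for t
    using Om_star[OF p(1), of t] that p(1) W_sub by (cases "t = 1") auto
  have "(c has_vector_derivative c' 1) (at 1 within {0..1})" using geo by (simp add: geodesic_on_def)
  then have 1: "((\<lambda>t. E (t *\<^sub>R ?p)) has_vector_derivative c' 1) (at 1 within {0..1})"
    by (rule has_vector_derivative_transform[rotated 2]) (use exc E(4) tp in auto)
  have "(E has_derivative frechet_derivative E (at (1 *\<^sub>R ?p))) (at (1 *\<^sub>R ?p))"
    using Ck_open_Suc_has_derivative[OF E(3)] p(1) E(2) by auto
  from has_vector_derivative_compose[OF ray_derivative this]
  have 2: "((\<lambda>t. E (t *\<^sub>R ?p)) has_vector_derivative frechet_derivative E (at ?p) ?p) (at 1 within {0..1})" by simp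
  have "frechet_derivative E (at ?p) ?p = c' 1"
    using vector_derivative_unique_within_closed_interval[of 0 1 1, OF _ _ 2[unfolded box_real[symmetric]] 1[unfolded box_real[symmetric]]] by simp
  then show "E ?p \<bullet> frechet_derivative E (at ?p) ?p \<noteq> 0" using nz c1 E(4)[OF p(1)] by (simp add: inner_commute)
qed

text \<open>The function |E|^2 - 1 vanishes on the boundary and, by transversality, has nonzero
  radial derivative there; \<open>implicit_scaling_derivative\<close> then treats rad / norm.
  Continuity of the derivative follows from the explicit formula \<open>D\<close>.\<close>

lemma rad_C1:
  shows "x \<noteq> 0 \<Longrightarrow> (rad has_derivative frechet_derivative rad (at x)) (at x)"
    and "continuous_on (- {0}) (\<lambda>x. frechet_derivative rad (at x) w)"
proof -
  obtain U E where E: "open U" "Om \<subseteq> U" "\<And>m. Ck_open m U E" "\<And>x. x \<in> Om \<Longrightarrow> E x = ex x"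
    using ex_extension by metis
  define H where "H = (\<lambda>y. E y \<bullet> E y - 1)"
  have CH: "Ck_open m U H" for m
    unfolding H_def by (intro Ck_open_diff Ck_open_inner Ck_open_const E)
  define L where "L = (\<lambda>x. frechet_derivative H (at (bp x)))"
  define F where "F = (\<lambda>x. rad x / norm x)"
  have bpU: "bp x \<in> U" if "x \<noteq> 0" for x using bp_Om[OF that] E(2) by blast
  have dH: "(H has_derivative L x) (at (bp x))" if "x \<noteq> 0" for x
    unfolding L_def by (rule Ck_open_Suc_has_derivative[OF CH bpU[OF that]])
  have Hbp: "H (bp x) = 0" if "x \<noteq> 0" for x using bp_transverse(1)[OF that E] by (simp add: H_def)
  have Lx: "L x x \<noteq> 0" if x: "x \<noteq> 0" for x
  proof -
    have dE: "(E has_derivative frechet_derivative E (at (bp x))) (at (bp x))"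
      using Ck_open_Suc_has_derivative[OF E(3) bpU[OF x]] .
    have "(H has_derivative (\<lambda>v. E (bp x) \<bullet> frechet_derivative E (at (bp x)) v + frechet_derivative E (at (bp x)) v \<bullet> E (bp x))) (at (bp x))"
      unfolding H_def using has_derivative_diff[OF has_derivative_inner[OF dE dE] has_derivative_const] by simp
    then have "L x (bp x) = 2 * (E (bp x) \<bullet> frechet_derivative E (at (bp x)) (bp x))"
      using has_derivative_unique[OF dH[OF x]] by (simp add: inner_commute)
    then have "L x (bp x) \<noteq> 0" using bp_transverse(2)[OF x E] by simp
    then show ?thesis
      using linear_scale[OF has_derivative_linear[OF dH[OF x]], of "rad x / norm x" x] by (simp add: bp_rad[OF x])
  qed
  have cF: "continuous_on (- {0}) F"
    unfolding F_def rad_def by (intro continuous_intros continuous_on_bp) auto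
  have dF: "(F has_derivative (\<lambda>w. - (F x * L x w / L x x))) (at x)" if x: "x \<noteq> 0" for x
  proof (rule implicit_scaling_derivative[where F=F and ?x0.0=x and H=H and L="L x" and S="- {0}"])
    show "isCont F x" using cF x by (simp add: continuous_on_eq_continuous_at open_Compl)
    show "(H has_derivative L x) (at (F x *\<^sub>R x))" using dH[OF x] by (simp add: F_def bp_rad[OF x])
    show "H (F y *\<^sub>R y) = 0" if "y \<in> - {0}" for y using Hbp[of y] that by (simp add: F_def bp_rad)
  qed (use x Lx in \<open>auto simp: open_Compl\<close>)
  define D where "D = (\<lambda>x w. F x * (w \<bullet> sgn x) + - (F x * L x w / L x x) * norm x)"
  have dr: "(rad has_derivative D x) (at x)" if x: "x \<noteq> 0" for x
  proof (rule has_derivative_transform_within_open[of "\<lambda>y. F y * norm y" _ _ _ "- {0}"])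
    show "((\<lambda>y. F y * norm y) has_derivative D x) (at x)"
      unfolding D_def by (intro has_derivative_mult dF x has_derivative_norm)
  qed (use x in \<open>auto simp: F_def open_Compl\<close>)
  then have fr: "frechet_derivative rad (at x) = D x" if "x \<noteq> 0" for x
    using frechet_derivative_at that by metis
  show "x \<noteq> 0 \<Longrightarrow> (rad has_derivative frechet_derivative rad (at x)) (at x)" using dr fr by simp
  have cL: "continuous_on (- {0}) (\<lambda>x. L x v)" for v
  proof -
    have "continuous_on U (\<lambda>y. frechet_derivative H (at y) v)"
      by (rule Ck_open_continuous_on[OF Ck_open_Suc_derivative[OF CH[of "Suc 0"]]])
    then show ?thesis unfolding L_def
      by (rule continuous_on_compose2[OF _ continuous_on_bp]) (use bpU in auto)
  qed
  have cLx: "continuous_on (- {0}) (\<lambda>x. L x x)"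
  proof (rule continuous_on_eq)
    show "continuous_on (- {0}) (\<lambda>x. \<Sum>b\<in>Basis. (x \<bullet> b) * L x b)"
      by (intro continuous_intros cL)
    show "(\<Sum>b\<in>Basis. (x \<bullet> b) * L x b) = L x x" if "x \<in> - {0}" for x
    proof -
      have lin: "linear (L x)" using has_derivative_linear[OF dH] that by auto
      have "L x (\<Sum>b\<in>Basis. (x \<bullet> b) *\<^sub>R b) = (\<Sum>b\<in>Basis. (x \<bullet> b) * L x b)"
        by (simp add: linear_sum[OF lin] linear_scale[OF lin])
      then show ?thesis by (simp add: euclidean_representation)
    qed
  qed
  have csgn: "continuous_on (- {0::real^'n}) sgn"
    unfolding sgn_div_norm by (intro continuous_intros) auto
  have "continuous_on (- {0}) (\<lambda>x. D x w)"
    unfolding D_def by (intro continuous_intros cF cL cLx csgn) (use Lx in auto)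
  then show "continuous_on (- {0}) (\<lambda>x. frechet_derivative rad (at x) w)"
    by (rule continuous_on_eq) (simp add: fr)
qed

lemma rad_derivative_radial:
  assumes x: "x \<noteq> 0" shows "frechet_derivative rad (at x) x = 0"
proof -
  have "(rad has_derivative frechet_derivative rad (at (1 *\<^sub>R x))) (at (1 *\<^sub>R x))" using rad_C1(1)[OF x] by simp
  from has_vector_derivative_compose[OF ray_derivative[of x 1 UNIV] this]
  have 1: "((\<lambda>t. rad (t *\<^sub>R x)) has_vector_derivative frechet_derivative rad (at x) x) (at 1)" by simp
  have "((\<lambda>t. rad (t *\<^sub>R x)) has_vector_derivative 0) (at 1)"
    by (rule has_vector_derivative_transform_within_open[of "\<lambda>_. rad x" _ _ "{0<..}"])
       (use x bp_scale in \<open>auto simp: rad_def\<close>)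
  with 1 show ?thesis by (rule vector_derivative_unique_at)
qed

lemma Om_inward_derivative:
  assumes D: "((\<lambda>y. 0) has_derivative D) (at x within Om)" and d: "d > 0"
    and seg: "\<And>t. 0 \<le> t \<Longrightarrow> t < d \<Longrightarrow> x - t *\<^sub>R u \<in> Om"
  shows "D u = 0"
proof -
  have p: "((\<lambda>t. x - t *\<^sub>R u) has_vector_derivative - u) (at 0 within {0..d/2})"
    by (auto intro!: derivative_eq_intros simp: has_vector_derivative_def)
  have sub: "(\<lambda>t. x - t *\<^sub>R u) ` {0..d/2} \<subseteq> Om" using seg d by auto
  have "((\<lambda>y. 0) has_derivative D) (at (x - 0 *\<^sub>R u) within (\<lambda>t. x - t *\<^sub>R u) ` {0..d/2})"
    using has_derivative_subset[OF D sub] by simp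
  from vector_derivative_diff_chain_within[OF p this]
  have 1: "((\<lambda>t. 0) has_vector_derivative D (- u)) (at 0 within {0..d/2})" by (simp add: o_def)
  have 2: "((\<lambda>t::real. 0) has_vector_derivative 0) (at 0 within {0..d/2})" by (rule has_vector_derivative_const)
  have "D (- u) = 0"
    using vector_derivative_unique_within_closed_interval[of 0 "d/2" 0, OF _ _ 1[unfolded box_real[symmetric]] 2[unfolded box_real[symmetric]]] d
    by simp
  then show ?thesis using linear_neg[OF has_derivative_linear[OF D], of u] by simp
qed

text \<open>Derivatives within \<open>Om\<close> are unique at boundary points because \<open>Om\<close> contains an open cone of
  inward directions there.\<close>

lemma Om_derivative_unique:
  assumes x: "x \<in> Om" and A: "(f has_derivative A) (at x within Om)" and A': "(f has_derivative A') (at x within Om)"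
  shows "A = A'"
proof (cases "x \<in> W")
  case True
  then have "at x within Om = at x" by (rule at_within_interior)
  then show ?thesis using A A' has_derivative_unique by metis
next
  case False
  then have x0: "x \<noteq> 0" using zero_W by auto
  define D where "D = (\<lambda>v. A v - A' v)"
  have D: "((\<lambda>y. 0) has_derivative D) (at x within Om)"
    using has_derivative_diff[OF A A'] by (simp add: D_def)
  have rx: "norm x = rad x" using Om_iff_rad[OF x0] W_iff_rad[OF x0] x False by auto
  define m where "m = (\<lambda>y. norm y - rad y)"
  define dm where "dm = (\<lambda>u. u \<bullet> sgn x - frechet_derivative rad (at x) u)"
  have dm: "(m has_derivative dm) (at x)"
    unfolding m_def dm_def by (intro has_derivative_diff has_derivative_norm rad_C1(1) x0)
  have dmx: "dm x = norm x"
    using x0 by (simp add: dm_def rad_derivative_radial sgn_div_norm power2_norm_eq_inner[symmetric] power2_eq_square)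
  have pos: "D u = 0" if u: "dm u > 0" for u
  proof -
    have p: "((\<lambda>t. x - t *\<^sub>R u) has_vector_derivative - u) (at 0)"
      by (auto intro!: derivative_eq_intros simp: has_vector_derivative_def)
    have "(m has_derivative dm) (at (x - 0 *\<^sub>R u))" using dm by simp
    from has_vector_derivative_compose[OF p this]
    have "((\<lambda>t. m (x - t *\<^sub>R u)) has_real_derivative - dm u) (at 0)"
      using linear_neg[OF has_derivative_linear[OF dm], of u] by (simp add: has_real_derivative_iff_has_vector_derivative)
    from DERIV_neg_dec_right[OF this] u obtain d where d: "d > 0" "\<And>h. h > 0 \<Longrightarrow> h < d \<Longrightarrow> m (x - h *\<^sub>R u) < m x"
      by auto
    have "x - t *\<^sub>R u \<in> Om" if "0 \<le> t" "t < d" for t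
    proof (cases "t = 0 \<or> x - t *\<^sub>R u = 0")
      case True
      then show ?thesis using x zero_W W_sub by auto
    next
      case False
      then have "m (x - t *\<^sub>R u) < m x" using d(2) that by auto
      then show ?thesis using False rx by (simp add: Om_iff_rad m_def)
    qed
    then show ?thesis by (rule Om_inward_derivative[OF D d(1)])
  qed
  have Dx: "D x = 0" by (rule pos) (use dmx x0 in simp)
  have "D w = 0" for w
  proof -
    \<comment> \<open>Adding this multiple of \<open>x\<close> makes \<open>dm\<close> positive, so
      \<open>w\<close> is a difference of two directions on which \<open>D\<close> is already known
      to vanish.\<close>
    define s where "s = (\<bar>dm w\<bar> + 1) / norm x"
    have "dm (w + s *\<^sub>R x) = dm w + s * norm x"
      using linear_add[OF has_derivative_linear[OF dm]] linear_scale[OF has_derivative_linear[OF dm]] dmx by simp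
    also have "\<dots> > 0" using x0 by (simp add: s_def)
    finally have "D (w + s *\<^sub>R x) = 0" by (rule pos)
    then show ?thesis
      using linear_add[OF has_derivative_linear[OF D]] linear_scale[OF has_derivative_linear[OF D]] Dx by simp
  qed
  then show ?thesis by (auto simp: D_def fun_eq_iff)
qed

end

section \<open>Normal coordinates up to the boundary\<close>

context star_metric
begin

text \<open>By \<open>Om_derivative_unique\<close> the derivative within \<open>Om\<close> is that
  of any smooth extension, also at the boundary; this makes \<open>gbar g\<close> smooth up to the
  boundary.\<close>

lemma ex_within_derivative:
  assumes x: "x \<in> Om" and E: "Om \<subseteq> U" "\<And>m. Ck_open m U E" "\<And>x. x \<in> Om \<Longrightarrow> E x = ex x"
  shows "frechet_derivative ex (at x within Om) = frechet_derivative E (at x)"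
proof -
  have "(E has_derivative frechet_derivative E (at x)) (at x)"
    using Ck_open_Suc_has_derivative[OF E(2)] x E(1) by blast
  then have "(E has_derivative frechet_derivative E (at x)) (at x within Om)"
    by (rule has_derivative_at_withinI)
  then have d: "(ex has_derivative frechet_derivative E (at x)) (at x within Om)"
    by (rule has_derivative_transform[rotated 2]) (use x E(3) in auto)
  then have "(ex has_derivative frechet_derivative ex (at x within Om)) (at x within Om)"
    using frechet_derivative_works differentiableI by blast
  then show ?thesis using Om_derivative_unique[OF x] d by blast
qed

lemma gbar_extension:
  obtains U G where "open U" "Om \<subseteq> U" "\<And>m. Ck_open m U G" "\<And>x. x \<in> Om \<Longrightarrow> G x = gbar g x"
proof -
  obtain U E where E: "open U" "Om \<subseteq> U" "\<And>m. Ck_open m U E" "\<And>x. x \<in> Om \<Longrightarrow> E x = ex x"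
    using ex_extension by metis
  obtain U0 G0 where G0: "open U0" "cball 0 1 \<subseteq> U0" "\<forall>m. Ck_open m U0 G0" "\<forall>x\<in>cball 0 1. G0 x = g x"
    using smooth_g unfolding smooth_on_def by blast
  define V where "V = U \<inter> E -` U0"
  have V: "open V" unfolding V_def by (rule continuous_open_preimage[OF Ck_open_continuous_on[OF E(3)[of 0]] E(1) G0(1)])
  have VU: "V \<subseteq> U" by (auto simp: V_def)
  have sub: "Om \<subseteq> V"
  proof
    fix x assume x: "x \<in> Om"
    then have "ex x \<in> U0" using ex_in_cball G0(2) by blast
    then show "x \<in> V" using x E(2,4) by (auto simp: V_def)
  qed
  define J where "J = (\<lambda>x. matrix (frechet_derivative E (at x)))"
  have CJ: "Ck_open m V (\<lambda>x. J x $ i $ j)" for m i j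
    unfolding J_def matrix_def vec_lambda_beta
    by (intro Ck_open_vec_nth[OF V] Ck_open_Suc_derivative Ck_open_subset[OF E(3) VU])
  have CG: "Ck_open m V (\<lambda>x. G0 (E x) $ i $ j)" for m i j
    by (intro Ck_open_vec_nth[OF V] Ck_open_compose[OF V Ck_open_subset[OF E(3) VU] G0(1)])
       (use G0(3) in \<open>auto simp: V_def\<close>)
  define G where "G = (\<lambda>x. transpose (J x) ** G0 (E x) ** J x)"
  have "Ck_open m V (\<lambda>x. G x $ i $ j)" for m i j
    unfolding G_def matrix_matrix_mult_def transpose_def vec_lambda_beta
    by (intro Ck_open_sum Ck_open_mult V CJ CG)
  then have CkG: "Ck_open m V G" for m by (intro Ck_open_vecI V)
  have "G x = gbar g x" if x: "x \<in> Om" for x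
    using x ex_within_derivative[OF x E(2-4)] E(4)[OF x] G0(4) ex_in_cball[OF x]
    by (simp add: G_def J_def gbar_def pullback_metric_def Let_def jacobian_def)
  then show ?thesis using that V sub CkG by blast
qed

lemma gbar_continuous: "continuous_on Om (gbar g)"
proof -
  obtain U G where "Om \<subseteq> U" "\<And>m. Ck_open m U G" "\<And>x. x \<in> Om \<Longrightarrow> G x = gbar g x"
    using gbar_extension by metis
  then show ?thesis
    using continuous_on_eq[of Om G] continuous_on_subset Ck_open_continuous_on by metis
qed

lemma gbar_sym: "x \<in> Om \<Longrightarrow> transpose (gbar g x) = gbar g x"
proof -
  assume "x \<in> Om"
  then have "transpose (g (ex x)) = g (ex x)" using pos_def_cball[OF ex_in_cball] by (simp add: pos_def_sym_def)
  then show ?thesis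
    by (simp add: gbar_def pullback_metric_def Let_def matrix_transpose_mul matrix_mul_assoc)
qed

lemma Om_scale: "x \<in> Om \<Longrightarrow> 0 \<le> t \<Longrightarrow> t \<le> 1 \<Longrightarrow> t *\<^sub>R x \<in> Om"
  using Om_star[of x t] W_sub by (cases "t = 1") auto

lemma gbar_ray_continuous: "x \<in> Om \<Longrightarrow> continuous_on {0..1} (\<lambda>t. gbar g (t *\<^sub>R x))"
  by (intro continuous_on_compose2[OF gbar_continuous] continuous_intros) (auto intro: Om_scale)

lemma gbar_radial_W: "x \<in> W \<Longrightarrow> gbar g x *v x = x"
proof (rule vector_eq_rdot[THEN iffD1], rule allI)
  fix u assume x: "x \<in> W"
  have "(gbar g x *v x) \<bullet> u = x \<bullet> (gbar g x *v u)"
    using symmetric_dot_swap[OF gbar_sym] x W_sub by blast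
  also have "\<dots> = x \<bullet> u" using gbar_W[OF x] gauss_lemma[OF x] by simp
  finally show "(gbar g x *v x) \<bullet> u = x \<bullet> u" .
qed

lemma gbar_radial:
  assumes x: "x \<in> Om" shows "gbar g x *v x = x"
proof -
  have "gbar g (1 *\<^sub>R x) *v (1 *\<^sub>R x) = 1 *\<^sub>R x"
  proof (rule continuous_on_agree_endpoint[where T=1])
    show "continuous_on {0..1} (\<lambda>t. gbar g (t *\<^sub>R x) *v (t *\<^sub>R x))"
      by (intro bounded_bilinear.continuous_on[OF bounded_bilinear_matrix_vector_mult] gbar_ray_continuous[OF x] continuous_intros)
  qed (use gbar_radial_W Om_star[OF x] in \<open>auto intro!: continuous_intros\<close>)
  then show ?thesis by simp
qed

lemma gbar_pos_def: "x \<in> W \<Longrightarrow> pos_def_sym (gbar g x)"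
proof -
  assume x: "x \<in> W"
  have "0 < v \<bullet> (gbar g x *v v)" if "v \<noteq> 0" for v
  proof -
    have "D1 v x \<noteq> 0" using ex_derivative_inj[OF x, of v] that by (auto simp: D1_def)
    then show ?thesis using B.pos_g[OF ex_ball[OF x]] by (simp add: gbar_W[OF x])
  qed
  then show ?thesis using gbar_sym x W_sub unfolding pos_def_sym_def by blast
qed

lemma gbar_0: "gbar g 0 = mat 1"
proof -
  have "u \<bullet> (gbar g 0 *v v) = u \<bullet> v" for u v
    by (simp add: gbar_W[OF zero_W] D1_at_0 ex_0 P_inner)
  then have "gbar g 0 *v v = mat 1 *v v" for v by (metis matrix_vector_mul_lid vector_eq_ldot)
  then show ?thesis by (simp add: matrix_eq)
qed

text \<open>Rauch comparison with Q(t) = t^2 (w . gbar w) at the point t x. It covers times below 1;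
  continuity along the ray adds the boundary point at time 1.\<close>

lemma gbar_monotone:
  assumes x: "x \<in> Om" "x \<noteq> 0" and w: "w \<bullet> x = 0" and k: "k \<le> 0" and st: "0 < s" "s \<le> t" "t \<le> 1"
  shows "s\<^sup>2 / (s_model k (norm x * s))\<^sup>2 * (w \<bullet> (gbar g (s *\<^sub>R x) *v w)) \<le> t\<^sup>2 / (s_model k (norm x * t))\<^sup>2 * (w \<bullet> (gbar g (t *\<^sub>R x) *v w))"
proof -
  let ?f = "\<lambda>t. t\<^sup>2 / (s_model k (norm x * t))\<^sup>2 * (w \<bullet> (gbar g (t *\<^sub>R x) *v w))"
  have less: "?f s \<le> ?f t" if "0 < s" "s \<le> t" "t < 1" for s t
  proof -
    have W: "s *\<^sub>R x \<in> W" "t *\<^sub>R x \<in> W" using Om_star[OF x(1)] that by auto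
    show ?thesis
      using rauch_comparison[OF x w k that]
      by (simp add: gbar_W[OF W(1)] gbar_W[OF W(2)] matrix_vector_mult_scaleR power2_eq_square mult.assoc)
  qed
  show ?thesis
  proof (cases "t < 1")
    case True
    then show ?thesis using less st by simp
  next
    case False
    then have t1: "t = 1" using st by simp
    show ?thesis
    proof (cases "s = 1")
      case False
      then have s1: "s < 1" using st t1 by simp
      have c: "continuous_on {0<..} (\<lambda>t. s_model k (norm x * t))"
        by (intro continuous_at_imp_continuous_on ballI DERIV_isCont[OF s_model_derivative(1)[OF k]])
      have "continuous_on {s..1} ?f"
      proof (intro continuous_on_mult continuous_on_divide continuous_on_power continuous_on_inner continuous_on_const continuous_on_id
           bounded_bilinear.continuous_on[OF bounded_bilinear_matrix_vector_mult])
        show "continuous_on {s..1} (\<lambda>t. gbar g (t *\<^sub>R x))"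
          using gbar_ray_continuous[OF x(1)] by (rule continuous_on_subset) (use st in auto)
        show "continuous_on {s..1} (\<lambda>t. s_model k (norm x * t))" using c by (rule continuous_on_subset) (use st in auto)
        show "\<forall>t\<in>{s..1}. (s_model k (norm x * t))\<^sup>2 \<noteq> 0"
          using s_model_pos[OF k, of "norm x * _"] st x(2) by (metis atLeastAtMost_iff less_irrefl less_le_trans mult_pos_pos power_eq_0_iff zero_less_norm_iff)
      qed
      then have "continuous_on (closure {s..<1}) ?f" using s1 by simp
      then have "?f s \<le> ?f 1"
        by (rule continuous_ge_on_closure) (use less st s1 in auto)
      then show ?thesis by (simp add: t1)
    qed (use t1 in simp)
  qed
qed

end

sublocale star_metric \<subseteq> G: smooth_metric "interior (Omega g)" "Omega g" "gbar g"
proof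
  show "Ck_open m W (gbar g)" for m
  proof -
    obtain U G where G: "Om \<subseteq> U" "\<And>m. Ck_open m U G" "\<And>x. x \<in> Om \<Longrightarrow> G x = gbar g x"
      using gbar_extension by metis
    have "Ck_open m W G" using G(2) by (rule Ck_open_subset) (use G(1) W_sub in blast)
    then show ?thesis by (rule Ck_open_transform[rotated 2]) (use G W_sub in auto)
  qed
qed (use W_sub gbar_pos_def in auto)

section \<open>Rays as geodesics of the pulled back metric, and the radial function\<close>

context star_metric
begin

text \<open>Differentiating the Gauss lemma \<open>gbar g x *v x = x\<close> shows that the rays are geodesics.\<close>

lemma christoffel_radial:
  assumes x: "x \<in> Om"
  shows "(\<Sum>i\<in>UNIV. \<Sum>j\<in>UNIV. christoffel Om (gbar g) l i j x * x $ i * x $ j) = 0"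
proof -
  obtain U G where G: "Om \<subseteq> U" "\<And>m. Ck_open m U G" "\<And>x. x \<in> Om \<Longrightarrow> G x = gbar g x"
    using gbar_extension by metis
  define d where "d = frechet_derivative G (at x)"
  have dG: "(G has_derivative d) (at x within Om)"
    unfolding d_def using Ck_open_Suc_has_derivative[OF G(2), of x] x G(1) by (blast intro: has_derivative_at_withinI)
  have lin: "linear d" using dG by (rule has_derivative_linear)
  have dij: "((\<lambda>y. gbar g y $ i $ j) has_derivative (\<lambda>v. d v $ i $ j)) (at x within Om)" for i j
  proof -
    have "((\<lambda>y. G y $ i $ j) has_derivative (\<lambda>v. d v $ i $ j)) (at x within Om)"
      by (intro bounded_linear.has_derivative[OF bounded_linear_vec_nth] dG)
    then show ?thesis by (rule has_derivative_transform[rotated 2]) (use x G(3) in auto)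
  qed
  have p: "partial_within Om (\<lambda>y. gbar g y $ i $ j) m x = d (axis m 1) $ i $ j" for i j m
  proof -
    have "((\<lambda>y. gbar g y $ i $ j) has_derivative frechet_derivative (\<lambda>y. gbar g y $ i $ j) (at x within Om)) (at x within Om)"
      using dij frechet_derivative_works differentiableI by blast
    then have "frechet_derivative (\<lambda>y. gbar g y $ i $ j) (at x within Om) = (\<lambda>v. d v $ i $ j)"
      using Om_derivative_unique[OF x] dij by blast
    then show ?thesis by (simp add: partial_within_def)
  qed
  have dsym: "d v $ i $ j = d v $ j $ i" for v i j
  proof -
    have "((\<lambda>y. gbar g y $ i $ j) has_derivative (\<lambda>v. d v $ j $ i)) (at x within Om)"
    proof (rule has_derivative_transform[OF x _ dij])
      fix y assume "y \<in> Om"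
      then show "gbar g y $ i $ j = gbar g y $ j $ i"
        using arg_cong[OF gbar_sym, of y "\<lambda>A. A $ j $ i"] by (simp add: transpose_def)
    qed
    from Om_derivative_unique[OF x dij this] show ?thesis by (rule fun_cong)
  qed
  have key: "d v *v x = v - gbar g x *v v" for v
  proof -
    have "((\<lambda>y. G y *v y) has_derivative (\<lambda>v. G x *v v + d v *v x)) (at x within Om)"
      by (rule bounded_bilinear.FDERIV[OF bounded_bilinear_matrix_vector_mult dG has_derivative_ident])
    then have "((\<lambda>y. y) has_derivative (\<lambda>v. G x *v v + d v *v x)) (at x within Om)"
      by (rule has_derivative_transform[rotated 2]) (use x G(3) gbar_radial in auto)
    from fun_cong[OF Om_derivative_unique[OF x this has_derivative_ident], of v]
    show ?thesis using G(3)[OF x] by (simp add: algebra_simps)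
  qed
  have dx: "d x *v x = 0" using key[of x] gbar_radial[OF x] by simp
  have expand: "d x $ j $ m = (\<Sum>i\<in>UNIV. x $ i * d (axis i 1) $ j $ m)" for j m
  proof -
    have "d x = d (\<Sum>i\<in>UNIV. x $ i *\<^sub>R axis i 1)" by (simp add: basis_expansion flip: scalar_mult_eq_scaleR)
    then show ?thesis by (simp add: linear_sum[OF lin] linear_scale[OF lin])
  qed
  \<comment> \<open>\<open>s1\<close>, \<open>s2\<close> and \<open>s3\<close> are the three parts
    of the Christoffel symbol with lowered index, contracted twice with \<open>x\<close>; each
    vanishes by \<open>key\<close> and the Gauss lemma.\<close>
  have s1: "(\<Sum>i\<in>UNIV. \<Sum>j\<in>UNIV. d (axis i 1) $ j $ m * x $ i * x $ j) = 0" for m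
  proof -
    have "(\<Sum>i\<in>UNIV. \<Sum>j\<in>UNIV. d (axis i 1) $ j $ m * x $ i * x $ j) = (\<Sum>j\<in>UNIV. d x $ j $ m * x $ j)"
      unfolding expand sum_distrib_right by (subst sum.swap) (simp add: mult_ac)
    also have "\<dots> = (\<Sum>j\<in>UNIV. d x $ m $ j * x $ j)"
      by (intro sum.cong refl arg_cong2[of _ _ _ _ "(*)"] dsym)
    also have "\<dots> = (d x *v x) $ m" by (simp add: matrix_vector_mult_def)
    finally show ?thesis by (simp add: dx)
  qed
  have s2: "(\<Sum>i\<in>UNIV. \<Sum>j\<in>UNIV. d (axis j 1) $ i $ m * x $ i * x $ j) = 0" for m
    using s1[of m] by (subst sum.swap) (simp add: mult_ac)
  have s3: "(\<Sum>i\<in>UNIV. \<Sum>j\<in>UNIV. d (axis m 1) $ i $ j * x $ i * x $ j) = 0" for m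
  proof -
    have "(\<Sum>i\<in>UNIV. \<Sum>j\<in>UNIV. d (axis m 1) $ i $ j * x $ i * x $ j) = x \<bullet> (d (axis m 1) *v x)"
      by (simp add: inner_vec_def matrix_vector_mult_def sum_distrib_left mult_ac)
    also have "\<dots> = x \<bullet> axis m 1 - (gbar g x *v x) \<bullet> axis m 1"
      unfolding key inner_diff_right using symmetric_dot_swap[OF gbar_sym[OF x]] by simp
    finally show ?thesis by (simp add: gbar_radial[OF x])
  qed
  have "(\<Sum>i\<in>UNIV. \<Sum>j\<in>UNIV. christoffel Om (gbar g) l i j x * x $ i * x $ j) =
      (\<Sum>i\<in>UNIV. \<Sum>j\<in>UNIV. \<Sum>m\<in>UNIV. (1/2) * matrix_inv (gbar g x) $ l $ m * ((d (axis i 1) $ j $ m + d (axis j 1) $ i $ m - d (axis m 1) $ i $ j) * x $ i * x $ j))"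
    unfolding christoffel_def p sum_distrib_left sum_distrib_right by (intro sum.cong refl) (simp add: mult.assoc)
  also have "\<dots> = (\<Sum>m\<in>UNIV. \<Sum>i\<in>UNIV. \<Sum>j\<in>UNIV. (1/2) * matrix_inv (gbar g x) $ l $ m * ((d (axis i 1) $ j $ m + d (axis j 1) $ i $ m - d (axis m 1) $ i $ j) * x $ i * x $ j))"
    by (rule sum3_rotate[symmetric])
  also have "\<dots> = (\<Sum>m\<in>UNIV. (1/2) * matrix_inv (gbar g x) $ l $ m * (\<Sum>i\<in>UNIV. \<Sum>j\<in>UNIV. (d (axis i 1) $ j $ m + d (axis j 1) $ i $ m - d (axis m 1) $ i $ j) * x $ i * x $ j))"
    unfolding sum_distrib_left by (rule refl)
  also have "\<dots> = 0"
  proof (rule sum.neutral, rule ballI)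
    fix m
    have "(\<Sum>i\<in>UNIV. \<Sum>j\<in>UNIV. (d (axis i 1) $ j $ m + d (axis j 1) $ i $ m - d (axis m 1) $ i $ j) * x $ i * x $ j)
       = (\<Sum>i\<in>UNIV. \<Sum>j\<in>UNIV. d (axis i 1) $ j $ m * x $ i * x $ j) + (\<Sum>i\<in>UNIV. \<Sum>j\<in>UNIV. d (axis j 1) $ i $ m * x $ i * x $ j)
        - (\<Sum>i\<in>UNIV. \<Sum>j\<in>UNIV. d (axis m 1) $ i $ j * x $ i * x $ j)"
      by (simp only: distrib_right left_diff_distrib sum.distrib sum_subtractf)
    then show "(1/2) * matrix_inv (gbar g x) $ l $ m * (\<Sum>i\<in>UNIV. \<Sum>j\<in>UNIV. (d (axis i 1) $ j $ m + d (axis j 1) $ i $ m - d (axis m 1) $ i $ j) * x $ i * x $ j) = 0"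
      unfolding s1 s2 s3 by simp
  qed
  finally show ?thesis .
qed

text \<open>For positive t the factor t^2 cancels from \<open>christoffel_radial\<close>; continuity
  of the symbols supplies t = 0.\<close>

lemma christoffel_ray:
  assumes \<theta>: "norm \<theta> = 1" and t: "0 \<le> t" "t \<le> rad \<theta>"
  shows "(\<Sum>i\<in>UNIV. \<Sum>j\<in>UNIV. christoffel Om (gbar g) l i j (t *\<^sub>R \<theta>) * \<theta> $ i * \<theta> $ j) = 0"
proof -
  have \<theta>0: "\<theta> \<noteq> 0" using \<theta> by auto
  let ?S = "\<lambda>t. \<Sum>i\<in>UNIV. \<Sum>j\<in>UNIV. christoffel Om (gbar g) l i j (t *\<^sub>R \<theta>) * \<theta> $ i * \<theta> $ j"
  have Omt: "t *\<^sub>R \<theta> \<in> Om" if "0 < t" "t \<le> rad \<theta>" for t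
    using that \<theta> bp_scale[OF \<theta>0, of t] \<theta>0 by (subst Om_iff_rad) (auto simp: rad_def)
  have Wt: "t *\<^sub>R \<theta> \<in> W" if "0 < t" "t < rad \<theta>" for t
    using that \<theta> bp_scale[OF \<theta>0, of t] \<theta>0 by (subst W_iff_rad) (auto simp: rad_def)
  have pos: "?S t = 0" if "0 < t" "t \<le> rad \<theta>" for t
  proof -
    have "t * t * ?S t = 0"
      using christoffel_radial[OF Omt[OF that], of l] by (simp add: sum_distrib_left mult_ac)
    then show ?thesis using that by simp
  qed
  have r: "rad \<theta> > 0" using rad_pos[OF \<theta>0] .
  have "?S 0 = 0"
  proof -
    have sub: "(\<lambda>t. t *\<^sub>R \<theta>) ` {0..rad \<theta> / 2} \<subseteq> W"
    proof
      fix y assume "y \<in> (\<lambda>t. t *\<^sub>R \<theta>) ` {0..rad \<theta> / 2}"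
      then obtain t where "0 \<le> t" "t \<le> rad \<theta> / 2" "y = t *\<^sub>R \<theta>" by auto
      then show "y \<in> W" using Wt[of t] zero_W r by (cases "t = 0") auto
    qed
    have "continuous_on {0..rad \<theta> / 2} ?S"
      by (intro continuous_intros continuous_on_compose2[OF Ck_open_continuous_on[OF G.Ck_christoffel[of 0]] _ sub])
    then have "continuous_on (closure {0<..<rad \<theta> / 2}) ?S" using r by simp
    then show ?thesis
      by (rule continuous_constant_on_closure) (use pos r in auto)
  qed
  then show ?thesis using pos t by (cases "t = 0") auto
qed

text \<open>The ray with velocity \<theta> is a geodesic of unit speed. Any other admissible
  geodesic agrees with it as long as both are interior, and its time \<open>T\<close> can be neither
  smaller than \<open>rad \<theta>\<close>, where the ray is still interior, nor larger, where it
  would already have touched the boundary.\<close>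

lemma radial_fun_eq:
  assumes \<theta>: "norm \<theta> = 1"
  shows "radial_fun g \<theta> = rad \<theta>"
proof -
  have \<theta>0: "\<theta> \<noteq> 0" using \<theta> by auto
  have r: "rad \<theta> > 0" using rad_pos[OF \<theta>0] .
  have Omt: "t *\<^sub>R \<theta> \<in> Om" if "0 \<le> t" "t \<le> rad \<theta>" for t
    using that \<theta> bp_scale[OF \<theta>0, of t] \<theta>0 zero_W W_sub
    by (cases "t = 0") (auto simp: Om_iff_rad rad_def)
  have Wt: "t *\<^sub>R \<theta> \<in> W" if "0 \<le> t" "t < rad \<theta>" for t
    using that \<theta> bp_scale[OF \<theta>0, of t] \<theta>0 zero_W
    by (cases "t = 0") (auto simp: W_iff_rad rad_def)
  have fr: "rad \<theta> *\<^sub>R \<theta> \<in> frontier Om"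
    using bp(1)[OF \<theta>0] bp_rad[OF \<theta>0] \<theta> by simp
  have ray: "geodesic_on Om (gbar g) T (\<lambda>t. t *\<^sub>R \<theta>) (\<lambda>_. \<theta>)" if T: "0 < T" "T \<le> rad \<theta>" for T
    unfolding geodesic_on_def
  proof (intro conjI ballI)
    fix t assume t: "t \<in> {0..T}"
    show "t *\<^sub>R \<theta> \<in> Om" using t T by (intro Omt) auto
    show "((\<lambda>t. t *\<^sub>R \<theta>) has_vector_derivative \<theta>) (at t within {0..T})" by (rule ray_derivative)
    have "- (\<chi> l. \<Sum>i\<in>UNIV. \<Sum>j\<in>UNIV. christoffel Om (gbar g) l i j (t *\<^sub>R \<theta>) * \<theta> $ i * \<theta> $ j) = 0"
      using christoffel_ray[OF \<theta>, of t] t T by (simp add: vec_eq_iff)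
    then show "((\<lambda>_. \<theta>) has_vector_derivative - (\<chi> l. \<Sum>i\<in>UNIV. \<Sum>j\<in>UNIV. christoffel Om (gbar g) l i j (t *\<^sub>R \<theta>) * \<theta> $ i * \<theta> $ j)) (at t within {0..T})"
      by (metis has_vector_derivative_const)
  qed (rule T(1))
  have speed1: "riem_inner (gbar g (t *\<^sub>R \<theta>)) \<theta> \<theta> = 1" if t: "0 \<le> t" "t \<le> rad \<theta>" for t
  proof (cases "t = 0")
    case True
    then show ?thesis using \<theta> by (simp add: riem_inner_def gbar_0 norm_eq_1)
  next
    case False
    then have "t *\<^sub>R (gbar g (t *\<^sub>R \<theta>) *v \<theta>) = t *\<^sub>R \<theta>"
      using gbar_radial[OF Omt[OF t]] by (simp add: matrix_vector_mult_scaleR)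
    then show ?thesis using False \<theta> by (simp add: riem_inner_def norm_eq_1)
  qed
  show ?thesis
    unfolding radial_fun_def radial_length_def
  proof (rule the_equality)
    have "curve_length (gbar g) (rad \<theta>) (\<lambda>t. t *\<^sub>R \<theta>) (\<lambda>_. \<theta>) = integral {0..rad \<theta>} (\<lambda>t. 1)"
      unfolding curve_length_def by (rule integral_cong) (simp add: speed1)
    then have "rad \<theta> = curve_length (gbar g) (rad \<theta>) (\<lambda>t. t *\<^sub>R \<theta>) (\<lambda>_. \<theta>)" using r by simp
    then show "\<exists>T c c'. geodesic_on Om (gbar g) T c c' \<and> c 0 = 0 \<and> c' 0 = \<theta> \<and> c ` {0..<T} \<subseteq> W \<and> c T \<in> frontier Om \<and> rad \<theta> = curve_length (gbar g) T c c'"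
      using ray[of "rad \<theta>"] r fr Wt by (intro exI[of _ "rad \<theta>"] exI[of _ "\<lambda>t. t *\<^sub>R \<theta>"] exI[of _ "\<lambda>_. \<theta>"]) auto
    fix L assume "\<exists>T c c'. geodesic_on Om (gbar g) T c c' \<and> c 0 = 0 \<and> c' 0 = \<theta> \<and> c ` {0..<T} \<subseteq> W \<and> c T \<in> frontier Om \<and> L = curve_length (gbar g) T c c'"
    then obtain T c c' where geo: "geodesic_on Om (gbar g) T c c'" and c0: "c 0 = 0" "c' 0 = \<theta>"
      and cW: "c ` {0..<T} \<subseteq> W" and cT: "c T \<in> frontier Om" and L: "L = curve_length (gbar g) T c c'" by blast
    have T: "0 < T" using geo by (simp add: geodesic_on_def)
    have cc: "continuous_on {0..T} c" "continuous_on {0..T} c'"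
      unfolding continuous_on_eq_continuous_within
      using geo has_vector_derivative_continuous unfolding geodesic_on_def by blast+
    have eq: "c t = t *\<^sub>R \<theta> \<and> c' t = \<theta>" if t: "0 \<le> t" "t < T" "t < rad \<theta>" for t
    proof (cases "t = 0")
      case False
      then have t0: "0 < t" using t by simp
      show ?thesis
        by (rule G.geodesic_unique[OF geodesic_on_restrict[OF geo t0] ray[OF t0]])
           (use t t0 c0 cW Wt in \<open>auto simp: image_subset_iff\<close>)
    qed (use c0 in auto)
    define m where "m = min T (rad \<theta>)"
    have m: "0 < m" "m \<le> T" "m \<le> rad \<theta>" using T r by (auto simp: m_def)
    have em: "c m = m *\<^sub>R \<theta>" "c' m = \<theta>"
    proof -
      have sub: "{0..m} \<subseteq> {0..T}" using m by auto
      show "c m = m *\<^sub>R \<theta>"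
        using eq m by (intro continuous_on_agree_endpoint[of m c "\<lambda>t. t *\<^sub>R \<theta>"] continuous_on_subset[OF cc(1) sub] continuous_intros) auto
      show "c' m = \<theta>"
        using eq m by (intro continuous_on_agree_endpoint[of m c' "\<lambda>t. \<theta>"] continuous_on_subset[OF cc(2) sub] continuous_intros) auto
    qed
    have "T = rad \<theta>"
    proof (rule ccontr)
      assume "T \<noteq> rad \<theta>"
      then consider "T < rad \<theta>" | "rad \<theta> < T" by linarith
      then show False
      proof cases
        case 1
        then have "c T \<in> W" using em(1) Wt[of T] T by (simp add: m_def)
        then show False using cT by (simp add: frontier_Om)
      next
        case 2
        then have "c (rad \<theta>) \<in> W" using cW r by auto
        moreover have "c (rad \<theta>) \<in> frontier Om" using em(1) fr 2 by (simp add: m_def)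
        ultimately show False by (simp add: frontier_Om)
      qed
    qed
    then have all: "c t = t *\<^sub>R \<theta> \<and> c' t = \<theta>" if "t \<in> {0..rad \<theta>}" for t
      using eq[of t] em that m_def by (cases "t = rad \<theta>") auto
    have "L = integral {0..rad \<theta>} (\<lambda>t. 1)"
      unfolding L curve_length_def \<open>T = rad \<theta>\<close>
      by (rule integral_cong) (use all speed1 in auto)
    then show "L = rad \<theta>" using r by simp
  qed
qed

text \<open>Suprema bound single values only after boundedness is shown. For the derivative it comes
  from the sum of the absolute partial derivatives, which dominates the operator norm and is
  continuous on the sphere.\<close>

lemma C1_norm_bounds:
  assumes "C1_norm_sphere (\<lambda>\<theta>. radial_fun g \<theta> - R) \<le> \<epsilon>" and \<theta>: "norm \<theta> = 1"
  shows "\<bar>rad \<theta> - R\<bar> \<le> \<epsilon>" "\<bar>frechet_derivative rad (at \<theta>) v\<bar> \<le> \<epsilon> * norm v"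
proof -
  let ?S = "sphere (0::real^'n) 1"
  define A where "A = (SUP \<theta>\<in>?S. \<bar>rad \<theta> - R\<bar>)"
  define D where "D = (SUP \<theta>\<in>?S. onorm (frechet_derivative rad (at \<theta>)))"
  have nz: "x \<noteq> 0" if "x \<in> ?S" for x using that by auto
  have der: "frechet_derivative (\<lambda>x. radial_fun g (sgn x) - R) (at x) = frechet_derivative rad (at x)" if x: "x \<in> ?S" for x
  proof -
    have "((\<lambda>x. rad x - R) has_derivative (\<lambda>v. frechet_derivative rad (at x) v - 0)) (at x)"
      by (intro has_derivative_diff rad_C1(1) nz x has_derivative_const)
    then have "((\<lambda>x. radial_fun g (sgn x) - R) has_derivative (\<lambda>v. frechet_derivative rad (at x) v - 0)) (at x)"
      by (rule has_derivative_transform_within_open[of _ _ _ _ "- {0}"])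
         (use nz[OF x] in \<open>auto simp: open_Compl radial_fun_eq norm_sgn rad_sgn\<close>)
    then show ?thesis using frechet_derivative_at by (metis (no_types, lifting) diff_zero ext)
  qed
  have C: "C1_norm_sphere (\<lambda>\<theta>. radial_fun g \<theta> - R) = A + D"
    unfolding C1_norm_sphere_def A_def D_def by (intro arg_cong2[of _ _ _ _ "(+)"] SUP_cong refl) (auto simp: radial_fun_eq der)
  have "continuous_on ?S (\<lambda>\<theta>. \<bar>rad \<theta> - R\<bar>)"
    unfolding rad_def by (intro continuous_intros continuous_on_subset[OF continuous_on_bp]) auto
  then have bddA: "bdd_above ((\<lambda>\<theta>. \<bar>rad \<theta> - R\<bar>) ` ?S)"
    by (intro bounded_imp_bdd_above compact_imp_bounded compact_continuous_image) auto
  have bl: "bounded_linear (frechet_derivative rad (at x))" if "x \<in> ?S" for x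
    using rad_C1(1)[OF nz[OF that]] by (rule has_derivative_bounded_linear)
  have le: "onorm (frechet_derivative rad (at x)) \<le> (\<Sum>b\<in>Basis. \<bar>frechet_derivative rad (at x) b\<bar>)" if x: "x \<in> ?S" for x
  proof (rule onorm_le)
    fix v
    have lin: "linear (frechet_derivative rad (at x))" using bl[OF x] bounded_linear.linear by blast
    have "frechet_derivative rad (at x) v = frechet_derivative rad (at x) (\<Sum>b\<in>Basis. (v \<bullet> b) *\<^sub>R b)"
      by (simp add: euclidean_representation)
    also have "\<dots> = (\<Sum>b\<in>Basis. (v \<bullet> b) *\<^sub>R frechet_derivative rad (at x) b)"
      by (simp add: linear_sum[OF lin] linear_scale[OF lin])
    also have "norm \<dots> \<le> (\<Sum>b\<in>Basis. \<bar>frechet_derivative rad (at x) b\<bar> * norm v)"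
      by (intro sum_norm_le) (simp add: abs_mult Basis_le_norm mult_right_mono mult.commute)
    finally show "norm (frechet_derivative rad (at x) v) \<le> (\<Sum>b\<in>Basis. \<bar>frechet_derivative rad (at x) b\<bar>) * norm v"
      by (simp add: sum_distrib_right)
  qed
  have "continuous_on ?S (\<lambda>x. \<Sum>b\<in>Basis. \<bar>frechet_derivative rad (at x) b\<bar>)"
    by (intro continuous_intros continuous_on_subset[OF rad_C1(2)]) auto
  then have "bdd_above ((\<lambda>x. \<Sum>b\<in>Basis. \<bar>frechet_derivative rad (at x) b\<bar>) ` ?S)"
    by (intro bounded_imp_bdd_above compact_imp_bounded compact_continuous_image) auto
  then obtain M where "\<forall>x\<in>?S. (\<Sum>b\<in>Basis. \<bar>frechet_derivative rad (at x) b\<bar>) \<le> M"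
    unfolding bdd_above_def by auto
  then have bddD: "bdd_above ((\<lambda>x. onorm (frechet_derivative rad (at x))) ` ?S)"
    using le by (intro bdd_aboveI2[where M=M]) (meson order_trans)
  have \<theta>S: "\<theta> \<in> ?S" using \<theta> by simp
  have uA: "\<bar>rad \<theta> - R\<bar> \<le> A" unfolding A_def by (rule cSUP_upper[OF \<theta>S bddA])
  have uD: "onorm (frechet_derivative rad (at \<theta>)) \<le> D" unfolding D_def by (rule cSUP_upper[OF \<theta>S bddD])
  have "0 \<le> onorm (frechet_derivative rad (at \<theta>))" by (rule onorm_pos_le[OF bl[OF \<theta>S]])
  then have "\<bar>rad \<theta> - R\<bar> \<le> \<epsilon>" and D: "onorm (frechet_derivative rad (at \<theta>)) \<le> \<epsilon>"
    using assms(1) uA uD unfolding C by linarith+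
  then show "\<bar>rad \<theta> - R\<bar> \<le> \<epsilon>" by simp
  have "\<bar>frechet_derivative rad (at \<theta>) v\<bar> \<le> onorm (frechet_derivative rad (at \<theta>)) * norm v"
    using onorm[OF bl[OF \<theta>S], of v] by simp
  also have "\<dots> \<le> \<epsilon> * norm v" using D by (rule mult_right_mono) simp
  finally show "\<bar>frechet_derivative rad (at \<theta>) v\<bar> \<le> \<epsilon> * norm v" .
qed

end

section \<open>Comparison of densities\<close>

text \<open>\<open>kmat e c\<close> acts as the identity on the line through the unit vector \<open>e\<close> and as \<open>c\<close> on its
  orthogonal complement. With \<open>q = s_quot k (norm x)\<close>, \<open>kmat (sgn x) q\<close> is the square root of
  \<open>delta_metric k x\<close>, and \<open>nmat (sgn x) q G\<close> is \<open>G\<close> relative to a \<open>delta_metric\<close>-orthonormal frame.\<close>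

definition kmat :: "real^'n \<Rightarrow> real \<Rightarrow> real^'n^'n" where
  "kmat e c = outer e + c *\<^sub>R (mat 1 - outer e)"

definition nmat :: "real^'n \<Rightarrow> real \<Rightarrow> real^'n^'n \<Rightarrow> real^'n^'n" where
  "nmat e q G = outer e + (1 / q\<^sup>2) *\<^sub>R (G - outer e)"

lemma scaleR_matrix_vec: "(c *\<^sub>R A) *v x = c *\<^sub>R (A *v x)" for A :: "real^'n^'m"
  by (rule scaleR_matrix_vector_assoc[symmetric])

lemma kmat_vec: "kmat e c *v x = (e \<bullet> x) *\<^sub>R e + c *\<^sub>R (x - (e \<bullet> x) *\<^sub>R e)"
  by (simp add: kmat_def matrix_vector_mult_add_rdistrib matrix_vector_mult_diff_rdistrib scaleR_matrix_vec outer_vec)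

lemma transpose_add_scale:
  fixes A B :: "real^'n^'m"
  shows "transpose (A + B) = transpose A + transpose B" "transpose (A - B) = transpose A - transpose B"
    "transpose (c *\<^sub>R A) = c *\<^sub>R transpose A"
  by (simp_all add: transpose_def vec_eq_iff)

lemma transpose_kmat [simp]: "transpose (kmat e c) = kmat e c"
  by (simp add: kmat_def transpose_add_scale transpose_mat)

lemma transpose_nmat: "transpose G = G \<Longrightarrow> transpose (nmat e q G) = nmat e q G"
  by (simp add: nmat_def transpose_add_scale)

lemma kmat_mult:
  assumes "e \<bullet> e = 1"
  shows "kmat e a ** kmat e b = kmat e (a * b)"
proof -
  have "(kmat e a ** kmat e b) *v x = kmat e (a * b) *v x" for x
    unfolding matrix_vector_mul_assoc[symmetric] kmat_vec
    using assms by (simp add: inner_simps)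
  then show ?thesis by (simp add: matrix_eq)
qed

lemma det_scaleR: "det (c *\<^sub>R A) = c ^ CARD('n) * det A" for A :: "real^'n^'n"
proof -
  have "c *\<^sub>R A = diag_matrix (\<lambda>_. c) ** A"
    unfolding matrix_eq matrix_vector_mul_assoc[symmetric] diag_matrix_vec scaleR_matrix_vec
    by (simp add: vec_eq_iff)
  then show ?thesis by (simp add: det_mul det_diag_matrix)
qed

text \<open>For c \<le> 1, \<open>kmat e c\<close> is c times 1 + (1 / c - 1) e e^T, whose
  nonnegative coefficient is the square of a scaling of \<open>e\<close>; for larger c the inverse
  \<open>kmat e (1 / c)\<close> falls under that case.\<close>

lemma det_kmat:
  fixes e :: "real^'n"
  assumes e: "e \<bullet> e = 1" and c: "c > 0"
  shows "det (kmat e c) = c ^ (CARD('n) - 1)"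
proof -
  have pw: "c ^ CARD('n) = c * c ^ (CARD('n) - 1)" for c :: real
    by (metis One_nat_def Suc_pred power_Suc zero_less_card_finite)
  have *: "det (kmat e c) = c ^ (CARD('n) - 1)" if c: "0 < c" "c \<le> 1" for c
  proof -
    have z: "0 \<le> 1 / c - 1" using c by simp
    have "kmat e c = c *\<^sub>R (mat 1 + outer (sqrt (1 / c - 1) *\<^sub>R e))"
      unfolding outer_scaleR real_sqrt_pow2[OF z] kmat_def
      using c by (simp add: algebra_simps)
    then have "det (kmat e c) = c ^ CARD('n) * (1 + (1 / c - 1))"
      using z e by (simp add: det_scaleR det_mat_1_plus_outer)
    then show ?thesis using c by (simp add: pw)
  qed
  show ?thesis
  proof (cases "c \<le> 1")
    case False
    have "kmat e c ** kmat e (1 / c) = mat 1"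
      using kmat_mult[OF e, of c "1 / c"] c by (simp add: kmat_def)
    then have "det (kmat e c) * (1 / c) ^ (CARD('n) - 1) = 1"
      using *[of "1 / c"] False by (metis det_I det_mul divide_le_eq_1 less_eq_real_def not_le zero_less_divide_1_iff c)
    then show ?thesis using c by (simp add: power_one_over field_simps)
  qed (use * c in auto)
qed

text \<open>The metrics \<open>G\<close> below all satisfy the Gauss lemma \<open>G *v e = e\<close> in the radial direction \<open>e\<close>.\<close>

context
  fixes e :: "real^'n" and G :: "real^'n^'n" and q :: real
  assumes e: "e \<bullet> e = 1" and G: "transpose G = G" and Ge: "G *v e = e" and q: "q > 0"
begin

lemma G_split: "G *v x = (e \<bullet> x) *\<^sub>R e + G *v (x - (e \<bullet> x) *\<^sub>R e)"
  by (simp add: matrix_vector_mult_diff_distrib matrix_vector_mult_scaleR Ge)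

lemma G_orth: "e \<bullet> (G *v (x - (e \<bullet> x) *\<^sub>R e)) = 0"
  using symmetric_dot_swap[OF G, of e "x - (e \<bullet> x) *\<^sub>R e"] e by (simp add: Ge inner_diff_right)

lemma nmat_form:
  "x \<bullet> (nmat e q G *v y) = (e \<bullet> x) * (e \<bullet> y) +
     (1 / q\<^sup>2) * ((x - (e \<bullet> x) *\<^sub>R e) \<bullet> (G *v (y - (e \<bullet> y) *\<^sub>R e)))"
proof -
  have "nmat e q G *v y = (e \<bullet> y) *\<^sub>R e + (1 / q\<^sup>2) *\<^sub>R (G *v (y - (e \<bullet> y) *\<^sub>R e))"
    unfolding nmat_def matrix_vector_mult_add_rdistrib scaleR_matrix_vec matrix_vector_mult_diff_rdistrib outer_vec
    by (subst (1) G_split) simp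
  then show ?thesis
    by (simp add: inner_diff_left G_orth inner_add_right inner_commute[of x e])
qed

lemma nmat_congruence: "kmat e q ** nmat e q G ** kmat e q = G"
proof -
  have "x \<bullet> ((transpose (kmat e q) ** nmat e q G ** kmat e q) *v y) = x \<bullet> (G *v y)" for x y
  proof -
    have a: "e \<bullet> (kmat e q *v x) = e \<bullet> x" "kmat e q *v x - (e \<bullet> x) *\<^sub>R e = q *\<^sub>R (x - (e \<bullet> x) *\<^sub>R e)" for x
      using e by (auto simp: kmat_vec inner_simps)
    have "x \<bullet> (G *v y) = (e \<bullet> x) * (e \<bullet> y) + (x - (e \<bullet> x) *\<^sub>R e) \<bullet> (G *v (y - (e \<bullet> y) *\<^sub>R e))"
      by (subst G_split) (simp add: inner_diff_left G_orth inner_add_right inner_commute[of x e])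
    then show ?thesis
      unfolding bilinear_form_congruence nmat_form a using q
      by (simp add: matrix_vector_mult_scaleR power2_eq_square)
  qed
  then show ?thesis by (metis matrix_eq transpose_kmat vector_eq_ldot)
qed

lemma det_nmat: "det G = (q ^ (CARD('n) - 1))\<^sup>2 * det (nmat e q G)"
proof -
  have "det G = det (kmat e q) * det (nmat e q G) * det (kmat e q)"
    by (metis det_mul nmat_congruence)
  then show ?thesis by (simp add: det_kmat[OF e q] power2_eq_square)
qed

text \<open>\<open>J\<close> is the differential of the radial graph with radius \<open>f\<close>
  and gradient \<open>d\<close>. Removing \<open>kmat e s\<close> on both sides turns the pulled
  back metric into \<open>nmat\<close> plus the rank-one term of the slope d / s, and the added
  \<open>outer e\<close> fills the radial direction. For r = f and q = \<open>s_quot k r\<close>,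
  the number \<open>s\<close> is \<open>s_model k r\<close>.\<close>

lemma det_graph:
  assumes de: "d \<bullet> e = 0" and f: "f > 0" and J: "\<And>h. J *v h = (d \<bullet> h) *\<^sub>R e + f *\<^sub>R (h - (e \<bullet> h) *\<^sub>R e)"
  defines "s \<equiv> f * q"
  shows "det (transpose J ** G ** J + outer e) = (s ^ (CARD('n) - 1))\<^sup>2 * det (nmat e q G + outer ((1 / s) *\<^sub>R d))"
proof -
  have s: "s > 0" using f q by (simp add: s_def)
  let ?N = "nmat e q G + outer ((1 / s) *\<^sub>R d)"
  have "x \<bullet> ((transpose J ** G ** J + outer e) *v y) = x \<bullet> ((transpose (kmat e s) ** ?N ** kmat e s) *v y)" for x y
  proof -
    let ?w = "\<lambda>x. x - (e \<bullet> x) *\<^sub>R e"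
    have a: "e \<bullet> (kmat e s *v x) = e \<bullet> x" "kmat e s *v x - (e \<bullet> x) *\<^sub>R e = s *\<^sub>R ?w x" for x
      using e by (auto simp: kmat_vec inner_simps)
    have dk: "d \<bullet> (kmat e s *v x) = s * (d \<bullet> x)" for x
      using de by (simp add: kmat_vec inner_simps)
    have "(kmat e s *v x) \<bullet> (?N *v (kmat e s *v y)) = (e \<bullet> x) * (e \<bullet> y) + (1 / q\<^sup>2) * (s * s * (?w x \<bullet> (G *v ?w y))) + (d \<bullet> x) * (d \<bullet> y)"
      unfolding matrix_vector_mult_add_rdistrib inner_add_right nmat_form a outer_vec
      using s by (simp add: matrix_vector_mult_scaleR dk inner_commute[of "kmat e s *v x" d])
    moreover have "(J *v x) \<bullet> (G *v (J *v y)) = (d \<bullet> x) * (d \<bullet> y) + f * f * (?w x \<bullet> (G *v ?w y))"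
    proof -
      have "e \<bullet> ?w x = 0" for x using e by (simp add: inner_diff_right)
      then have "(G *v ?w x) \<bullet> e = 0" "?w x \<bullet> e = 0" for x using G_orth inner_commute by metis+
      then show ?thesis unfolding J using e G_orth
        by (simp add: matrix_vector_right_distrib matrix_vector_mult_scaleR Ge inner_add_left inner_add_right)
    qed
    moreover have "(1 / q\<^sup>2) * (s * s * X) = f * f * X" for X using q by (simp add: s_def power2_eq_square)
    ultimately show ?thesis
      unfolding matrix_vector_mult_add_rdistrib inner_add_right bilinear_form_congruence outer_vec
      by (simp add: inner_commute[of x e])
  qed
  then have "transpose J ** G ** J + outer e = kmat e s ** ?N ** kmat e s"
    by (metis matrix_eq transpose_kmat vector_eq_ldot)
  then show ?thesis by (simp add: det_mul det_kmat[OF e s] power2_eq_square)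
qed

end

section \<open>Model functions and the density of the model metric\<close>

definition s_quot :: "real \<Rightarrow> real \<Rightarrow> real" where
  "s_quot k r = (if r = 0 then 1 else s_model k r / r)"

lemma s_model_ge:
  assumes k: "k \<le> 0" and r: "0 \<le> r" shows "r \<le> s_model k r"
proof -
  have "s_model k (1 * 0) - 0 \<le> s_model k (1 * r) - r"
  proof (rule DERIV_nonneg_imp_nondecreasing[OF r])
    fix t :: real
    have "((\<lambda>t. s_model k (1 * t) - t) has_real_derivative 1 * c_model k (1 * t) - 1) (at t)"
      by (intro DERIV_diff s_model_derivative[OF k] DERIV_ident)
    moreover have "0 \<le> 1 * c_model k (1 * t) - 1" by (simp add: c_model_def cosh_real_ge_1)
    ultimately show "\<exists>y. ((\<lambda>t. s_model k (1 * t) - t) has_real_derivative y) (at t) \<and> 0 \<le> y" by blast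
  qed
  then show ?thesis by simp
qed

lemma s_model_mono:
  assumes k: "k \<le> 0" and r: "r \<le> t" shows "s_model k r \<le> s_model k t"
proof -
  have "s_model k (1 * r) \<le> s_model k (1 * t)"
  proof (rule DERIV_nonneg_imp_nondecreasing[OF r])
    fix t :: real
    have "((\<lambda>t. s_model k (1 * t)) has_real_derivative 1 * c_model k (1 * t)) (at t)"
      by (rule s_model_derivative[OF k])
    moreover have "0 \<le> 1 * c_model k (1 * t)" by (simp add: c_model_def)
    ultimately show "\<exists>y. ((\<lambda>t. s_model k (1 * t)) has_real_derivative y) (at t) \<and> 0 \<le> y" by blast
  qed
  then show ?thesis by simp
qed

lemma s_quot_ge_1: "k \<le> 0 \<Longrightarrow> 0 \<le> r \<Longrightarrow> 1 \<le> s_quot k r"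
  using s_model_ge[of k r] by (simp add: s_quot_def)

lemma isCont_s_model: "k \<le> 0 \<Longrightarrow> isCont (s_model k) r"
  using DERIV_isCont[OF s_model_derivative(1)[of k 1 r]] by simp

lemma s_quot_continuous:
  assumes k: "k \<le> 0" shows "isCont (s_quot k) r"
proof (cases "r = 0")
  case True
  have "((\<lambda>t. s_model k (1 * t)) has_real_derivative 1 * c_model k (1 * 0)) (at 0)"
    by (rule s_model_derivative[OF k])
  moreover have "c_model k 0 = 1" by (simp add: c_model_def)
  ultimately have "(s_model k has_real_derivative 1) (at 0)" by simp
  then have "((\<lambda>h. s_model k h / h) \<longlongrightarrow> 1) (at 0)" unfolding DERIV_def by simp
  then have "(s_quot k \<longlongrightarrow> 1) (at 0)"
    by (rule Lim_transform_eventually) (auto simp: s_quot_def eventually_at intro!: exI[of _ 1])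
  then show ?thesis using True by (simp add: isCont_def s_quot_def)
next
  case False
  have "isCont (\<lambda>r. s_model k r / r) r" using False isCont_s_model[OF k] by (intro continuous_intros)
  moreover have "\<forall>\<^sub>F t in nhds r. s_model k t / t = s_quot k t"
    using t1_space_nhds[OF False] by eventually_elim (simp add: s_quot_def)
  ultimately show ?thesis by (simp add: isCont_cong)
qed

lemma delta_metric_kmat:
  "x \<noteq> 0 \<Longrightarrow> delta_metric k x = kmat (sgn x) (s_quot k (norm x)) ** kmat (sgn x) (s_quot k (norm x))"
  by (subst kmat_mult) (auto simp: delta_metric_def Let_def outer_def[symmetric] kmat_def s_quot_def power2_eq_square norm_eq_1[symmetric] norm_sgn)

lemma sgn_unit: "x \<noteq> 0 \<Longrightarrow> sgn x \<bullet> sgn x = (1::real)" for x :: "'a::real_inner"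
  by (simp add: norm_eq_1[symmetric] norm_sgn)

lemma delta_metric_facts:
  assumes x: "x \<noteq> 0" and k: "k \<le> 0"
  shows "transpose (delta_metric k x) = delta_metric k x" "delta_metric k x *v sgn x = sgn x"
    "nmat (sgn x) (s_quot k (norm x)) (delta_metric k x) = mat 1"
proof -
  have q: "s_quot k (norm x) > 0" using s_quot_ge_1[OF k, of "norm x"] by simp
  have d: "delta_metric k x = kmat (sgn x) (s_quot k (norm x) * s_quot k (norm x))"
    using delta_metric_kmat[OF x] kmat_mult[OF sgn_unit[OF x]] by metis
  show "transpose (delta_metric k x) = delta_metric k x" unfolding d by simp
  show "delta_metric k x *v sgn x = sgn x" unfolding d kmat_vec using sgn_unit[OF x] by simp
  show "nmat (sgn x) (s_quot k (norm x)) (delta_metric k x) = mat 1"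
    unfolding d nmat_def kmat_def using q by (simp add: power2_eq_square)
qed

lemma sqrt_det_delta:
  fixes x :: "real^'n"
  assumes k: "k \<le> 0"
  shows "sqrt (det (delta_metric k x)) = s_quot k (norm x) ^ (CARD('n) - 1)"
proof (cases "x = 0")
  case True
  then show ?thesis by (simp add: delta_metric_def s_quot_def)
next
  case False
  have q: "s_quot k (norm x) > 0" using s_quot_ge_1[OF k, of "norm x"] by simp
  show ?thesis
    using det_nmat[OF sgn_unit[OF False] delta_metric_facts(1,2)[OF False k] q] q
    by (simp add: delta_metric_facts(3)[OF False k] real_sqrt_unique)
qed

section \<open>Volume and boundary densities relative to the model\<close>

context star_metric
begin

definition Mx where "Mx x = nmat (sgn x) (s_quot k (norm x)) (gbar g x)"

text \<open>The ratio of the volume densities of \<open>gbar g\<close> and \<open>delta_metric k\<close>.\<close>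

definition lam where "lam x = sqrt (det (Mx x))"

lemma gbar_sgn: "x \<in> Om \<Longrightarrow> x \<noteq> 0 \<Longrightarrow> gbar g x *v sgn x = sgn x"
  using gbar_radial[of x] by (simp add: sgn_div_norm matrix_vector_mult_scaleR)

lemma Mx_form:
  assumes x: "x \<in> Om" "x \<noteq> 0" and k: "k \<le> 0"
  shows "v \<bullet> (Mx x *v v) = (sgn x \<bullet> v)\<^sup>2 + (1 / (s_quot k (norm x))\<^sup>2) * ((v - (sgn x \<bullet> v) *\<^sub>R sgn x) \<bullet> (gbar g x *v (v - (sgn x \<bullet> v) *\<^sub>R sgn x)))"
  using nmat_form[OF sgn_unit[OF x(2)] gbar_sym[OF x(1)] gbar_sgn[OF x]] s_quot_ge_1[OF k, of "norm x"]
  unfolding Mx_def by (simp add: power2_eq_square)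

lemma transpose_Mx: "x \<in> Om \<Longrightarrow> transpose (Mx x) = Mx x"
  unfolding Mx_def by (intro transpose_nmat gbar_sym)

text \<open>\<open>gbar_monotone\<close> multiplied by |x|^2. In terms of \<open>s_quot\<close> both
  sides extend continuously to s = 0, where \<open>gbar g\<close> is the identity; that is the
  initial value used in \<open>Mx_ge\<close>.\<close>

lemma s_quot_ray_mono:
  assumes x: "x \<in> Om" "x \<noteq> 0" and w: "w \<bullet> x = 0" and k: "k \<le> 0" and s: "0 \<le> s" "s \<le> 1"
  shows "(1 / (s_quot k (norm x * s))\<^sup>2) * (w \<bullet> (gbar g (s *\<^sub>R x) *v w)) \<le> (1 / (s_quot k (norm x))\<^sup>2) * (w \<bullet> (gbar g x *v w))"
proof -
  let ?f = "\<lambda>s. (1 / (s_quot k (norm x * s))\<^sup>2) * (w \<bullet> (gbar g (s *\<^sub>R x) *v w))"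
  have q: "1 / (s_quot k (norm x * t))\<^sup>2 = (norm x)\<^sup>2 * (t\<^sup>2 / (s_model k (norm x * t))\<^sup>2)" if "0 < t" for t
    using that x(2) by (simp add: s_quot_def power_divide power_mult_distrib)
  have pos: "?f s \<le> ?f 1" if s: "0 < s" "s \<le> 1" for s
  proof -
    have "(norm x)\<^sup>2 * (s\<^sup>2 / (s_model k (norm x * s))\<^sup>2 * (w \<bullet> (gbar g (s *\<^sub>R x) *v w))) \<le>
        (norm x)\<^sup>2 * (1\<^sup>2 / (s_model k (norm x * 1))\<^sup>2 * (w \<bullet> (gbar g (1 *\<^sub>R x) *v w)))"
      by (intro mult_left_mono gbar_monotone[OF x w k s]) auto
    then show ?thesis unfolding q[OF s(1)] q[OF zero_less_one] by (simp only: mult.assoc)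
  qed
  show ?thesis
  proof (cases "s = 0")
    case True
    have "continuous_on {0..1} ?f"
    proof (intro continuous_on_mult continuous_on_divide continuous_on_power continuous_on_inner continuous_on_const
         bounded_bilinear.continuous_on[OF bounded_bilinear_matrix_vector_mult] gbar_ray_continuous[OF x(1)])
      show "continuous_on {0..1} (\<lambda>t. s_quot k (norm x * t))"
        by (intro continuous_at_imp_continuous_on ballI isCont_o2[OF _ s_quot_continuous[OF k]] continuous_intros)
      show "\<forall>t\<in>{0..1}. (s_quot k (norm x * t))\<^sup>2 \<noteq> 0"
        using s_quot_ge_1[OF k, of "norm x * _"] by (metis atLeastAtMost_iff mult_nonneg_nonneg norm_ge_zero not_one_le_zero power_eq_0_iff)
    qed
    then have "continuous_on (closure {0<..<1}) ?f" by simp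
    then have "?f 0 \<le> ?f 1"
      by (rule continuous_le_on_closure) (use pos in auto)
    then show ?thesis using True by simp
  next
    case False
    then show ?thesis using pos[of s] s by simp
  qed
qed

lemma orth_w: "x \<noteq> 0 \<Longrightarrow> (v - (sgn x \<bullet> v) *\<^sub>R sgn x) \<bullet> x = 0" for x v :: "real^'n"
proof -
  assume x: "x \<noteq> 0"
  have "(v - (sgn x \<bullet> v) *\<^sub>R sgn x) \<bullet> sgn x = 0"
    using sgn_unit[OF x] by (simp add: inner_diff_left inner_commute[of v])
  moreover have "x = norm x *\<^sub>R sgn x" using x by (simp add: sgn_div_norm)
  ultimately show ?thesis by (metis inner_scaleR_right mult_zero_right)
qed

lemma Mx_mono:
  assumes x: "x \<in> Om" "x \<noteq> 0" and k: "k \<le> 0" and s: "0 < s" "s \<le> 1"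
  shows "v \<bullet> (Mx (s *\<^sub>R x) *v v) \<le> v \<bullet> (Mx x *v v)"
proof -
  have sx: "s *\<^sub>R x \<in> Om" "s *\<^sub>R x \<noteq> 0" "sgn (s *\<^sub>R x) = sgn x" "norm (s *\<^sub>R x) = norm x * s"
    using Om_scale[OF x(1), of s] x(2) s by (auto simp: sgn_scaleR mult.commute)
  show ?thesis
    unfolding Mx_form[OF x k] Mx_form[OF sx(1,2) k] sx(3,4)
    using s_quot_ray_mono[OF x orth_w[OF x(2)] k, of s v] s by simp
qed

lemma Mx_ge:
  assumes x: "x \<in> Om" "x \<noteq> 0" and k: "k \<le> 0"
  shows "v \<bullet> v \<le> v \<bullet> (Mx x *v v)"
proof -
  let ?w = "v - (sgn x \<bullet> v) *\<^sub>R sgn x"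
  have "v \<bullet> v = (sgn x \<bullet> v)\<^sup>2 + ?w \<bullet> ?w"
    using sgn_unit[OF x(2)] by (simp add: inner_diff_left inner_diff_right power2_eq_square inner_commute)
  moreover have "?w \<bullet> ?w \<le> (1 / (s_quot k (norm x))\<^sup>2) * (?w \<bullet> (gbar g x *v ?w))"
    using s_quot_ray_mono[OF x orth_w[OF x(2)] k, of 0 v] by (simp add: gbar_0 s_quot_def)
  ultimately show ?thesis unfolding Mx_form[OF x k] by simp
qed

lemma Mx_pos_def:
  assumes x: "x \<in> Om" "x \<noteq> 0" and k: "k \<le> 0"
  shows "pos_def_sym (Mx x)"
  unfolding pos_def_sym_def
proof (intro conjI allI impI)
  show "transpose (Mx x) = Mx x" by (rule transpose_Mx[OF x(1)])
  fix v :: "real^'n" assume "v \<noteq> 0"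
  then have "0 < v \<bullet> v" by simp
  then show "0 < v \<bullet> (Mx x *v v)" using Mx_ge[OF x k, of v] by linarith
qed

lemma pos_def_sym_mat_1: "pos_def_sym (mat 1)"
  by (simp add: pos_def_sym_def transpose_mat)

lemma det_Mx:
  assumes x: "x \<in> Om" "x \<noteq> 0" and k: "k \<le> 0"
  shows "1 \<le> det (Mx x)" "det (Mx x) = 1 \<Longrightarrow> Mx x = mat 1"
proof -
  have "v \<bullet> (mat 1 *v v) \<le> v \<bullet> (Mx x *v v)" for v using Mx_ge[OF x k, of v] by simp
  from det_mono(2,3)[OF pos_def_sym_mat_1 transpose_Mx[OF x(1)] this]
  show "1 \<le> det (Mx x)" "det (Mx x) = 1 \<Longrightarrow> Mx x = mat 1" by auto
qed

lemma lam_ge_1: "x \<in> Om \<Longrightarrow> x \<noteq> 0 \<Longrightarrow> k \<le> 0 \<Longrightarrow> 1 \<le> lam x"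
  using det_Mx(1) by (simp add: lam_def)

text \<open>\<open>x\<close> is a multiple of \<open>bp x\<close> with factor
  \<open>norm x / rad x\<close>, so \<open>Mx_mono\<close> along this ray and
  \<open>det_mono\<close> apply. The volume gain is thereby controlled by boundary values
  alone.\<close>

lemma lam_mono:
  assumes x: "x \<in> Om" "x \<noteq> 0" and k: "k \<le> 0"
  shows "lam x \<le> lam (bp x)"
proof -
  define s where "s = norm x / rad x"
  have s: "0 < s" "s \<le> 1" using x rad_pos[OF x(2)] Om_iff_rad[OF x(2)] by (auto simp: s_def)
  have xs: "s *\<^sub>R bp x = x" using rad_pos[OF x(2)] x(2) by (simp add: s_def bp_rad[OF x(2)])
  have "det (Mx (s *\<^sub>R bp x)) \<le> det (Mx (bp x))"
    using Mx_mono[OF bp_Om[OF x(2)] bp_nonzero[OF x(2)] k s] xs x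
    by (intro det_mono(2) Mx_pos_def k transpose_Mx bp_Om) auto
  then show ?thesis by (simp add: xs lam_def)
qed

lemma lam_eq_1:
  assumes x: "x \<in> Om" "x \<noteq> 0" and k: "k \<le> 0" and "lam x = 1"
  shows "gbar g x = delta_metric k x"
proof -
  have q: "s_quot k (norm x) > 0" using s_quot_ge_1[OF k, of "norm x"] by simp
  have "det (Mx x) = 1" using assms(4) by (simp add: lam_def)
  then have "Mx x = mat 1" by (rule det_Mx(2)[OF x k])
  then show ?thesis
    using nmat_congruence[OF sgn_unit[OF x(2)] gbar_sym[OF x(1)] gbar_sgn[OF x] q] delta_metric_kmat[OF x(2), of k]
    by (simp add: Mx_def)
qed

lemma sqrt_det_gbar:
  assumes x: "x \<in> Om" "x \<noteq> 0" and k: "k \<le> 0"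
  shows "sqrt (det (gbar g x)) = s_quot k (norm x) ^ (CARD('n) - 1) * lam x"
proof -
  have q: "s_quot k (norm x) > 0" using s_quot_ge_1[OF k, of "norm x"] by simp
  show ?thesis
    using det_nmat[OF sgn_unit[OF x(2)] gbar_sym[OF x(1)] gbar_sgn[OF x] q] q
    by (simp add: Mx_def lam_def real_sqrt_mult)
qed

definition rgrad where "rgrad \<theta> = (\<chi> i. frechet_derivative rad (at \<theta>) (axis i 1))"

lemma rgrad_inner: "\<theta> \<noteq> 0 \<Longrightarrow> rgrad \<theta> \<bullet> h = frechet_derivative rad (at \<theta>) h"
proof -
  assume "\<theta> \<noteq> 0"
  then have lin: "linear (frechet_derivative rad (at \<theta>))" using rad_C1(1) has_derivative_linear by blast
  have "frechet_derivative rad (at \<theta>) h = frechet_derivative rad (at \<theta>) (\<Sum>i\<in>UNIV. h $ i *\<^sub>R axis i 1)"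
    by (simp add: basis_expansion flip: scalar_mult_eq_scaleR)
  then show ?thesis
    by (simp add: linear_sum[OF lin] linear_scale[OF lin] rgrad_def inner_vec_def mult.commute)
qed

lemma jacobian_bp:
  assumes \<theta>: "norm \<theta> = 1"
  shows "jacobian (\<lambda>x. bp (sgn x)) (at \<theta>) *v h = (rgrad \<theta> \<bullet> h) *\<^sub>R \<theta> + rad \<theta> *\<^sub>R (h - (\<theta> \<bullet> h) *\<^sub>R \<theta>)"
proof -
  have \<theta>0: "\<theta> \<noteq> 0" using \<theta> by auto
  let ?D = "\<lambda>h. (rgrad \<theta> \<bullet> h) *\<^sub>R \<theta> + rad \<theta> *\<^sub>R (h - (\<theta> \<bullet> h) *\<^sub>R \<theta>)"
  have 1: "((\<lambda>x. inverse (norm x)) has_derivative (\<lambda>h. - (inverse (norm \<theta>) * (h \<bullet> sgn \<theta>) * inverse (norm \<theta>)))) (at \<theta>)"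
    by (rule Deriv.has_derivative_inverse[OF _ has_derivative_norm[OF \<theta>0]]) (use \<theta>0 in simp)
  have 2: "((\<lambda>x. (rad x * inverse (norm x)) *\<^sub>R x) has_derivative
     (\<lambda>h. (rad \<theta> * inverse (norm \<theta>)) *\<^sub>R h + (rad \<theta> * - (inverse (norm \<theta>) * (h \<bullet> sgn \<theta>) * inverse (norm \<theta>)) + frechet_derivative rad (at \<theta>) h * inverse (norm \<theta>)) *\<^sub>R \<theta>)) (at \<theta>)"
    by (rule has_derivative_scaleR[OF has_derivative_mult[OF rad_C1(1)[OF \<theta>0] 1] has_derivative_ident])
  have "(\<lambda>h. (rad \<theta> * inverse (norm \<theta>)) *\<^sub>R h + (rad \<theta> * - (inverse (norm \<theta>) * (h \<bullet> sgn \<theta>) * inverse (norm \<theta>)) + frechet_derivative rad (at \<theta>) h * inverse (norm \<theta>)) *\<^sub>R \<theta>) = ?D"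
    using \<theta> by (auto simp: rgrad_inner[OF \<theta>0] sgn_div_norm algebra_simps inner_commute[of _ \<theta>])
  with 2 have "((\<lambda>x. (rad x * inverse (norm x)) *\<^sub>R x) has_derivative ?D) (at \<theta>)" by simp
  then have D: "((\<lambda>x. bp (sgn x)) has_derivative ?D) (at \<theta>)"
    by (rule has_derivative_transform_within_open[of _ _ _ _ "- {0}"])
       (use \<theta>0 in \<open>auto simp: open_Compl bp_sgn bp_rad divide_inverse\<close>)
  show ?thesis
    unfolding jacobian_def frechet_derivative_at[OF D, symmetric]
    using has_derivative_linear[OF D] by (simp add: matrix_works)
qed

text \<open>The squared slope of the boundary against the model sphere of radius
  \<open>rad \<theta>\<close>; sqrt (1 + slope2) is the factor of the model area density in
  \<open>hypersurface_integrand\<close>.\<close>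

definition slope2 where "slope2 \<theta> = (rgrad \<theta> \<bullet> rgrad \<theta>) / (s_model k (rad \<theta>))\<^sup>2"

lemma boundary_facts:
  assumes \<theta>: "norm \<theta> = 1"
  shows "bp \<theta> \<in> Om" "bp \<theta> \<noteq> 0" "sgn (bp \<theta>) = \<theta>" "norm (bp \<theta>) = rad \<theta>" "rad \<theta> > 0" "rgrad \<theta> \<bullet> \<theta> = 0"
proof -
  have \<theta>0: "\<theta> \<noteq> 0" using \<theta> by auto
  show "bp \<theta> \<in> Om" "bp \<theta> \<noteq> 0" "norm (bp \<theta>) = rad \<theta>" "rad \<theta> > 0"
    using bp_Om bp_nonzero rad_pos \<theta>0 by (auto simp: rad_def)
  show "sgn (bp \<theta>) = \<theta>" using rad_pos[OF \<theta>0] \<theta> by (simp add: bp_rad[OF \<theta>0] sgn_scaleR sgn_div_norm)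
  show "rgrad \<theta> \<bullet> \<theta> = 0" by (simp add: rgrad_inner[OF \<theta>0] rad_derivative_radial[OF \<theta>0])
qed

text \<open>\<open>G\<close> is left general so that one formula serves both \<open>gbar g\<close>
  and \<open>delta_metric k\<close> at the boundary point.\<close>

lemma boundary_density:
  assumes \<theta>: "norm \<theta> = 1" and k: "k \<le> 0" and G: "transpose G = G" "G *v \<theta> = \<theta>"
  shows "sqrt (det (transpose (jacobian (\<lambda>x. bp (sgn x)) (at \<theta>)) ** G ** jacobian (\<lambda>x. bp (sgn x)) (at \<theta>) + outer \<theta>))
    = s_model k (rad \<theta>) ^ (CARD('n) - 1) * sqrt (det (nmat \<theta> (s_quot k (rad \<theta>)) G + outer ((1 / s_model k (rad \<theta>)) *\<^sub>R rgrad \<theta>)))"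
proof -
  note b = boundary_facts[OF \<theta>]
  have q: "s_quot k (rad \<theta>) > 0" using s_quot_ge_1[OF k, of "rad \<theta>"] b(5) by simp
  have s: "rad \<theta> * s_quot k (rad \<theta>) = s_model k (rad \<theta>)" using b(5) by (simp add: s_quot_def)
  have u: "\<theta> \<bullet> \<theta> = 1" using \<theta> by (simp add: norm_eq_1)
  show ?thesis
    using det_graph[OF u G q b(6,5) jacobian_bp[OF \<theta>]] s_model_pos[OF k b(5)]
    by (simp add: s real_sqrt_mult)
qed

lemma hypersurface_integrand:
  assumes \<theta>: "norm \<theta> = 1" and k: "k \<le> 0"
  shows "(let J = jacobian (\<lambda>x. bp (sgn x)) (at \<theta>) in sqrt (det (transpose J ** gbar g (bp \<theta>) ** J + (\<chi> i j. \<theta> $ i * \<theta> $ j))))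
     = s_model k (rad \<theta>) ^ (CARD('n) - 1) * sqrt (det (Mx (bp \<theta>) + outer ((1 / s_model k (rad \<theta>)) *\<^sub>R rgrad \<theta>)))"
    and "(let J = jacobian (\<lambda>x. bp (sgn x)) (at \<theta>) in sqrt (det (transpose J ** delta_metric k (bp \<theta>) ** J + (\<chi> i j. \<theta> $ i * \<theta> $ j))))
     = s_model k (rad \<theta>) ^ (CARD('n) - 1) * sqrt (1 + slope2 \<theta>)"
proof -
  note b = boundary_facts[OF \<theta>]
  show "(let J = jacobian (\<lambda>x. bp (sgn x)) (at \<theta>) in sqrt (det (transpose J ** gbar g (bp \<theta>) ** J + (\<chi> i j. \<theta> $ i * \<theta> $ j))))
     = s_model k (rad \<theta>) ^ (CARD('n) - 1) * sqrt (det (Mx (bp \<theta>) + outer ((1 / s_model k (rad \<theta>)) *\<^sub>R rgrad \<theta>)))"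
    using boundary_density[OF \<theta> k gbar_sym[OF b(1)]] gbar_sgn[OF b(1,2)]
    by (simp add: Let_def outer_def[symmetric] b(3,4) Mx_def)
  show "(let J = jacobian (\<lambda>x. bp (sgn x)) (at \<theta>) in sqrt (det (transpose J ** delta_metric k (bp \<theta>) ** J + (\<chi> i j. \<theta> $ i * \<theta> $ j))))
     = s_model k (rad \<theta>) ^ (CARD('n) - 1) * sqrt (1 + slope2 \<theta>)"
    using boundary_density[OF \<theta> k delta_metric_facts(1)[OF b(2) k]] delta_metric_facts(2,3)[OF b(2) k]
    by (simp add: Let_def outer_def[symmetric] b(3,4) det_mat_1_plus_outer slope2_def power2_eq_square)
qed

text \<open>The slope of the boundary weakens the gain from \<open>lam\<close> only by the factor \<open>1 / sqrt (1 + slope2)\<close>.\<close>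

lemma boundary_gain:
  assumes \<theta>: "norm \<theta> = 1" and k: "k \<le> 0"
  shows "sqrt (1 + slope2 \<theta>) + (lam (bp \<theta>) - 1) / sqrt (1 + slope2 \<theta>)
      \<le> sqrt (det (Mx (bp \<theta>) + outer ((1 / s_model k (rad \<theta>)) *\<^sub>R rgrad \<theta>)))"
proof -
  note b = boundary_facts[OF \<theta>]
  let ?l = "lam (bp \<theta>)" and ?p = "slope2 \<theta>"
  have l: "1 \<le> ?l" by (rule lam_ge_1[OF b(1,2) k])
  have p: "0 \<le> ?p" by (simp add: slope2_def)
  \<comment> \<open>The square roots cancel in the mixed term. Once the denominator of the last term
    is dropped, the sum is exactly l^2 + p.\<close>
  have "(sqrt (1 + ?p) + (?l - 1) / sqrt (1 + ?p))\<^sup>2 = 1 + ?p + 2 * (?l - 1) + (?l - 1)\<^sup>2 / (1 + ?p)"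
  proof -
    have r: "sqrt (1 + ?p) \<noteq> 0" "(sqrt (1 + ?p))\<^sup>2 = 1 + ?p" using p by auto
    have "(sqrt (1 + ?p) + (?l - 1) / sqrt (1 + ?p))\<^sup>2 = (sqrt (1 + ?p))\<^sup>2 + 2 * (?l - 1) + (?l - 1)\<^sup>2 / (sqrt (1 + ?p))\<^sup>2"
      using r(1) by (simp add: power2_sum power_divide)
    then show ?thesis unfolding r(2) .
  qed
  also have "(?l - 1)\<^sup>2 / (1 + ?p) \<le> (?l - 1)\<^sup>2" using p by (simp add: divide_le_eq mult_le_cancel_left1)
  finally have "(sqrt (1 + ?p) + (?l - 1) / sqrt (1 + ?p))\<^sup>2 \<le> ?l\<^sup>2 + ?p"
    by (simp add: power2_eq_square algebra_simps)
  also have "?l\<^sup>2 = det (Mx (bp \<theta>))" using det_Mx(1)[OF b(1,2) k] by (simp add: lam_def)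
  also have "det (Mx (bp \<theta>)) + ?p \<le> det (Mx (bp \<theta>) + outer ((1 / s_model k (rad \<theta>)) *\<^sub>R rgrad \<theta>))"
  proof -
    have "?p = ((1 / s_model k (rad \<theta>)) *\<^sub>R rgrad \<theta>) \<bullet> ((1 / s_model k (rad \<theta>)) *\<^sub>R rgrad \<theta>)"
      by (simp add: slope2_def power2_eq_square)
    then show ?thesis
      using det_plus_outer_ge[OF transpose_Mx[OF b(1)] Mx_ge[OF b(1,2) k]] by metis
  qed
  finally show ?thesis by (rule real_le_rsqrt)
qed

end

section \<open>The isoperimetric comparison\<close>

lemma continuous_on_det:
  fixes A :: "'a::topological_space \<Rightarrow> real^'n^'n"
  assumes "\<And>i j. continuous_on S (\<lambda>x. A x $ i $ j)"
  shows "continuous_on S (\<lambda>x. det (A x))"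
  unfolding det_def by (intro continuous_on_sum continuous_on_mult continuous_on_const continuous_on_prod assms)

text \<open>Tends to 1 as \<open>e\<close> tends to 0: the factor lost in comparing the gain of boundary area with the
  gain of volume.\<close>

definition gain_const :: "nat \<Rightarrow> (real \<Rightarrow> real) \<Rightarrow> real \<Rightarrow> real \<Rightarrow> real \<Rightarrow> real" where
  "gain_const m W k R e =
     (s_model k (R - e) ^ m / sqrt (1 + (2 * e / R)\<^sup>2)) / (s_model k (R + e) ^ m * sqrt (1 + (2 * e / R)\<^sup>2))
       * (W (R - e) / W (R + 2 * e))"

text \<open>All factors converge as \<open>e\<close> decreases to 0. The side condition keeps R - e
  above R / 2, on which the slope estimate relies.\<close>

lemma gain_const_near_1:
  assumes k: "k \<le> 0" and R: "R > 0" and W: "isCont W R" "W R > 0" and q: "q < 1"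
  shows "\<exists>e>0. 2 * e < R \<and> q < gain_const m W k R e"
proof -
  have sR: "s_model k R > 0" by (rule s_model_pos[OF k R])
  let ?F = "at_right (0::real)"
  have e0: "((\<lambda>e. e) \<longlongrightarrow> 0) ?F" by (rule tendsto_ident_at)
  have l1: "((\<lambda>e. R - e) \<longlongrightarrow> R) ?F" using tendsto_diff[OF tendsto_const e0, of R] by simp
  have l2: "((\<lambda>e. R + e) \<longlongrightarrow> R) ?F" using tendsto_add[OF tendsto_const e0, of R] by simp
  have l3: "((\<lambda>e. R + 2 * e) \<longlongrightarrow> R) ?F"
    using tendsto_add[OF tendsto_const tendsto_mult[OF tendsto_const e0], of R 2] by simp
  have "((\<lambda>e. 2 * e / R) \<longlongrightarrow> 2 * 0 / R) ?F"
    by (rule tendsto_divide[OF tendsto_mult[OF tendsto_const e0] tendsto_const]) (use R in simp)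
  from tendsto_real_sqrt[OF tendsto_add[OF tendsto_const tendsto_power[OF this, of 2], of 1]]
  have l4: "((\<lambda>e. sqrt (1 + (2 * e / R)\<^sup>2)) \<longlongrightarrow> 1) ?F" by simp
  have s1: "((\<lambda>e. s_model k (R - e) ^ m) \<longlongrightarrow> s_model k R ^ m) ?F"
    by (rule tendsto_power[OF isCont_tendsto_compose[OF isCont_s_model[OF k] l1]])
  have s2: "((\<lambda>e. s_model k (R + e) ^ m) \<longlongrightarrow> s_model k R ^ m) ?F"
    by (rule tendsto_power[OF isCont_tendsto_compose[OF isCont_s_model[OF k] l2]])
  have "(gain_const m W k R \<longlongrightarrow> (s_model k R ^ m / 1) / (s_model k R ^ m * 1) * (W R / W R)) ?F"
    unfolding gain_const_def
    by (rule tendsto_mult[OF tendsto_divide[OF tendsto_divide[OF s1 l4] tendsto_mult[OF s2 l4]]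
          tendsto_divide[OF isCont_tendsto_compose[OF W(1) l1] isCont_tendsto_compose[OF W(1) l3]]])
       (use sR W(2) in simp_all)
  moreover have "(s_model k R ^ m / 1) / (s_model k R ^ m * 1) * (W R / W R) = 1" using sR W(2) by simp
  ultimately have "(gain_const m W k R \<longlongrightarrow> 1) ?F" by simp
  then have "\<forall>\<^sub>F e in at_right 0. q < gain_const m W k R e" using q by (rule order_tendstoD(1))
  moreover have "\<forall>\<^sub>F e in at_right 0. 2 * e < R"
    unfolding eventually_at_right_field using R by (intro exI[of _ "R / 2"]) auto
  moreover have "\<forall>\<^sub>F e in at_right (0::real). 0 < e" by (rule eventually_at_right_less)
  ultimately have "\<forall>\<^sub>F e in at_right 0. 0 < e \<and> 2 * e < R \<and> q < gain_const m W k R e"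
    by eventually_elim simp
  then show ?thesis using eventually_happens'[of "at_right (0::real)"] by force
qed

text \<open>For the equality case: a vanishing integral of the gain forces it to vanish in every
  direction. The point \<open>y\<close> at radius 1/2 leaves room for a ball inside the unit ball on
  which the integrand stays above half of \<open>u x0\<close>.\<close>

lemma integral_sgn_pos:
  fixes u :: "'a::euclidean_space \<Rightarrow> real"
  assumes u: "continuous_on (sphere 0 1) u" and nonneg: "\<And>x. 0 \<le> u x"
    and x0: "norm x0 = 1" "0 < u x0"
  shows "0 < integral (ball 0 1) (\<lambda>x. u (sgn x))"
proof -
  define y where "y = (1/2) *\<^sub>R x0"
  have y: "norm y = 1/2" "y \<noteq> 0" "sgn y = x0" using x0 by (auto simp: y_def sgn_scaleR sgn_div_norm)
  have "isCont (\<lambda>x. u (sgn x)) y"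
    using continuous_on_sgn_compose[OF u] y(2) by (simp add: continuous_on_eq_continuous_at open_Compl)
  then obtain d where d: "d > 0" "\<And>x. dist x y < d \<Longrightarrow> dist (u (sgn x)) (u (sgn y)) < u x0 / 2"
    using x0(2) unfolding continuous_at_eps_delta by (metis half_gt_zero)
  define r where "r = min d (1/2)"
  have r: "r > 0" using d(1) by (simp add: r_def)
  have sub: "ball y r \<subseteq> ball 0 1"
  proof
    fix x assume "x \<in> ball y r"
    then have "norm (x - y) < 1/2" by (simp add: r_def dist_norm norm_minus_commute)
    then show "x \<in> ball 0 1" using y(1) norm_triangle_ineq[of "x - y" y] by simp
  qed
  have i: "(\<lambda>x. u (sgn x)) integrable_on S" if "S \<in> lmeasurable" "bounded S" for S
    using integrable_sgn_radial[OF u, of "\<lambda>_. 1", OF _ that] by simp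
  have lb: "u x0 / 2 \<le> u (sgn x)" if "x \<in> ball y r" for x
  proof -
    have "dist (u (sgn x)) (u x0) < u x0 / 2"
      using d(2)[of x] that y(3) by (simp add: r_def dist_commute)
    then show ?thesis unfolding dist_real_def by linarith
  qed
  have "0 < measure lebesgue (ball y r) * (u x0 / 2)"
    using r x0(2) content_ball_pos[of r y] by simp
  also have "\<dots> = integral (ball y r) (\<lambda>x. 1) * (u x0 / 2)" by (simp only: lmeasure_integral[OF lmeasurable_ball])
  also have "\<dots> = integral (ball y r) (\<lambda>x. 1 * (u x0 / 2))" by (rule integral_mult_left[symmetric])
  also have "\<dots> \<le> integral (ball y r) (\<lambda>x. u (sgn x))"
    using lb by (intro integral_le integrable_on_const i) auto
  also have "\<dots> \<le> integral (ball 0 1) (\<lambda>x. u (sgn x))"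
    by (intro integral_subset_le sub i ballI nonneg) auto
  finally show ?thesis .
qed

text \<open>Inserting the bounds reduces the quotient of the two ratios to (1 + c z)^n / (1 + z)^(n
  - 1), which exceeds 1 strictly for z > 0 by \<open>bernoulli_isoperimetric\<close>. Strictness is
  what detects equality.\<close>

lemma isoperimetric_conclusion:
  fixes Bg Bd Vg Vd z c :: real
  assumes n: "n \<ge> 1" and pos: "0 < Bd" "0 < Vd" "0 < Vg" and z: "0 \<le> z" and c: "(real n - 1) / n < c"
    and B: "Bd * (1 + c * z) \<le> Bg" and V: "Vg \<le> Vd * (1 + z)"
  shows "Bd ^ n / Vd ^ (n - 1) \<le> Bg ^ n / Vg ^ (n - 1)"
    and "Bg ^ n / Vg ^ (n - 1) = Bd ^ n / Vd ^ (n - 1) \<Longrightarrow> z = 0"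
proof -
  have c0: "0 \<le> c" using c n by (metis diff_ge_0_iff_ge divide_nonneg_nonneg less_imp_le of_nat_0_le_iff of_nat_1 of_nat_le_iff order_trans)
  have up: "(Bd * (1 + c * z)) ^ n / (Vd * (1 + z)) ^ (n - 1) \<le> Bg ^ n / Vg ^ (n - 1)"
  proof -
    have "0 \<le> Bd * (1 + c * z)" using pos z c0 by simp
    then show ?thesis using pos z B V by (intro frac_le power_mono zero_le_power zero_less_power) auto
  qed
  have eq: "(Bd * (1 + c * z)) ^ n / (Vd * (1 + z)) ^ (n - 1) = (Bd ^ n / Vd ^ (n - 1)) * ((1 + c * z) ^ n / (1 + z) ^ (n - 1))"
    by (simp add: power_mult_distrib)
  have I: "0 < Bd ^ n / Vd ^ (n - 1)" using pos by simp
  have strict: "Bd ^ n / Vd ^ (n - 1) < Bg ^ n / Vg ^ (n - 1)" if "z \<noteq> 0"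
  proof -
    have z0: "0 < z" using z that by simp
    have "(1 + z) ^ (n - 1) < (1 + c * z) ^ n" by (rule bernoulli_isoperimetric[OF n z0 c])
    then have "1 < (1 + c * z) ^ n / (1 + z) ^ (n - 1)" using z0 by (simp add: less_divide_eq)
    then have "Bd ^ n / Vd ^ (n - 1) * 1 < (Bd ^ n / Vd ^ (n - 1)) * ((1 + c * z) ^ n / (1 + z) ^ (n - 1))"
      using I by (rule mult_strict_left_mono)
    then show ?thesis using up unfolding eq by simp
  qed
  show "Bd ^ n / Vd ^ (n - 1) \<le> Bg ^ n / Vg ^ (n - 1)"
  proof (cases "z = 0")
    case True
    then show ?thesis using up by simp
  qed (use strict in simp)
  show "Bg ^ n / Vg ^ (n - 1) = Bd ^ n / Vd ^ (n - 1) \<Longrightarrow> z = 0" using strict by force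
qed

context star_metric
begin

definition dens_g where
  "dens_g \<theta> = s_model k (rad \<theta>) ^ (CARD('n) - 1) * sqrt (det (Mx (bp \<theta>) + outer ((1 / s_model k (rad \<theta>)) *\<^sub>R rgrad \<theta>)))"

definition dens_d where
  "dens_d \<theta> = s_model k (rad \<theta>) ^ (CARD('n) - 1) * sqrt (1 + slope2 \<theta>)"

text \<open>The excess \<mu> of the density ratio over 1 at the boundary. The value 0 off the unit
  sphere makes it nonnegative everywhere, as \<open>radial_integral_product\<close> demands, also at
  \<open>sgn 0 = 0\<close>.\<close>

definition gain where
  "gain \<theta> = (if norm \<theta> = 1 then lam (bp \<theta>) - 1 else 0)"

lemma gain_nonneg: "k \<le> 0 \<Longrightarrow> 0 \<le> gain \<theta>"
  using lam_ge_1[of "bp \<theta>"] boundary_facts[of \<theta>] by (simp add: gain_def)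

text \<open>The integrands agree at unit vectors, so the point 0, where \<open>sgn\<close> is not a
  unit vector, is spiked out.\<close>

lemma boundary_volume_eq:
  assumes k: "k \<le> 0"
  shows "riem_boundary_volume Om (gbar g) = real CARD('n) * integral (ball 0 1) (\<lambda>x. dens_g (sgn x))"
    and "riem_boundary_volume Om (delta_metric k) = real CARD('n) * integral (ball 0 1) (\<lambda>x. dens_d (sgn x))"
  unfolding riem_boundary_volume_def hypersurface_volume_def sphere_integral_def
  by (intro arg_cong2[of _ _ _ _ "(*)"] refl integral_spike[of "{0}"],
      simp, simp add: dens_g_def dens_d_def hypersurface_integrand[OF _ k] norm_sgn)+

lemma continuous_sphere:
  assumes k: "k \<le> 0"
  shows "continuous_on (sphere 0 1) bp" "continuous_on (sphere 0 1) rad"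
    "continuous_on (sphere 0 1) (\<lambda>\<theta>. s_model k (rad \<theta>))"
    "continuous_on (sphere 0 1) (\<lambda>\<theta>. rgrad \<theta> $ i)"
    "continuous_on (sphere 0 1) (\<lambda>\<theta>. Mx (bp \<theta>) $ i $ j)"
proof -
  show bpc: "continuous_on (sphere 0 1) bp" by (rule continuous_on_subset[OF continuous_on_bp]) auto
  then show radc: "continuous_on (sphere 0 1) rad" unfolding rad_def by (intro continuous_intros)
  have s: "continuous_on UNIV (s_model k)" "continuous_on UNIV (s_quot k)"
    using isCont_s_model[OF k] s_quot_continuous[OF k] by (auto intro: continuous_at_imp_continuous_on)
  show "continuous_on (sphere 0 1) (\<lambda>\<theta>. s_model k (rad \<theta>))"
    by (rule continuous_on_compose2[OF s(1) radc]) auto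
  have sq: "continuous_on (sphere 0 1) (\<lambda>\<theta>. s_quot k (rad \<theta>))"
    by (rule continuous_on_compose2[OF s(2) radc]) auto
  show "continuous_on (sphere 0 1) (\<lambda>\<theta>. rgrad \<theta> $ i)"
    unfolding rgrad_def vec_lambda_beta by (rule continuous_on_subset[OF rad_C1(2)]) auto
  have "continuous_on (sphere 0 1) (\<lambda>\<theta>. gbar g (bp \<theta>))"
    by (rule continuous_on_compose2[OF gbar_continuous bpc]) (auto intro: bp_Om)
  then have "continuous_on (sphere 0 1) (\<lambda>\<theta>. \<theta> $ i * \<theta> $ j + (1 / (s_quot k (rad \<theta>))\<^sup>2) * (gbar g (bp \<theta>) $ i $ j - \<theta> $ i * \<theta> $ j))"
  proof (intro continuous_intros sq)
    show "\<forall>\<theta>\<in>sphere 0 1. (s_quot k (rad \<theta>))\<^sup>2 \<noteq> 0"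
      using s_quot_ge_1[OF k] boundary_facts(5) by (metis less_imp_le mem_sphere_0 not_one_le_zero power_eq_0_iff)
  qed auto
  then show "continuous_on (sphere 0 1) (\<lambda>\<theta>. Mx (bp \<theta>) $ i $ j)"
    by (rule continuous_on_eq) (simp add: Mx_def nmat_def outer_def boundary_facts)
qed

lemma continuous_densities:
  assumes k: "k \<le> 0"
  shows "continuous_on (sphere 0 1) dens_g" "continuous_on (sphere 0 1) dens_d" "continuous_on (sphere 0 1) gain"
proof -
  note c = continuous_sphere[OF k]
  have s0: "\<forall>\<theta>\<in>sphere 0 1. s_model k (rad \<theta>) \<noteq> 0"
    using s_model_pos[OF k boundary_facts(5)] by force
  have o: "outer v $ i $ j = v $ i * v $ j" for v :: "real^'n" and i j by (simp add: outer_def)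
  show "continuous_on (sphere 0 1) dens_g"
    unfolding dens_g_def vector_add_component o vector_scaleR_component
    by (intro continuous_on_mult continuous_on_power c continuous_on_real_sqrt continuous_on_det)
       (simp only: vector_add_component o vector_scaleR_component real_scaleR_def,
        intro continuous_on_add continuous_on_mult continuous_on_divide continuous_on_const c s0)
  show "continuous_on (sphere 0 1) dens_d"
    unfolding dens_d_def slope2_def inner_vec_def inner_real_def
    by (intro continuous_on_mult continuous_on_power c continuous_on_real_sqrt continuous_on_add continuous_on_const
        continuous_on_divide continuous_on_sum) (use s0 in auto)
  have "continuous_on (sphere 0 1) (\<lambda>\<theta>. lam (bp \<theta>) - 1)"
    unfolding lam_def by (intro continuous_on_diff continuous_on_real_sqrt continuous_on_det c continuous_on_const)
  then show "continuous_on (sphere 0 1) gain"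
    by (rule continuous_on_eq) (simp add: gain_def)
qed

text \<open>The excess of boundary area is at least n \<open>amin\<close> I, and the excess of
  volume at most z times the model volume, with z proportional to the same I. Comparing the two
  gives the constant \<open>c\<close>, which is the value of \<open>gain_const\<close>.\<close>

lemma isoperimetric_comparison:
  assumes k: "k \<le> 0" and R: "R > 0" and n: "CARD('n) \<ge> 2" and \<epsilon>: "0 < \<epsilon>" "2 * \<epsilon> < R"
    and gc: "(real CARD('n) - 1) / CARD('n) < gain_const (CARD('n) - 1) (radial_integral (\<lambda>x::real^'n. 1) (\<lambda>r. s_quot k r ^ (CARD('n) - 1))) k R \<epsilon>"
    and C1: "C1_norm_sphere (\<lambda>\<theta>. radial_fun g \<theta> - R) \<le> \<epsilon>"
  shows "isoperimetric_ratio Om (delta_metric k) \<le> isoperimetric_ratio Om (gbar g)"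
    and "isoperimetric_ratio Om (gbar g) = isoperimetric_ratio Om (delta_metric k) \<Longrightarrow> x \<in> Om \<Longrightarrow> gbar g x = delta_metric k x"
proof -
  let ?n = "CARD('n)" and ?m = "CARD('n) - 1"
  define \<rho> where "\<rho> = (\<lambda>r. s_quot k r ^ ?m)"
  define W0 where "W0 = radial_integral (\<lambda>x::real^'n. 1) \<rho>"
  define I where "I = integral (ball 0 1) (\<lambda>x. gain (sgn x))"
  define J where "J = integral (ball (0::real^'n) 1) (\<lambda>x. 1::real)"
  define p where "p = 1 + (2 * \<epsilon> / R)\<^sup>2"
  \<comment> \<open>\<open>amin\<close> bounds from below the weight with which the gain enters
    \<open>dens_g\<close>; \<open>bmax\<close> bounds \<open>dens_d\<close> from above.\<close>
  define amin where "amin = s_model k (R - \<epsilon>) ^ ?m / sqrt p"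
  define bmax where "bmax = s_model k (R + \<epsilon>) ^ ?m * sqrt p"
  \<comment> \<open>The volume excess is at most (I / J) W0 (R + 2 \<epsilon>) and the model volume
    at least W0 (R - \<epsilon>); \<open>z\<close> is the quotient of these bounds. The last factor
    of \<open>c\<close> is the reciprocal of the one in \<open>z\<close>, so that c z bmax J = amin
    I.\<close>
  define z where "z = I / J * (W0 (R + 2 * \<epsilon>) / W0 (R - \<epsilon>))"
  define c where "c = amin / bmax * (W0 (R - \<epsilon>) / W0 (R + 2 * \<epsilon>))"
  have c_gain: "(real ?n - 1) / ?n < c"
    using gc by (simp add: c_def amin_def bmax_def p_def gain_const_def W0_def \<rho>_def)
  have Re: "0 < R - \<epsilon>" "R / 2 \<le> R - \<epsilon>" using \<epsilon> by auto
  have \<rho>1: "1 \<le> \<rho> t" if "0 \<le> t" for t using s_quot_ge_1[OF k that] by (simp add: \<rho>_def one_le_power)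
  have \<rho>c: "continuous_on {0..} \<rho>"
    unfolding \<rho>_def by (intro continuous_at_imp_continuous_on ballI continuous_intros s_quot_continuous[OF k])
  have W0: "0 < W0 r" if "0 < r" for r unfolding W0_def by (rule radial_integral_pos[OF \<rho>c \<rho>1 that])
  have J: "0 < J" unfolding J_def by (rule integral_ball_1_pos)
  have p: "1 \<le> p" by (simp add: p_def)
  have sm: "0 < s_model k (R - \<epsilon>)" "0 < s_model k (R + \<epsilon>)" using s_model_pos[OF k] Re \<epsilon> by auto
  have ab: "0 < amin" "0 < bmax" using sm p by (auto simp: amin_def bmax_def)
  note cd = continuous_densities[OF k]
  have g0: "0 \<le> gain \<theta>" for \<theta> by (rule gain_nonneg[OF k])
  have int: "(\<lambda>x. u (sgn x)) integrable_on ball 0 1" if "continuous_on (sphere 0 1) u" for u :: "real^'n \<Rightarrow> real"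
    using integrable_sgn_radial[OF that, of "\<lambda>_. 1" "ball 0 1"] by simp
  have I0: "0 \<le> I" unfolding I_def by (intro integral_nonneg int cd g0)
  have rad_bounds: "R - \<epsilon> \<le> rad \<theta>" "rad \<theta> \<le> R + \<epsilon>" "slope2 \<theta> \<le> (2 * \<epsilon> / R)\<^sup>2" if \<theta>: "norm \<theta> = 1" for \<theta>
  proof -
    have "\<bar>rad \<theta> - R\<bar> \<le> \<epsilon>" by (rule C1_norm_bounds(1)[OF C1 \<theta>])
    then show r: "R - \<epsilon> \<le> rad \<theta>" "rad \<theta> \<le> R + \<epsilon>" by auto
    have \<theta>0: "\<theta> \<noteq> 0" using \<theta> by auto
    \<comment> \<open>The derivative bound is tested on the gradient itself, which gives norm at
      most \<epsilon>; division by \<open>s_model k (rad \<theta>)\<close>, at least R / 2, bounds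
      the slope.\<close>
    have "rgrad \<theta> \<bullet> rgrad \<theta> \<le> \<epsilon> * norm (rgrad \<theta>)"
      using C1_norm_bounds(2)[OF C1 \<theta>, of "rgrad \<theta>"] by (simp add: rgrad_inner[OF \<theta>0, symmetric])
    then have "norm (rgrad \<theta>) * norm (rgrad \<theta>) \<le> \<epsilon> * norm (rgrad \<theta>)" by (simp add: norm_eq_sqrt_inner)
    then have "norm (rgrad \<theta>) \<le> \<epsilon>" using \<epsilon> by (metis less_imp_le mult_right_le_imp_le norm_ge_zero order_le_less)
    moreover have "R / 2 \<le> s_model k (rad \<theta>)" using s_model_ge[OF k, of "rad \<theta>"] r Re by linarith
    ultimately have "norm (rgrad \<theta>) / s_model k (rad \<theta>) \<le> \<epsilon> / (R / 2)" using R \<epsilon> by (intro frac_le) auto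
    moreover have "0 \<le> norm (rgrad \<theta>) / s_model k (rad \<theta>)" using \<open>R / 2 \<le> s_model k (rad \<theta>)\<close> R by simp
    ultimately have "(norm (rgrad \<theta>) / s_model k (rad \<theta>))\<^sup>2 \<le> (\<epsilon> / (R / 2))\<^sup>2" by (rule power_mono)
    then show "slope2 \<theta> \<le> (2 * \<epsilon> / R)\<^sup>2"
      by (simp add: slope2_def power_divide power2_norm_eq_inner mult.commute)
  qed
  have dens: "dens_d \<theta> + amin * gain \<theta> \<le> dens_g \<theta>" "dens_d \<theta> \<le> bmax" "s_model k (R - \<epsilon>) ^ ?m \<le> dens_d \<theta>" if \<theta>: "norm \<theta> = 1" for \<theta>
  proof -
    note rb = rad_bounds[OF \<theta>]
    have s: "s_model k (R - \<epsilon>) \<le> s_model k (rad \<theta>)" "s_model k (rad \<theta>) \<le> s_model k (R + \<epsilon>)"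
      using rb s_model_mono[OF k] by auto
    then have sp: "s_model k (R - \<epsilon>) ^ ?m \<le> s_model k (rad \<theta>) ^ ?m" "s_model k (rad \<theta>) ^ ?m \<le> s_model k (R + \<epsilon>) ^ ?m"
      using sm by (auto intro!: power_mono)
    have s0: "0 < s_model k (rad \<theta>) ^ ?m" using s(1) sm by simp
    have sl: "0 \<le> slope2 \<theta>" by (simp add: slope2_def)
    have sq: "1 \<le> sqrt (1 + slope2 \<theta>)" "sqrt (1 + slope2 \<theta>) \<le> sqrt p" using rb(3) sl by (auto simp: p_def)
    have "amin \<le> s_model k (rad \<theta>) ^ ?m / sqrt (1 + slope2 \<theta>)"
      unfolding amin_def using sp(1) sq s0 by (intro frac_le) auto
    then have "amin * gain \<theta> \<le> s_model k (rad \<theta>) ^ ?m / sqrt (1 + slope2 \<theta>) * gain \<theta>"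
      using g0 by (rule mult_right_mono)
    also have "\<dots> = s_model k (rad \<theta>) ^ ?m * ((lam (bp \<theta>) - 1) / sqrt (1 + slope2 \<theta>))" using \<theta> by (simp add: gain_def)
    finally have "dens_d \<theta> + amin * gain \<theta> \<le> s_model k (rad \<theta>) ^ ?m * (sqrt (1 + slope2 \<theta>) + (lam (bp \<theta>) - 1) / sqrt (1 + slope2 \<theta>))"
      by (simp add: dens_d_def distrib_left)
    also have "\<dots> \<le> dens_g \<theta>"
      unfolding dens_g_def using s0 by (intro mult_left_mono boundary_gain[OF \<theta> k]) auto
    finally show "dens_d \<theta> + amin * gain \<theta> \<le> dens_g \<theta>" .
    show "dens_d \<theta> \<le> bmax" unfolding dens_d_def bmax_def using sp(2) sq s0 sm by (intro mult_mono) auto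
    show "s_model k (R - \<epsilon>) ^ ?m \<le> dens_d \<theta>"
      unfolding dens_d_def using sp(1) mult_mono[OF sp(1) sq(1)] s0 by simp
  qed
  define Bg where "Bg = riem_boundary_volume Om (gbar g)"
  define Bd where "Bd = riem_boundary_volume Om (delta_metric k)"
  define Vg where "Vg = riem_volume Om (gbar g)"
  define Vd where "Vd = riem_volume Om (delta_metric k)"
  \<comment> \<open>The density estimates hold at unit vectors, hence for all \<open>sgn x\<close>
    except at the origin.\<close>
  have le_off_0: "integral (ball 0 1) (\<lambda>x. u (sgn x)) \<le> integral (ball 0 1) (\<lambda>x. v (sgn x))"
    if "continuous_on (sphere 0 1) u" "continuous_on (sphere 0 1) v" "\<And>\<theta>. norm \<theta> = 1 \<Longrightarrow> u \<theta> \<le> v \<theta>" for u v :: "real^'n \<Rightarrow> real"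
  proof -
    have "integral (ball 0 1) (\<lambda>x. u (sgn x)) = integral (ball 0 1) (\<lambda>x. if x = 0 then v (sgn x) else u (sgn x))"
      by (rule integral_spike[of "{0}"]) auto
    also have "\<dots> \<le> integral (ball 0 1) (\<lambda>x. v (sgn x))"
    proof (rule integral_le[OF _ int[OF that(2)]])
      show "(\<lambda>x. if x = 0 then v (sgn x) else u (sgn x)) integrable_on ball 0 1"
        by (rule integrable_spike[OF int[OF that(1)], of "{0}"]) auto
    qed (use that(3) in \<open>auto simp: norm_sgn\<close>)
    finally show ?thesis .
  qed
  have Bg: "Bd + ?n * (amin * I) \<le> Bg"
  proof -
    have "integral (ball 0 1) (\<lambda>x. dens_d (sgn x) + amin * gain (sgn x)) \<le> integral (ball 0 1) (\<lambda>x. dens_g (sgn x))"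
      using le_off_0[of "\<lambda>\<theta>. dens_d \<theta> + amin * gain \<theta>" dens_g] dens(1) by (simp add: cd continuous_intros)
    moreover have "integral (ball 0 1) (\<lambda>x. dens_d (sgn x) + amin * gain (sgn x)) = integral (ball 0 1) (\<lambda>x. dens_d (sgn x)) + amin * I"
      unfolding I_def using integral_add[OF int[OF cd(2)] integrable_on_cmult_left[OF int[OF cd(3)], of amin]] by simp
    ultimately have "?n * (integral (ball 0 1) (\<lambda>x. dens_d (sgn x)) + amin * I) \<le> ?n * integral (ball 0 1) (\<lambda>x. dens_g (sgn x))"
      by (simp add: mult_left_mono)
    then show ?thesis by (simp add: Bg_def Bd_def boundary_volume_eq[OF k] distrib_left)
  qed
  have const: "integral (ball (0::real^'n) 1) (\<lambda>x. b) = b * J" for b :: real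
    unfolding J_def using integral_mult_right[of "ball (0::real^'n) 1" b "\<lambda>x. 1::real"] by simp
  have Bd_le: "Bd \<le> ?n * (bmax * J)"
    unfolding Bd_def boundary_volume_eq[OF k]
    using le_off_0[of dens_d "\<lambda>_. bmax"] dens(2) cd(2) const[of bmax] by (intro mult_left_mono) auto
  have Bd_pos: "0 < Bd"
  proof -
    have "0 < ?n * (s_model k (R - \<epsilon>) ^ ?m * J)" using sm J by simp
    also have "\<dots> \<le> Bd"
      unfolding Bd_def boundary_volume_eq[OF k]
      using le_off_0[of "\<lambda>_. s_model k (R - \<epsilon>) ^ ?m" dens_d] dens(3) cd(2) const[of "s_model k (R - \<epsilon>) ^ ?m"] by (intro mult_left_mono) auto
    finally show ?thesis .
  qed
  have Om_m: "Om \<in> lmeasurable" "bounded Om" using Om_compact by (auto intro: lmeasurable_compact compact_imp_bounded)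
  have b1: "ball 0 (R - \<epsilon>) \<subseteq> Om"
  proof
    fix y :: "real^'n" assume y: "y \<in> ball 0 (R - \<epsilon>)"
    show "y \<in> Om"
    proof (cases "y = 0")
      case False
      then show ?thesis using y rad_bounds(1)[of "sgn y"] by (simp add: Om_iff_rad rad_sgn norm_sgn)
    qed (use zero_W W_sub in auto)
  qed
  \<comment> \<open>The boundary may touch the sphere of radius R + \<epsilon>; the extra \<epsilon>
    lets an open ball contain \<open>Om\<close>.\<close>
  have b2: "Om \<subseteq> ball 0 (R + 2 * \<epsilon>)"
  proof
    fix y assume y: "y \<in> Om"
    show "y \<in> ball 0 (R + 2 * \<epsilon>)"
    proof (cases "y = 0")
      case False
      then show ?thesis using y rad_bounds(2)[of "sgn y"] \<epsilon> by (simp add: Om_iff_rad rad_sgn norm_sgn)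
    qed (use R \<epsilon> in auto)
  qed
  have Vd_eq: "Vd = integral Om (\<lambda>x. \<rho> (norm x))"
    by (simp add: Vd_def riem_volume_def sqrt_det_delta[OF k] \<rho>_def)
  have i\<rho>: "(\<lambda>x. \<rho> (norm x)) integrable_on S" if "S \<in> lmeasurable" "bounded S" for S :: "(real^'n) set"
    using integrable_sgn_radial[of "\<lambda>x::real^'n. 1" \<rho> S] \<rho>c that by simp
  have ig: "(\<lambda>x. gain (sgn x) * \<rho> (norm x)) integrable_on S" if "S \<in> lmeasurable" "bounded S" for S :: "(real^'n) set"
    by (rule integrable_sgn_radial[OF cd(3) \<rho>c that])
  have Vd_ge: "W0 (R - \<epsilon>) \<le> Vd"
    unfolding Vd_eq W0_def radial_integral_def mult_1
    by (intro integral_subset_le b1 i\<rho> Om_m) (use \<rho>1 in \<open>auto intro: order_trans[OF zero_le_one]\<close>)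
  have Vd_pos: "0 < Vd" using Vd_ge W0[OF Re(1)] by linarith
  \<comment> \<open>Replacing the density ratio by its boundary value turns the volume excess into
    an angular times a radial function, the form that \<open>radial_integral_product\<close>
    evaluates.\<close>
  have lam_le: "sqrt (det (gbar g x)) \<le> \<rho> (norm x) + gain (sgn x) * \<rho> (norm x)" if x: "x \<in> Om" for x
  proof (cases "x = 0")
    case True
    then show ?thesis using g0[of 0] by (simp add: gbar_0 \<rho>_def s_quot_def)
  next
    case False
    have "lam x \<le> 1 + gain (sgn x)" using lam_mono[OF x False k] False by (simp add: gain_def norm_sgn bp_sgn)
    then have "\<rho> (norm x) * lam x \<le> \<rho> (norm x) * (1 + gain (sgn x))" using \<rho>1[of "norm x"] by (intro mult_left_mono) auto
    then show ?thesis using sqrt_det_gbar[OF x False k] by (simp add: \<rho>_def algebra_simps)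
  qed
  have lam_ge: "\<rho> (norm x) \<le> sqrt (det (gbar g x))" if x: "x \<in> Om" for x
  proof (cases "x = 0")
    case True
    then show ?thesis by (simp add: gbar_0 \<rho>_def s_quot_def)
  next
    case False
    have "\<rho> (norm x) * 1 \<le> \<rho> (norm x) * lam x" using \<rho>1[of "norm x"] lam_ge_1[OF x False k] by (intro mult_left_mono) auto
    then show ?thesis using sqrt_det_gbar[OF x False k] by (simp add: \<rho>_def)
  qed
  have igbar: "(\<lambda>x. sqrt (det (gbar g x))) integrable_on Om"
  proof -
    have c: "continuous_on Om (\<lambda>x. sqrt (det (gbar g x)))"
      by (intro continuous_on_real_sqrt continuous_on_det continuous_intros gbar_continuous)
    then have "bounded ((\<lambda>x. sqrt (det (gbar g x))) ` Om)"
      by (intro compact_imp_bounded compact_continuous_image Om_compact)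
    then obtain B where "\<forall>y\<in>(\<lambda>x. sqrt (det (gbar g x))) ` Om. norm y \<le> B" unfolding bounded_iff by blast
    then have "(\<lambda>x. sqrt (det (gbar g x))) absolutely_integrable_on Om"
      by (intro absolutely_integrable_continuous_except_0[OF Om_m(1), where B=B] continuous_on_subset[OF c]) auto
    then show ?thesis by (rule set_lebesgue_integral_eq_integral(1))
  qed
  have Vg_ge: "Vd \<le> Vg"
    unfolding Vd_eq Vg_def riem_volume_def by (intro integral_le i\<rho> Om_m igbar lam_ge)
  have prod: "radial_integral gain \<rho> (R + 2 * \<epsilon>) * J = W0 (R + 2 * \<epsilon>) * I"
    unfolding J_def W0_def I_def by (rule radial_integral_product[OF cd(3) g0 \<rho>c]) (use R \<epsilon> in simp)
  have Vg_le: "Vg \<le> Vd * (1 + z)"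
  proof -
    have "Vg \<le> integral Om (\<lambda>x. \<rho> (norm x) + gain (sgn x) * \<rho> (norm x))"
      unfolding Vg_def riem_volume_def by (intro integral_le igbar integrable_add i\<rho> ig Om_m lam_le)
    also have "\<dots> = Vd + integral Om (\<lambda>x. gain (sgn x) * \<rho> (norm x))"
      unfolding Vd_eq by (intro integral_add i\<rho> ig Om_m)
    also have "integral Om (\<lambda>x. gain (sgn x) * \<rho> (norm x)) \<le> radial_integral gain \<rho> (R + 2 * \<epsilon>)"
      unfolding radial_integral_def
      by (intro integral_subset_le b2 ig Om_m) (use g0 \<rho>1 in \<open>auto intro!: mult_nonneg_nonneg intro: order_trans[OF zero_le_one]\<close>)
    also have "radial_integral gain \<rho> (R + 2 * \<epsilon>) = z * W0 (R - \<epsilon>)"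
      using prod J W0[OF Re(1)] by (simp add: z_def field_simps)
    also have "z * W0 (R - \<epsilon>) \<le> z * Vd"
      using Vd_ge I0 J W0[OF Re(1)] W0[of "R + 2 * \<epsilon>"] R \<epsilon> by (intro mult_left_mono) (auto simp: z_def)
    finally show ?thesis by (simp add: algebra_simps)
  qed
  have z0: "0 \<le> z" using I0 J W0[OF Re(1)] W0[of "R + 2 * \<epsilon>"] R \<epsilon> by (simp add: z_def)
  have Bg_ge: "Bd * (1 + c * z) \<le> Bg"
  proof -
    have cz: "c * z * (bmax * J) = amin * I"
      using ab J W0[OF Re(1)] W0[of "R + 2 * \<epsilon>"] R \<epsilon> by (simp add: c_def z_def)
    have "0 \<le> c * z"
      using z0 ab W0[OF Re(1)] W0[of "R + 2 * \<epsilon>"] R \<epsilon> by (simp add: c_def)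
    then have "c * z * Bd \<le> c * z * (?n * (bmax * J))" by (rule mult_left_mono[OF Bd_le])
    also have "\<dots> = ?n * (c * z * (bmax * J))" by (simp only: mult.left_commute)
    also have "\<dots> = ?n * (amin * I)" by (simp only: cz)
    finally have "c * z * Bd \<le> ?n * (amin * I)" .
    then show ?thesis using Bg by (simp add: algebra_simps)
  qed
  have ratio: "isoperimetric_ratio Om (gbar g) = Bg ^ ?n / Vg ^ (?n - 1)"
    "isoperimetric_ratio Om (delta_metric k) = Bd ^ ?n / Vd ^ (?n - 1)"
    by (simp_all add: isoperimetric_ratio_def Bg_def Bd_def Vg_def Vd_def)
  have n1: "1 \<le> ?n" using n by simp
  have Vg_pos: "0 < Vg" using Vd_pos Vg_ge by linarith
  note concl = isoperimetric_conclusion[OF n1 Bd_pos Vd_pos Vg_pos z0 c_gain Bg_ge Vg_le]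
  show "isoperimetric_ratio Om (delta_metric k) \<le> isoperimetric_ratio Om (gbar g)"
    unfolding ratio by (rule concl(1))
  assume eq: "isoperimetric_ratio Om (gbar g) = isoperimetric_ratio Om (delta_metric k)" and x: "x \<in> Om"
  \<comment> \<open>Equality gives z = 0 and hence I = 0. The gain then vanishes in every direction,
    and \<open>lam x\<close> is squeezed between 1 and its boundary value 1.\<close>
  have "z = 0" by (rule concl(2)) (use eq ratio in simp)
  then have Iz: "I = 0" using J W0[OF Re(1)] W0[of "R + 2 * \<epsilon>"] R \<epsilon> by (simp add: z_def)
  show "gbar g x = delta_metric k x"
  proof (cases "x = 0")
    case True
    then show ?thesis by (simp add: gbar_0 delta_metric_def)
  next
    case False
    have "gain (sgn x) = 0"
    proof (rule ccontr)
      assume "gain (sgn x) \<noteq> 0"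
      then have "0 < gain (sgn x)" using g0[of "sgn x"] by simp
      then have "0 < I" unfolding I_def
        by (intro integral_sgn_pos[OF cd(3) g0, of "sgn x"]) (use False in \<open>auto simp: norm_sgn\<close>)
      then show False using Iz by simp
    qed
    then have "lam (bp x) = 1" using False by (simp add: gain_def norm_sgn bp_sgn)
    then have "lam x = 1" using lam_mono[OF x False k] lam_ge_1[OF x False k] by simp
    then show ?thesis by (rule lam_eq_1[OF x False k])
  qed
qed

end

theorem theorem3p1:
  fixes k R :: real
  assumes "CARD('n::finite) \<ge> 2" and "k \<le> 0" and "R > 0"
  shows "\<exists>\<epsilon>>0. \<forall>g :: 'n metric.
           g \<in> star_metrics_ball k \<and> C1_norm_sphere (\<lambda>\<theta>. radial_fun g \<theta> - R) \<le> \<epsilon> \<longrightarrow>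
             isoperimetric_ratio (Omega g) (gbar g)
               \<ge> isoperimetric_ratio (Omega g) (delta_metric k) \<and>
             (isoperimetric_ratio (Omega g) (gbar g)
                = isoperimetric_ratio (Omega g) (delta_metric k)
              \<longrightarrow> (\<forall>x\<in>Omega g. gbar g x = delta_metric k x))"
proof -
  let ?\<rho> = "\<lambda>r. s_quot k r ^ (CARD('n) - 1)"
  let ?W = "radial_integral (\<lambda>x::real^'n. 1) ?\<rho>"
  have \<rho>: "continuous_on {0..} ?\<rho>"
    by (intro continuous_at_imp_continuous_on ballI continuous_intros s_quot_continuous[OF assms(2)])
  have "isCont ?W R" by (rule radial_integral_continuous[OF \<rho> assms(3)])
  moreover have "0 < ?W R"
    by (rule radial_integral_pos[OF \<rho> _ assms(3)]) (simp add: one_le_power s_quot_ge_1[OF assms(2)])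
  moreover have "(real CARD('n) - 1) / CARD('n) < 1" by simp
  \<comment> \<open>The number \<epsilon> is chosen before any metric: the model volume function
    \<open>?W\<close> involves only n and k.\<close>
  ultimately obtain \<epsilon> where \<epsilon>: "0 < \<epsilon>" "2 * \<epsilon> < R" "(real CARD('n) - 1) / CARD('n) < gain_const (CARD('n) - 1) ?W k R \<epsilon>"
    using gain_const_near_1[OF assms(2,3)] by metis
  show ?thesis
  proof (intro exI[of _ \<epsilon>] conjI allI impI ballI)
    fix g :: "'n metric"
    assume g: "g \<in> star_metrics_ball k \<and> C1_norm_sphere (\<lambda>\<theta>. radial_fun g \<theta> - R) \<le> \<epsilon>"
    then interpret star_metric k g by unfold_locales simp
    note main = isoperimetric_comparison[OF assms(2,3,1) \<epsilon> conjunct2[OF g]]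
    show "isoperimetric_ratio (Omega g) (gbar g) \<ge> isoperimetric_ratio (Omega g) (delta_metric k)" by (rule main(1))
    show "gbar g x = delta_metric k x"
      if "isoperimetric_ratio (Omega g) (gbar g) = isoperimetric_ratio (Omega g) (delta_metric k)" "x \<in> Omega g" for x
      by (rule main(2)[OF that])
  qed (rule \<epsilon>(1))
qed

end
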